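(* Let $T=\mathrm{conv}(\boldsymbol x_1,\boldsymbol x_2,\boldsymbol x_3,\boldsymbol x_4)\subset\mathbb R^3$ be a non-degenerate tetrahedron, with set of edges $\mathcal E(T)$ and set of faces $\mathcal F(T)$, and let the spaces $S_{low},\boldsymbol E_{low},\boldsymbol V_{low},W_{low},S_n^E,S_n^F,S_n^T,\boldsymbol E_n^F,\boldsymbol E_n^T,\boldsymbol V_n^T$ and the families of functions spanning them be as defined in the context. (1) For every integer $n\ge 0$, every edge $E\in\mathcal E(T)$ and every face $F\in\mathcal F(T)$, each of the following families is a basis of the space it spans (i.e. is linearly independent): - $\{\lambda_i\}_{1\le i\le 4}$ (basis of $S_{low}$), $\{\boldsymbol\omega_{ij}\}_{1\le i<j\le 4}$ (basis of $\boldsymbol E_{low}$), $\{\boldsymbol\chi_\ell\}_{1\le \ell\le 4}$ (basis of $\boldsymbol V_{low}$), $\{1\}$ (basis of $W_{low}$); - the families $\{B^n_{\boldsymbol\alpha}\}$ and $\{\nabla B^n_{\boldsymbol\alpha}\}$, with $\boldsymbol\alpha$ ranging over $\mathring{\mathcal I}_3^n(E)$, respectively over $\mathring{\mathcal I}_3^n(F)$, respectively over $\mathring{\mathcal I}_3^n$ (bases of $S_n^E,\nabla S_n^E$; $S_n^F,\nabla S_n^F$; $S_n^T,\nabla S_n^T$); - $\{\boldsymbol\Phi^{FT,n}_{\boldsymbol\alpha}:\boldsymbol\alpha\in\tilde{\mathcal I}_3^n(F)'\}$ and $\{\nabla\times\boldsymbol\Phi^{FT,n}_{\boldsymbol\alpha}:\boldsymbol\alpha\in\tilde{\mathcal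 I}_3^n(F)'\}$ (bases of $\boldsymbol E_n^F$ and $\nabla\times\boldsymbol E_n^F$); - $\{\boldsymbol\Psi^{n}_{\ell,\boldsymbol\alpha}:\ell\in\{1,2\},\boldsymbol\alpha\in\mathring{\mathcal I}_3^{n+1}\}\cup\{\boldsymbol\Psi^{n}_{3,\boldsymbol\alpha}:\boldsymbol\alpha\in\mathring{\mathcal I}_3^{n+1},\alpha_3=1\}$ and the family of the curls of these functions (bases of $\boldsymbol E_n^T$ and $\nabla\times\boldsymbol E_n^T$); - $\{\boldsymbol\Upsilon^n_{\boldsymbol\alpha}:\boldsymbol\alpha\in{\mathcal I_3^n}'\}$ and $\{\nabla\cdot\boldsymbol\Upsilon^n_{\boldsymbol\alpha}:\boldsymbol\alpha\in{\mathcal I_3^n}'\}$ (bases of $\boldsymbol V_n^T$ and $\nabla\cdot\boldsymbol V_n^T$). (2) The following internal direct sum decompositions hold: $$\mathbb P_n=S_{low}\oplus\bigoplus_{E\in\mathcal E(T)}S_n^E\oplus\bigoplus_{F\in\mathcal F(T)}S_n^F\oplus S_n^T\qquad(n\ge1),$$ $$\mathbb P_n^3\oplus\boldsymbol x\times\widetilde{\mathbb P}_n^3=\boldsymbol E_{low}\oplus\bigoplus_{E\in\mathcal E(T)}\nabla S_{n+1}^E\oplus\bigoplus_{F\in\mathcal F(T)}\left(\nabla S_{n+1}^F\oplus\boldsymbol E_n^F\right)\oplus\left(\nabla S_{n+1}^T\oplus\boldsymbol E_{n+1}^T\right)\qquad(n\ge0),$$ $$\mathbb P_n^3=\boldsymbol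 E_{low}\oplus\bigoplus_{E\in\mathcal E(T)}\nabla S_{n+1}^E\oplus\bigoplus_{F\in\mathcal F(T)}\left(\nabla S_{n+1}^F\oplus\boldsymbol E_{n-1}^F\right)\oplus\left(\nabla S_{n+1}^T\oplus\boldsymbol E_n^T\right)\qquad(n\ge1),$$ $$\mathbb P_n^3\oplus\boldsymbol x\,\widetilde{\mathbb P}_n=\boldsymbol V_{low}\oplus\bigoplus_{F\in\mathcal F(T)}\nabla\times\boldsymbol E_n^F\oplus\left(\nabla\times\boldsymbol E_{n+1}^T\oplus\boldsymbol V_n^T\right)\qquad(n\ge0),$$ $$\mathbb P_n^3=\boldsymbol V_{low}\oplus\bigoplus_{F\in\mathcal F(T)}\nabla\times\boldsymbol E_n^F\oplus\left(\nabla\times\boldsymbol E_{n+1}^T\oplus\boldsymbol V_{n-1}^T\right)\qquad(n\ge1),$$ $$\mathbb P_n=W_{low}\oplus\nabla\cdot\boldsymbol V_n^T\qquad(n\ge0).$$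
   Context: **Polynomial spaces.** $\mathbb P_n$ is the space of real polynomials in three variables of total degree at most $n$ (viewed as functions on $T$), $\widetilde{\mathbb P}_n$ the space of homogeneous polynomials of degree $n$, $\mathbb P_n^3$ and $\widetilde{\mathbb P}_n^3$ the spaces of vector fields with three components in $\mathbb P_n$, resp. $\widetilde{\mathbb P}_n$. $\boldsymbol x$ is the position vector, $\boldsymbol x\times\widetilde{\mathbb P}_n^3=\{\boldsymbol x\times\boldsymbol q:\boldsymbol q\in\widetilde{\mathbb P}_n^3\}$, $\boldsymbol x\,\widetilde{\mathbb P}_n=\{q\,\boldsymbol x:q\in\widetilde{\mathbb P}_n\}$. **Barycentric coordinates and Bernstein polynomials.** $\lambda_1,\dots,\lambda_4$ are the barycentric coordinates of $T$: $\boldsymbol x=\sum_k\lambda_k\boldsymbol x_k$, $\sum_k\lambda_k=1$. $\mathcal I_3^n=\{\boldsymbol\alpha\in\mathbb Z_{\ge0}^4:|\boldsymbol\alpha|=\alpha_1+\alpha_2+\alpha_3+\alpha_4=n\}$; $\boldsymbol e_\ell$ is the $\ell$-th unit multi-index. For $\boldsymbol\alpha\in\mathcal I_3^n$, $B^n_{\boldsymbol\alpha}=\frac{n!}{\alpha_1!\alpha_2!\alpha_3!\alpha_4!}\lambda_1^{\alpha_1}\lambda_2^{\alpha_2}\lambda_3^{\alpha_3}\lambda_4^{\alpha_4}$. **Index sets.** For an edge $E=\mathrm{conv}(\boldsymbol x_{e_1},\boldsymbol x_{e_2})$: $\mathring{\mathcal I}_3^n(E)=\{\boldsymbol\alpha\in\mathcal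 I_3^n:\alpha_i>0\text{ if }i\in\{e_1,e_2\},\ \alpha_i=0\text{ otherwise}\}$. For a face $F=\mathrm{conv}(\boldsymbol x_{f_1},\boldsymbol x_{f_2},\boldsymbol x_{f_3})$: $\mathring{\mathcal I}_3^n(F)=\{\boldsymbol\alpha\in\mathcal I_3^n:\alpha_i>0\text{ if }i\in\{f_1,f_2,f_3\},\ \alpha_i=0\text{ otherwise}\}$ and $\tilde{\mathcal I}_3^n(F)=\{\boldsymbol\alpha\in\mathcal I_3^n:\alpha_i=0\text{ for }i\notin\{f_1,f_2,f_3\}\}$. $\mathring{\mathcal I}_3^n=\{\boldsymbol\alpha\in\mathcal I_3^n:\alpha_i>0\text{ for all }i\}$. $\tilde{\mathcal I}_3^n(F)'$ denotes $\tilde{\mathcal I}_3^n(F)$ with a single, arbitrarily chosen, index removed, and ${\mathcal I_3^n}'$ denotes $\mathcal I_3^n$ with a single, arbitrarily chosen, index removed; the result holds for any such choices. **Functions.** - $\boldsymbol\omega_{ij}=\lambda_i\nabla\lambda_j-\lambda_j\nabla\lambda_i$ for $i,j\in\{1,2,3,4\}$. - $\boldsymbol\chi_\ell=\lambda_i\nabla\lambda_j\times\nabla\lambda_k-\lambda_j\nabla\lambda_i\times\nabla\lambda_k+\lambda_k\nabla\lambda_i\times\nabla\lambda_j$, where $i<j<k$ and $\{i,j,k,\ell\}=\{1,2,3,4\}$. - For a face $F=\mathrm{conv}(\boldsymbol x_{i_1},\boldsymbol x_{i_2},\boldsymbol x_{i_3})$ and $\boldsymbol\alpha\in\tilde{\mathcal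 I}_3^n(F)$: $\boldsymbol\Phi^{FT,n}_{\boldsymbol\alpha}=(n+1)B^n_{\boldsymbol\alpha}(\alpha_{i_1}\boldsymbol\omega_{i_2i_3}+\alpha_{i_2}\boldsymbol\omega_{i_3i_1}+\alpha_{i_3}\boldsymbol\omega_{i_1i_2})$. - For $\ell\in\{1,2,3,4\}$ and $\boldsymbol\alpha\in\mathring{\mathcal I}_3^{n+1}$: $\boldsymbol\Psi^n_{\ell,\boldsymbol\alpha}=(n+1)B^n_{\boldsymbol\alpha-\boldsymbol e_\ell}\nabla\lambda_\ell-\frac{\alpha_\ell}{n+1}\nabla B^{n+1}_{\boldsymbol\alpha}$. - For $\boldsymbol\alpha\in\mathcal I_3^n$: $\boldsymbol\Upsilon^n_{\boldsymbol\alpha}=(n+1)B^n_{\boldsymbol\alpha}\sum_{\ell=1}^4(-1)^\ell\alpha_\ell\boldsymbol\chi_\ell$. **Spaces** (real linear spans; the span of the empty family is $\{0\}$). - $S_{low}=\mathrm{span}\{\lambda_i:1\le i\le4\}$, $\boldsymbol E_{low}=\mathrm{span}\{\boldsymbol\omega_{ij}:1\le i<j\le4\}$, $\boldsymbol V_{low}=\mathrm{span}\{\boldsymbol\chi_\ell:1\le\ell\le4\}$, $W_{low}=\mathrm{span}\{1\}$. - $S_n^E=\mathrm{span}\{B^n_{\boldsymbol\alpha}:\boldsymbol\alpha\in\mathring{\mathcal I}_3^n(E)\}$, $S_n^F=\mathrm{span}\{B^n_{\boldsymbol\alpha}:\boldsymbol\alpha\in\mathring{\mathcal I}_3^n(F)\}$,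 $S_n^T=\mathrm{span}\{B^n_{\boldsymbol\alpha}:\boldsymbol\alpha\in\mathring{\mathcal I}_3^n\}$. - $\boldsymbol E_n^F=\mathrm{span}\{\boldsymbol\Phi^{FT,n}_{\boldsymbol\alpha}:\boldsymbol\alpha\in\tilde{\mathcal I}_3^n(F)'\}$. - $\boldsymbol E_n^T=\mathrm{span}\big(\{\boldsymbol\Psi^n_{\ell,\boldsymbol\alpha}:\ell\in\{1,2\},\boldsymbol\alpha\in\mathring{\mathcal I}_3^{n+1}\}\cup\{\boldsymbol\Psi^n_{3,\boldsymbol\alpha}:\boldsymbol\alpha\in\mathring{\mathcal I}_3^{n+1},\alpha_3=1\}\big)$. - $\boldsymbol V_n^T=\mathrm{span}\{\boldsymbol\Upsilon^n_{\boldsymbol\alpha}:\boldsymbol\alpha\in{\mathcal I_3^n}'\}$. - $\nabla S$, $\nabla\times\boldsymbol E$, $\nabla\cdot\boldsymbol V$ denote images of the spaces under the gradient, curl, divergence. *)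

theory Defs
  imports "HOL-Analysis.Analysis" "HOL-Library.Function_Algebras"
begin

text \<open>
  Pointwise real vector space structure on functions, so that \<^const>\<open>span\<close>,
  \<^const>\<open>independent\<close> and \<^const>\<open>subspace\<close> apply to scalar and vector fields.
\<close>

instantiation "fun" :: (type, real_vector) real_vector
begin

definition scaleR_fun :: "real \<Rightarrow> ('a \<Rightarrow> 'b) \<Rightarrow> 'a \<Rightarrow> 'b" where
  "scaleR_fun c f = (\<lambda>p. c *\<^sub>R f p)"

instance
  by standard (simp_all add: scaleR_fun_def plus_fun_def fun_eq_iff scaleR_add_right scaleR_add_left)

end

text \<open>
  All fields are polynomial and are defined on the whole of \<open>\<real>\<^sup>3\<close>.  A field viewed as a function
  on \<open>T\<close> is represented by its extension by zero outside \<open>T\<close>, so that the functions on \<open>T\<close>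
  form a subspace.
\<close>

definition restr :: "'a set \<Rightarrow> ('a \<Rightarrow> 'b::real_vector) \<Rightarrow> 'a \<Rightarrow> 'b" where
  "restr T f = (\<lambda>p. if p \<in> T then f p else 0)"

definition basis_on ::
  "'a set \<Rightarrow> ('i \<Rightarrow> 'a \<Rightarrow> 'b::real_vector) \<Rightarrow> 'i set \<Rightarrow> ('a \<Rightarrow> 'b) set \<Rightarrow> bool" where
  "basis_on T f I V \<longleftrightarrow>
     inj_on (\<lambda>i. restr T (f i)) I \<and>
     independent ((\<lambda>i. restr T (f i)) ` I) \<and>
     span ((\<lambda>i. restr T (f i)) ` I) = restr T ` V"

text \<open>\<open>sum_list ` listset [V\<^sub>1, \<dots>, V\<^sub>k]\<close> is the sum \<open>V\<^sub>1 + \<dots> + V\<^sub>k\<close>; injectivity of \<^const>\<open>sum_list\<close>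
  is uniqueness of the decomposition.\<close>

definition direct_sum :: "'v::real_vector set list \<Rightarrow> 'v set \<Rightarrow> bool" where
  "direct_sum Vs W \<longleftrightarrow> (\<forall>V\<in>set Vs. subspace V) \<and> bij_betw sum_list (listset Vs) W"

text \<open>\<open>U\<^sub>1 \<oplus> \<dots> \<oplus> U\<^sub>m = V\<^sub>1 \<oplus> \<dots> \<oplus> V\<^sub>k\<close> for spaces of functions on \<open>T\<close>, where both sums are direct.\<close>

definition direct_sums_eq_on ::
  "'a set \<Rightarrow> ('a \<Rightarrow> 'b::real_vector) set list \<Rightarrow> ('a \<Rightarrow> 'b) set list \<Rightarrow> bool" where
  "direct_sums_eq_on T Us Vs \<longleftrightarrow>
     (\<exists>W. direct_sum (map (image (restr T)) Us) W \<and> direct_sum (map (image (restr T)) Vs) W)"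

definition partial :: "3 \<Rightarrow> (real^3 \<Rightarrow> real) \<Rightarrow> real^3 \<Rightarrow> real" where
  "partial i f p = frechet_derivative f (at p) (axis i 1)"

definition grad :: "(real^3 \<Rightarrow> real) \<Rightarrow> real^3 \<Rightarrow> real^3" where
  "grad f p = (\<chi> i. partial i f p)"

definition curl :: "(real^3 \<Rightarrow> real^3) \<Rightarrow> real^3 \<Rightarrow> real^3" where
  "curl v p = vector
     [partial 2 (\<lambda>q. v q $ 3) p - partial 3 (\<lambda>q. v q $ 2) p,
      partial 3 (\<lambda>q. v q $ 1) p - partial 1 (\<lambda>q. v q $ 3) p,
      partial 1 (\<lambda>q. v q $ 2) p - partial 2 (\<lambda>q. v q $ 1) p]"

definition divergence :: "(real^3 \<Rightarrow> real^3) \<Rightarrow> real^3 \<Rightarrow> real" where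
  "divergence v p = (\<Sum>i\<in>UNIV. partial i (\<lambda>q. v q $ i) p)"

definition monomial3 :: "nat \<times> nat \<times> nat \<Rightarrow> real^3 \<Rightarrow> real" where
  "monomial3 = (\<lambda>(a, b, c) p. (p $ 1) ^ a * (p $ 2) ^ b * (p $ 3) ^ c)"

definition polys :: "nat \<Rightarrow> (real^3 \<Rightarrow> real) set" where
  "polys n = span (monomial3 ` {(a, b, c). a + b + c \<le> n})"

definition hom_polys :: "nat \<Rightarrow> (real^3 \<Rightarrow> real) set" where
  "hom_polys n = span (monomial3 ` {(a, b, c). a + b + c = n})"

definition vec_fields :: "(real^3 \<Rightarrow> real) set \<Rightarrow> (real^3 \<Rightarrow> real^3) set" where
  "vec_fields P = {v. \<forall>i. (\<lambda>p. v p $ i) \<in> P}"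

definition x_cross_hom :: "nat \<Rightarrow> (real^3 \<Rightarrow> real^3) set" where
  "x_cross_hom n = (\<lambda>q p. cross3 p (q p)) ` vec_fields (hom_polys n)"

definition x_times_hom :: "nat \<Rightarrow> (real^3 \<Rightarrow> real^3) set" where
  "x_times_hom n = (\<lambda>q p. q p *\<^sub>R p) ` hom_polys n"

text \<open>
  The vertices are \<open>x 1, \<dots>, x 4\<close>.  Indices are natural numbers rather than elements of the
  numeral type \<open>4\<close>, in which \<open>4 = 0\<close> is the least element.  A multi-index is a function on \<open>nat\<close>
  supported in \<open>{1..4}\<close>.  Edges and faces are given by their sets of vertex indices.
\<close>

definition bary :: "(nat \<Rightarrow> real^3) \<Rightarrow> nat \<Rightarrow> real^3 \<Rightarrow> real" where
  "bary x k p = (THE l. (\<forall>i. i \<notin> {1..4} \<longrightarrow> l i = 0) \<and>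
                        p = (\<Sum>i=1..4. l i *\<^sub>R x i) \<and> (\<Sum>i=1..4. l i) = 1) k"

definition indices :: "nat \<Rightarrow> (nat \<Rightarrow> nat) set" where
  "indices n = {\<alpha>. (\<forall>i. i \<notin> {1..4} \<longrightarrow> \<alpha> i = 0) \<and> (\<Sum>i=1..4. \<alpha> i) = n}"

definition interior_indices :: "nat \<Rightarrow> nat set \<Rightarrow> (nat \<Rightarrow> nat) set" where
  "interior_indices n A = {\<alpha>\<in>indices n. \<forall>i\<in>{1..4}. if i \<in> A then \<alpha> i > 0 else \<alpha> i = 0}"

definition face_indices :: "nat \<Rightarrow> nat set \<Rightarrow> (nat \<Rightarrow> nat) set" where
  "face_indices n F = {\<alpha>\<in>indices n. \<forall>i\<in>{1..4}. i \<notin> F \<longrightarrow> \<alpha> i = 0}"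

definition edges :: "nat set list" where
  "edges = [{1, 2}, {1, 3}, {1, 4}, {2, 3}, {2, 4}, {3, 4}]"

definition faces :: "nat set list" where
  "faces = [{1, 2, 3}, {1, 2, 4}, {1, 3, 4}, {2, 3, 4}]"

definition bern :: "(nat \<Rightarrow> real^3) \<Rightarrow> nat \<Rightarrow> (nat \<Rightarrow> nat) \<Rightarrow> real^3 \<Rightarrow> real" where
  "bern x n \<alpha> p = fact n / (\<Prod>i=1..4. fact (\<alpha> i)) * (\<Prod>i=1..4. bary x i p ^ \<alpha> i)"

definition omega :: "(nat \<Rightarrow> real^3) \<Rightarrow> nat \<Rightarrow> nat \<Rightarrow> real^3 \<Rightarrow> real^3" where
  "omega x i j p = bary x i p *\<^sub>R grad (bary x j) p - bary x j p *\<^sub>R grad (bary x i) p"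

definition chi :: "(nat \<Rightarrow> real^3) \<Rightarrow> nat \<Rightarrow> real^3 \<Rightarrow> real^3" where
  "chi x l p =
     (let ijk = removeAll l [1, 2, 3, 4]; i = ijk ! 0; j = ijk ! 1; k = ijk ! 2 in
        bary x i p *\<^sub>R cross3 (grad (bary x j) p) (grad (bary x k) p)
      - bary x j p *\<^sub>R cross3 (grad (bary x i) p) (grad (bary x k) p)
      + bary x k p *\<^sub>R cross3 (grad (bary x i) p) (grad (bary x j) p))"

text \<open>Here \<open>f 1, f 2, f 3\<close> is a numbering of the vertices of the face.\<close>

definition Phi :: "(nat \<Rightarrow> real^3) \<Rightarrow> (nat \<Rightarrow> nat) \<Rightarrow> nat \<Rightarrow> (nat \<Rightarrow> nat) \<Rightarrow> real^3 \<Rightarrow> real^3" where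
  "Phi x f n \<alpha> p = (real (n + 1) * bern x n \<alpha> p) *\<^sub>R
     (real (\<alpha> (f 1)) *\<^sub>R omega x (f 2) (f 3) p
    + real (\<alpha> (f 2)) *\<^sub>R omega x (f 3) (f 1) p
    + real (\<alpha> (f 3)) *\<^sub>R omega x (f 1) (f 2) p)"

definition Psi :: "(nat \<Rightarrow> real^3) \<Rightarrow> nat \<Rightarrow> nat \<Rightarrow> (nat \<Rightarrow> nat) \<Rightarrow> real^3 \<Rightarrow> real^3" where
  "Psi x n l \<alpha> p =
     (real (n + 1) * bern x n (\<alpha>(l := \<alpha> l - 1)) p) *\<^sub>R grad (bary x l) p
   - (real (\<alpha> l) / real (n + 1)) *\<^sub>R grad (bern x (n + 1) \<alpha>) p"

definition Upsilon :: "(nat \<Rightarrow> real^3) \<Rightarrow> nat \<Rightarrow> (nat \<Rightarrow> nat) \<Rightarrow> real^3 \<Rightarrow> real^3" where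
  "Upsilon x n \<alpha> p = (real (n + 1) * bern x n \<alpha> p) *\<^sub>R
     (\<Sum>l=1..4. ((-1) ^ l * real (\<alpha> l)) *\<^sub>R chi x l p)"

definition Psi_indices :: "nat \<Rightarrow> (nat \<times> (nat \<Rightarrow> nat)) set" where
  "Psi_indices n =
     {(l, \<alpha>). l \<in> {1, 2} \<and> \<alpha> \<in> interior_indices (n + 1) {1..4}} \<union>
     {(l, \<alpha>). l = 3 \<and> \<alpha> \<in> interior_indices (n + 1) {1..4} \<and> \<alpha> 3 = 1}"

definition low_edges :: "(nat \<times> nat) set" where
  "low_edges = {(i, j). 1 \<le> i \<and> i < j \<and> j \<le> 4}"

definition S_low :: "(nat \<Rightarrow> real^3) \<Rightarrow> (real^3 \<Rightarrow> real) set" where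
  "S_low x = span (bary x ` {1..4})"

definition E_low :: "(nat \<Rightarrow> real^3) \<Rightarrow> (real^3 \<Rightarrow> real^3) set" where
  "E_low x = span ((\<lambda>(i, j). omega x i j) ` low_edges)"

definition V_low :: "(nat \<Rightarrow> real^3) \<Rightarrow> (real^3 \<Rightarrow> real^3) set" where
  "V_low x = span (chi x ` {1..4})"

definition W_low :: "(real^3 \<Rightarrow> real) set" where
  "W_low = span {\<lambda>p. 1}"

text \<open>\<open>S_space x n A\<close> is \<open>S\<^sub>n\<^sup>E\<close>, \<open>S\<^sub>n\<^sup>F\<close> or \<open>S\<^sub>n\<^sup>T\<close> when \<open>A\<close> is the vertex index set of an edge,
  of a face, or \<open>{1..4}\<close>.\<close>

definition S_space :: "(nat \<Rightarrow> real^3) \<Rightarrow> nat \<Rightarrow> nat set \<Rightarrow> (real^3 \<Rightarrow> real) set" where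
  "S_space x n A = span (bern x n ` interior_indices n A)"

text \<open>
  \<open>num F\<close> numbers the vertices of the face \<open>F\<close>; \<open>rF n F\<close> and \<open>rT n\<close> are the indices removed
  from \<^term>\<open>face_indices n F\<close> and \<^term>\<open>indices n\<close>.
\<close>

definition E_face ::
  "(nat \<Rightarrow> real^3) \<Rightarrow> (nat set \<Rightarrow> nat \<Rightarrow> nat) \<Rightarrow> (nat \<Rightarrow> nat set \<Rightarrow> nat \<Rightarrow> nat) \<Rightarrow>
   nat \<Rightarrow> nat set \<Rightarrow> (real^3 \<Rightarrow> real^3) set" where
  "E_face x num rF n F = span (Phi x (num F) n ` (face_indices n F - {rF n F}))"

definition E_cell :: "(nat \<Rightarrow> real^3) \<Rightarrow> nat \<Rightarrow> (real^3 \<Rightarrow> real^3) set" where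
  "E_cell x n = span ((\<lambda>(l, \<alpha>). Psi x n l \<alpha>) ` Psi_indices n)"

definition V_cell :: "(nat \<Rightarrow> real^3) \<Rightarrow> (nat \<Rightarrow> nat \<Rightarrow> nat) \<Rightarrow> nat \<Rightarrow> (real^3 \<Rightarrow> real^3) set" where
  "V_cell x rT n = span (Upsilon x n ` (indices n - {rT n}))"

end

theory Submission
  imports Defs
begin

text \<open>
  Everything is reduced to finitely many coefficient computations with the divided powers
  \<open>b\<^sub>\<alpha> = \<Prod>\<^sub>i \<lambda>\<^sub>i\<^bsup>\<alpha>\<^sub>i\<^esup> / \<alpha>\<^sub>i!\<close>, for which \<open>\<partial>\<^sub>k b\<^sub>\<alpha> = b\<^bsub>\<alpha> - e\<^sub>k\<^esub>\<close> and
  \<open>\<lambda>\<^sub>k b\<^sub>\<alpha> = (\<alpha>\<^sub>k + 1) b\<^bsub>\<alpha> + e\<^sub>k\<^esub>\<close>.  Up to a nonzero constant, \<open>\<nabla> \<cdot> \<Upsilon>\<^sub>\<alpha>\<close> and, for a face \<open>F\<close> with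
  opposite vertex \<open>l\<close>, \<open>\<nabla>\<lambda>\<^sub>l \<cdot> (\<nabla> \<times> \<Phi>\<^sub>\<alpha>)\<close> are both equal to
  \<open>\<Sum>\<^sub>i\<^sub>\<noteq>\<^sub>j \<alpha>\<^sub>i (\<alpha>\<^sub>j + 1) (b\<^sub>\<alpha> - b\<^bsub>\<alpha> - e\<^sub>i + e\<^sub>j\<^esub>)\<close>, the sum running over the vertices of \<open>T\<close>, respectively
  of \<open>F\<close>.  The weights are symmetric, so this is the Laplacian of a connected weighted graph on the
  multi-indices; its kernel consists of the constants, and its image is complementary to the
  constant function.  This is why exactly one index has to be removed from each family.

  The remaining fields \<open>\<nabla> \<times> \<Psi>\<close> have no normal component on the boundary, and their independence
  follows by induction on \<open>\<alpha>\<^sub>4\<close>.  Applying \<open>\<nabla>\<cdot>\<close> and then \<open>\<nabla>\<times>\<close> peels the summands off one after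
  the other, which proves that all sums are direct; they exhaust the polynomial spaces by a
  dimension count.
\<close>

section \<open>Finite families and direct sums\<close>

text \<open>The weight of the move from \<alpha> to \<open>\<beta> = \<alpha> - e_i + e_j\<close> is
  symmetric because the way back has weight
  \<open>\<beta>_j (\<beta>_i + 1) = (\<alpha>_j + 1) \<alpha>_i\<close>. The factor
  \<open>\<alpha>_i\<close> comes from the definition of the fields, the factor
  \<open>\<alpha>_j + 1\<close> from raising divided powers to a common degree. What makes the
  summands hard to separate are the constants that each differential operator leaves over. The
  divergence of \<open>V_low\<close> consists of constant functions, so the Laplacian lemmas carry a
  constant along. The curl of \<open>E_low\<close> consists of constant fields, and these lie in
  \<open>V_low\<close>. A constant field is the gradient of an affine function, which lies in
  \<open>S_low\<close>; so the relation that remains after the curl is integrated, and the scalar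
  decomposition ends the chain. For exhaustion, an upper bound suffices: a generating set of the
  polynomial space that is no larger than the independent family. All algebra takes place on the
  whole space and carries over to the tetrahedron because a polynomial that vanishes there is
  zero.\<close>

definition indep_family :: "('i \<Rightarrow> 'v::real_vector) \<Rightarrow> 'i set \<Rightarrow> bool" where
  "indep_family f I \<longleftrightarrow>
     finite I \<and> (\<forall>c. (\<Sum>i\<in>I. c i *\<^sub>R f i) = 0 \<longrightarrow> (\<forall>i\<in>I. c i = 0))"

lemma indep_familyD: "indep_family f I \<Longrightarrow> (\<Sum>i\<in>I. c i *\<^sub>R f i) = 0 \<Longrightarrow> i \<in> I \<Longrightarrow> c i = 0"
  by (auto simp: indep_family_def)

lemma indep_family_finite: "indep_family f I \<Longrightarrow> finite I"
  by (simp add: indep_family_def)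

text \<open>Two equal members with coefficients 1 and -1 form a nontrivial relation. This supplies
  the injectivity clause of \<open>basis_on\<close>.\<close>

lemma indep_family_inj:
  assumes "indep_family f I" shows "inj_on f I"
proof (rule inj_onI, rule ccontr)
  fix i j assume ij: "i \<in> I" "j \<in> I" "f i = f j" "i \<noteq> j"
  define c where "c = (\<lambda>k. if k = i then 1 else if k = j then -1 else (0::real))"
  have fin: "finite I" using assms by (rule indep_family_finite)
  have "(\<Sum>k\<in>I. c k *\<^sub>R f k) = (\<Sum>k\<in>{i, j}. c k *\<^sub>R f k)"
    using fin ij by (intro sum.mono_neutral_right) (auto simp: c_def)
  also have "\<dots> = 0" using ij by (simp add: c_def)
  finally have "c i = 0" using assms ij by (blast dest: indep_familyD)
  then show False by (simp add: c_def)
qed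

lemma indep_family_independent:
  assumes "indep_family f I" shows "independent (f ` I)"
proof (rule independent_if_scalars_zero)
  show "finite (f ` I)" using assms by (simp add: indep_family_finite)
  fix c v assume "(\<Sum>v\<in>f ` I. c v *\<^sub>R v) = 0" and v: "v \<in> f ` I"
  then have "(\<Sum>i\<in>I. c (f i) *\<^sub>R f i) = 0"
    by (simp add: sum.reindex[OF indep_family_inj[OF assms]])
  then show "c v = 0" using indep_familyD[OF assms, of "c \<circ> f"] v by auto
qed

lemma indep_family_subset:
  assumes "indep_family f I" "J \<subseteq> I" shows "indep_family f J"
  unfolding indep_family_def
proof (intro conjI allI impI ballI)
  have fin: "finite I" using assms(1) by (rule indep_family_finite)
  then show "finite J" using assms(2) finite_subset by blast
  fix c j assume c: "(\<Sum>i\<in>J. c i *\<^sub>R f i) = 0" and j: "j \<in> J"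
  have "(\<Sum>i\<in>I. (if i \<in> J then c i else 0) *\<^sub>R f i) = (\<Sum>i\<in>J. c i *\<^sub>R f i)"
    using fin assms(2) by (intro sum.mono_neutral_cong_right) auto
  then have "(if j \<in> J then c j else 0) = 0" using c j assms(2) indep_familyD[OF assms(1)] by force
  then show "c j = 0" using j by simp
qed

lemma span_family:
  assumes "finite I"
  shows "span (f ` I) = range (\<lambda>c. \<Sum>i\<in>I. c i *\<^sub>R f i)"
proof
  let ?R = "range (\<lambda>c. \<Sum>i\<in>I. c i *\<^sub>R f i)"
  show "?R \<subseteq> span (f ` I)"
    by (intro image_subsetI span_sum span_scale span_base) blast
  have "subspace ?R"
    unfolding subspace_def
  proof (intro conjI allI ballI)
    show "0 \<in> ?R" by (intro image_eqI[of _ _ "\<lambda>_. 0"]) simp_all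
    fix u assume "u \<in> ?R"
    then obtain c where u: "u = (\<Sum>i\<in>I. c i *\<^sub>R f i)" by blast
    { fix v assume "v \<in> ?R"
      then obtain d where "v = (\<Sum>i\<in>I. d i *\<^sub>R f i)" by blast
      then show "u + v \<in> ?R" using u
        by (intro image_eqI[of _ _ "\<lambda>i. c i + d i"]) (simp_all add: sum.distrib scaleR_add_left) }
    fix a :: real show "a *\<^sub>R u \<in> ?R" using u
      by (intro image_eqI[of _ _ "\<lambda>i. a * c i"]) (simp_all add: scaleR_sum_right)
  qed
  moreover have "f ` I \<subseteq> ?R"
  proof (rule image_subsetI)
    fix i assume i: "i \<in> I"
    have "f i = (\<Sum>k\<in>I. (if k = i then 1 else 0) *\<^sub>R f k)"
      using assms i by (subst sum.mono_neutral_right[of _ "{i}"]) auto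
    then show "f i \<in> ?R" by (intro image_eqI[of _ _ "\<lambda>k. if k = i then 1 else 0"]) simp_all
  qed
  ultimately show "span (f ` I) \<subseteq> ?R" by (rule span_minimal[rotated])
qed

lemma span_familyE:
  assumes "v \<in> span (f ` I)" "finite I"
  obtains c where "v = (\<Sum>i\<in>I. c i *\<^sub>R f i)"
  using assms unfolding span_family[OF assms(2)] by blast

text \<open>Differential operators are linear only on differentiable functions, hence the domain \<open>D\<close>.\<close>

definition linear_op_on :: "'a::real_vector set \<Rightarrow> ('a \<Rightarrow> 'b::real_vector) \<Rightarrow> bool" where
  "linear_op_on D h \<longleftrightarrow> subspace D \<and> (\<forall>u\<in>D. \<forall>v\<in>D. h (u + v) = h u + h v) \<and>
     (\<forall>u\<in>D. \<forall>c. h (c *\<^sub>R u) = c *\<^sub>R h u)"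

lemma linear_op_on_0:
  assumes "linear_op_on D h" shows "h 0 = 0"
proof -
  have "0 \<in> D" using assms subspace_0 unfolding linear_op_on_def by blast
  then have "h (0 *\<^sub>R 0) = 0 *\<^sub>R h 0" using assms unfolding linear_op_on_def by blast
  then show ?thesis by (simp only: scaleR_zero_left)
qed

lemma linear_op_on_sum:
  assumes "linear_op_on D h" "\<And>i. i \<in> I \<Longrightarrow> f i \<in> D"
  shows "h (\<Sum>i\<in>I. c i *\<^sub>R f i) = (\<Sum>i\<in>I. c i *\<^sub>R h (f i))"
  using assms(2)
proof (induction I rule: infinite_finite_induct)
  case (infinite A)
  show ?case unfolding sum.infinite[OF infinite.hyps] by (rule linear_op_on_0[OF assms(1)])
next
  case empty
  show ?case by (simp only: sum.empty linear_op_on_0[OF assms(1)])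
next
  case (insert i I)
  have D: "subspace D" and add: "\<And>u v. u \<in> D \<Longrightarrow> v \<in> D \<Longrightarrow> h (u + v) = h u + h v"
    and scale: "\<And>u c. u \<in> D \<Longrightarrow> h (c *\<^sub>R u) = c *\<^sub>R h u"
    using assms(1) unfolding linear_op_on_def by blast+
  have s: "(\<Sum>i\<in>I. c i *\<^sub>R f i) \<in> D"
    using insert.prems by (intro subspace_sum[OF D] subspace_scale[OF D]) blast
  have i: "f i \<in> D" using insert.prems by blast
  have IH: "h (\<Sum>i\<in>I. c i *\<^sub>R f i) = (\<Sum>i\<in>I. c i *\<^sub>R h (f i))"
    using insert.prems by (intro insert.IH) blast
  show ?case
    unfolding sum.insert[OF insert.hyps] add[OF subspace_scale[OF D i] s] scale[OF i] IH ..
qed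

lemma linear_op_on_image_span:
  assumes "linear_op_on D h" "\<And>i. i \<in> I \<Longrightarrow> f i \<in> D" "finite I"
  shows "h ` span (f ` I) = span ((\<lambda>i. h (f i)) ` I)"
proof -
  have "h ` span (f ` I) = range (\<lambda>c. h (\<Sum>i\<in>I. c i *\<^sub>R f i))"
    unfolding span_family[OF assms(3)] image_image ..
  also have "\<dots> = range (\<lambda>c. \<Sum>i\<in>I. c i *\<^sub>R h (f i))"
    by (intro image_cong refl linear_op_on_sum[OF assms(1,2)])
  finally show ?thesis unfolding span_family[OF assms(3)] .
qed

text \<open>A relation among the \<open>f i\<close> maps to the same relation among their images.
  This transfers independence from curls and divergences back to the fields themselves.\<close>

lemma indep_family_from_image:
  assumes "linear_op_on D h" "\<And>i. i \<in> I \<Longrightarrow> f i \<in> D" "indep_family (\<lambda>i. h (f i)) I"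
  shows "indep_family f I"
  unfolding indep_family_def
proof (intro conjI allI impI)
  show "finite I" using assms(3) by (rule indep_family_finite)
  fix c assume "(\<Sum>i\<in>I. c i *\<^sub>R f i) = 0"
  then have "h (\<Sum>i\<in>I. c i *\<^sub>R f i) = 0"
    by (simp only: linear_op_on_0[OF assms(1)])
  then have "(\<Sum>i\<in>I. c i *\<^sub>R h (f i)) = 0"
    by (simp only: linear_op_on_sum[OF assms(1,2)])
  then show "\<forall>i\<in>I. c i = 0" using assms(3) by (blast dest: indep_familyD)
qed

text \<open>Steinitz exchange: an element of \<open>C\<close> outside \<open>span S\<close> would
  enlarge \<open>S\<close> to an independent set with more members than \<open>C\<close>. A
  generating set of the right size thus replaces the exact dimension of \<open>W\<close>.\<close>

lemma span_eq_if_card_le: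
  fixes W :: "'v::real_vector set"
  assumes "independent S" "S \<subseteq> W" "subspace W" "W \<subseteq> span C" "finite C" "card C \<le> card S"
  shows "span S = W"
proof
  show "span S \<subseteq> W" using assms(2,3) by (rule span_minimal)
  have SC: "S \<subseteq> span C" using assms by blast
  have fS: "finite S" and eq: "card S = card C"
    using independent_span_bound[OF assms(5,1) SC] assms(6) by auto
  have "C \<subseteq> span S"
  proof (rule subsetI, rule ccontr)
    fix v assume v: "v \<in> C" and n: "v \<notin> span S"
    then have "independent (insert v S)" using assms(1) by (simp add: independent_insert)
    moreover have "insert v S \<subseteq> span C" using SC v by (simp add: span_base)
    ultimately have "card (insert v S) \<le> card C"
      using independent_span_bound[OF assms(5)] by blast
    moreover have "v \<notin> S" using n span_base by blast
    ultimately show False using fS eq by simp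
  qed
  then show "W \<subseteq> span S" using assms(4) by (metis span_mono span_span order_trans)
qed

text \<open>Choice functions on labels replace lists of vectors, so that sums of lists become finite
  sums over sets. The labels must be distinct for such a function to exist, while the spaces may
  coincide.\<close>

lemma listset_map:
  assumes "distinct L"
  shows "listset (map V L) = {map v L | v. \<forall>j\<in>set L. v j \<in> V j}"
  using assms
proof (induction L)
  case (Cons a L)
  show ?case
  proof (intro set_eqI iffI)
    fix z assume "z \<in> listset (map V (a # L))"
    then obtain y v where z: "z = y # map v L" "y \<in> V a" "\<forall>j\<in>set L. v j \<in> V j"
      using Cons by (auto simp: set_Cons_def)
    have "z = map (v(a := y)) (a # L)" using z Cons.prems by auto
    moreover have "\<forall>j\<in>set (a # L). (v(a := y)) j \<in> V j" using z by auto
    ultimately show "z \<in> {map v (a # L) | v. \<forall>j\<in>set (a # L). v j \<in> V j}" by blast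
  next
    fix z assume "z \<in> {map v (a # L) | v. \<forall>j\<in>set (a # L). v j \<in> V j}"
    then show "z \<in> listset (map V (a # L))" using Cons by (auto simp: set_Cons_def)
  qed
qed auto

text \<open>The difference of two decompositions lies in the same summands, so uniqueness only has
  to be checked for the zero vector.\<close>

lemma direct_sum_map:
  assumes L: "distinct L"
    and sub: "\<And>j. j \<in> set L \<Longrightarrow> subspace (V j)"
    and dir: "\<And>v j. \<lbrakk>\<And>j. j \<in> set L \<Longrightarrow> v j \<in> V j; (\<Sum>j\<in>set L. v j) = 0; j \<in> set L\<rbrakk> \<Longrightarrow> v j = 0"
    and W: "W = {\<Sum>j\<in>set L. v j | v. \<forall>j\<in>set L. v j \<in> V j}"
  shows "direct_sum (map V L) W"
  unfolding direct_sum_def bij_betw_def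
proof (intro conjI ballI)
  have sl: "sum_list (map v L) = (\<Sum>j\<in>set L. v j)" for v :: "_ \<Rightarrow> 'b"
    using L by (rule sum_list_distinct_conv_sum_set)
  show "subspace U" if "U \<in> set (map V L)" for U using that sub by auto
  show "sum_list ` listset (map V L) = W"
  proof safe
    fix z assume "z \<in> listset (map V L)"
    then obtain v where "\<forall>j\<in>set L. v j \<in> V j" "z = map v L" unfolding listset_map[OF L] by blast
    then show "sum_list z \<in> W" unfolding W using sl by blast
  next
    fix w assume "w \<in> W"
    then obtain v where v: "\<forall>j\<in>set L. v j \<in> V j" "w = (\<Sum>j\<in>set L. v j)" unfolding W by blast
    then have "map v L \<in> listset (map V L)" unfolding listset_map[OF L] by blast
    then show "w \<in> sum_list ` listset (map V L)" using v(2) sl by (metis image_eqI)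
  qed
  show "inj_on sum_list (listset (map V L))"
    unfolding listset_map[OF L]
  proof (rule inj_onI, safe)
    fix u v assume u: "\<forall>j\<in>set L. u j \<in> V j" and v: "\<forall>j\<in>set L. v j \<in> V j"
      and eq: "sum_list (map u L) = sum_list (map v L)"
    have "(\<Sum>j\<in>set L. u j - v j) = 0" using eq by (simp add: sl sum_subtractf)
    then have "u j - v j = 0" if "j \<in> set L" for j
      using dir[of "\<lambda>j. u j - v j" j] u v that sub by (simp add: subspace_diff)
    then show "map u L = map v L" by simp
  qed
qed

text \<open>Independence of the joined family gives directness, and the size of \<open>C\<close>
  forces the family to span \<open>W\<close>.\<close>

lemma direct_sum_basis:
  fixes f :: "'j \<Rightarrow> 'i \<Rightarrow> 'v::real_vector"
  assumes L: "distinct L"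
    and ind: "indep_family (\<lambda>(j, i). f j i) (SIGMA j:set L. I j)"
    and sub: "subspace W"
    and in_W: "\<And>j i. j \<in> set L \<Longrightarrow> i \<in> I j \<Longrightarrow> f j i \<in> W"
    and C: "finite C" "W \<subseteq> span C" "card C \<le> (\<Sum>j\<in>set L. card (I j))"
    and fin: "\<And>j. j \<in> set L \<Longrightarrow> finite (I j)"
  shows "direct_sum (map (\<lambda>j. span (f j ` I j)) L) W"
proof (rule direct_sum_map[OF L])
  let ?S = "SIGMA j:set L. I j"
  have sm: "(\<Sum>x\<in>?S. c x *\<^sub>R (case x of (j, i) \<Rightarrow> f j i)) = (\<Sum>j\<in>set L. \<Sum>i\<in>I j. c (j, i) *\<^sub>R f j i)" for c
    using fin by (simp add: sum.Sigma split_def)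
  show "subspace (span (f j ` I j))" for j by simp
  show "v j = 0" if v: "\<And>j. j \<in> set L \<Longrightarrow> v j \<in> span (f j ` I j)"
    and s: "(\<Sum>j\<in>set L. v j) = 0" and j: "j \<in> set L" for v j
  proof -
    have "\<forall>j\<in>set L. \<exists>c. v j = (\<Sum>i\<in>I j. c i *\<^sub>R f j i)"
    proof
      fix j assume "j \<in> set L"
      then show "\<exists>c. v j = (\<Sum>i\<in>I j. c i *\<^sub>R f j i)"
        using span_familyE[OF v fin] by metis
    qed
    then obtain c where c: "\<And>j. j \<in> set L \<Longrightarrow> v j = (\<Sum>i\<in>I j. c j i *\<^sub>R f j i)" by metis
    have "(\<Sum>x\<in>?S. (case x of (j, i) \<Rightarrow> c j i) *\<^sub>R (case x of (j, i) \<Rightarrow> f j i)) = 0"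
      unfolding sm using s by (simp add: c)
    then have "c j i = 0" if "i \<in> I j" for i
      using indep_familyD[OF ind, of "\<lambda>(j, i). c j i" "(j, i)"] j that by simp
    then show ?thesis using c[OF j] by simp
  qed
  have "card ((\<lambda>(j, i). f j i) ` ?S) = (\<Sum>j\<in>set L. card (I j))"
    using fin by (simp add: card_image[OF indep_family_inj[OF ind]])
  then have span: "span ((\<lambda>(j, i). f j i) ` ?S) = W"
    using in_W C by (intro span_eq_if_card_le[OF indep_family_independent[OF ind] _ sub C(2,1)]) auto
  show "W = {\<Sum>j\<in>set L. v j | v. \<forall>j\<in>set L. v j \<in> span (f j ` I j)}"
  proof safe
    fix w assume "w \<in> W"
    then obtain c where "w = (\<Sum>x\<in>?S. c x *\<^sub>R (case x of (j, i) \<Rightarrow> f j i))"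
      using span indep_family_finite[OF ind] by (metis span_familyE)
    then have "w = (\<Sum>j\<in>set L. \<Sum>i\<in>I j. c (j, i) *\<^sub>R f j i)" by (simp only: sm)
    then show "\<exists>v. w = (\<Sum>j\<in>set L. v j) \<and> (\<forall>j\<in>set L. v j \<in> span (f j ` I j))"
      by (intro exI[of _ "\<lambda>j. \<Sum>i\<in>I j. c (j, i) *\<^sub>R f j i"] conjI ballI
          span_sum span_scale span_base imageI)
  next
    fix v assume v: "\<forall>j\<in>set L. v j \<in> span (f j ` I j)"
    have "span (f j ` I j) \<subseteq> W" if "j \<in> set L" for j
      using in_W that sub by (intro span_minimal) auto
    then show "(\<Sum>j\<in>set L. v j) \<in> W" using v sub by (intro subspace_sum) auto
  qed
qed

text \<open>Injectivity is asked on \<open>W\<close> only, which is what restriction to the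
  tetrahedron satisfies for polynomials. Decompositions are proved on the whole space and
  transported in this way.\<close>

lemma direct_sum_image:
  assumes h: "linear h" and inj: "\<And>w. w \<in> W \<Longrightarrow> h w = 0 \<Longrightarrow> w = 0" and W: "subspace W"
    and ds: "direct_sum Vs W"
  shows "direct_sum (map (image h) Vs) (h ` W)"
  unfolding direct_sum_def
proof
  have ls: "listset (map (image h) Us) = map h ` listset Us" for Us :: "'a set list"
  proof (induction Us)
    case (Cons U Us)
    then show ?case by (auto simp: set_Cons_def image_iff) (metis list.map(2))+
  qed auto
  have sl: "sum_list (map h us) = h (sum_list us)" for us
    by (induction us) (simp_all add: linear_0[OF h] linear_add[OF h])
  have bb: "bij_betw sum_list (listset Vs) W" using ds by (simp add: direct_sum_def)
  show "\<forall>V\<in>set (map (image h) Vs). subspace V"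
    using ds h by (auto simp: direct_sum_def linear_subspace_image)
  have injW: "inj_on h W"
  proof (rule inj_onI)
    fix u v assume uv: "u \<in> W" "v \<in> W" "h u = h v"
    then have "h (u - v) = 0" by (simp add: linear_diff[OF h])
    then show "u = v" using inj[of "u - v"] uv W by (simp add: subspace_diff)
  qed
  have "inj_on (h \<circ> sum_list) (listset Vs)"
    using bb injW by (auto simp: bij_betw_def intro: comp_inj_on)
  then have "inj_on sum_list (map h ` listset Vs)"
    by (auto simp: inj_on_def sl)
  moreover have "sum_list ` map h ` listset Vs = h ` W"
    using bb by (auto simp: bij_betw_def image_image sl)
  ultimately show "bij_betw sum_list (listset (map (image h) Vs)) (h ` W)"
    by (simp add: bij_betw_def ls)
qed

section \<open>Transfer of bases to functions on a subset\<close>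

lemma restr_linear: "linear (restr T)"
  by (rule linearI) (auto simp: restr_def fun_eq_iff scaleR_fun_def)

text \<open>\<open>W\<close> is an ambient space of polynomial fields, on which restriction loses
  nothing, so a relation on \<open>T\<close> is a relation everywhere.\<close>

lemma basis_onI:
  assumes "indep_family f I" "V = span (f ` I)" "subspace W" "f ` I \<subseteq> W"
    and inj: "\<And>w. w \<in> W \<Longrightarrow> restr T w = 0 \<Longrightarrow> w = 0"
  shows "basis_on T f I V"
proof -
  have fin: "finite I" using assms(1) by (rule indep_family_finite)
  have ind: "indep_family (\<lambda>i. restr T (f i)) I"
    unfolding indep_family_def
  proof (intro conjI allI impI)
    fix c assume "(\<Sum>i\<in>I. c i *\<^sub>R restr T (f i)) = 0"
    then have "restr T (\<Sum>i\<in>I. c i *\<^sub>R f i) = 0"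
      by (simp add: linear_sum[OF restr_linear] linear_scale[OF restr_linear])
    moreover have "(\<Sum>i\<in>I. c i *\<^sub>R f i) \<in> W"
      using assms(3,4) by (intro subspace_sum subspace_scale) auto
    ultimately show "\<forall>i\<in>I. c i = 0" using inj assms(1) by (blast dest: indep_familyD)
  qed (fact fin)
  show ?thesis
    unfolding basis_on_def assms(2)
    using indep_family_inj[OF ind] indep_family_independent[OF ind]
      linear_span_image[OF restr_linear, of T "f ` I"]
    by (simp add: image_image)
qed

lemma linear_op_on_add: "linear_op_on D h \<Longrightarrow> u \<in> D \<Longrightarrow> v \<in> D \<Longrightarrow> h (u + v) = h u + h v"
  unfolding linear_op_on_def by blast

lemma linear_op_on_subspace: "linear_op_on D h \<Longrightarrow> subspace D"
  unfolding linear_op_on_def by blast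

lemma linear_op_on_plain_sum:
  assumes "linear_op_on D h" "\<And>i. i \<in> I \<Longrightarrow> f i \<in> D"
  shows "h (\<Sum>i\<in>I. f i) = (\<Sum>i\<in>I. h (f i))"
  using linear_op_on_sum[OF assms, where c="\<lambda>_. 1"] unfolding scaleR_one .

lemma indep_family_scale:
  assumes "indep_family f I" "r \<noteq> 0" shows "indep_family (\<lambda>i. r *\<^sub>R f i) I"
  unfolding indep_family_def
proof (intro conjI allI impI)
  show "finite I" using assms(1) by (rule indep_family_finite)
  fix c assume "(\<Sum>i\<in>I. c i *\<^sub>R r *\<^sub>R f i) = 0"
  then have "(\<Sum>i\<in>I. (c i * r) *\<^sub>R f i) = 0" by simp
  then show "\<forall>i\<in>I. c i = 0" using indep_familyD[OF assms(1)] assms(2) by fastforce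
qed

text \<open>Keeps the simplifier from turning the lower bound of \<open>{1..4}\<close> into \<open>Suc 0\<close>.\<close>

declare One_nat_def [simp del]

section \<open>Differential operators\<close>

lemma sum_fun_apply: "(\<Sum>i\<in>I. f i) p = (\<Sum>i\<in>I. f i p)"
  by (induction I rule: infinite_finite_induct) auto

lemma scaleR_fun_apply [simp]: "(c *\<^sub>R f) p = c *\<^sub>R f p"
  by (simp add: scaleR_fun_def)

lemma grad_eqI: "GDERIV f p :> d \<Longrightarrow> grad f p = d"
  unfolding gderiv_def
  by (simp add: grad_def partial_def frechet_derivative_at[symmetric] vec_eq_iff inner_axis' )

definition diffable :: "(real^3 \<Rightarrow> real) set" where
  "diffable = {f. \<forall>p. f differentiable (at p)}"

lemma diffable_GDERIV: "f \<in> diffable \<Longrightarrow> GDERIV f p :> grad f p"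
proof -
  assume "f \<in> diffable"
  then have d: "(f has_derivative frechet_derivative f (at p)) (at p)"
    by (simp add: diffable_def frechet_derivative_works)
  then have lin: "linear (frechet_derivative f (at p))" by (rule has_derivative_linear)
  have "frechet_derivative f (at p) h = h \<bullet> grad f p" for h
  proof -
    have "frechet_derivative f (at p) h = frechet_derivative f (at p) (\<Sum>i\<in>UNIV. h $ i *\<^sub>R axis i 1)"
      using basis_expansion[of h] by (simp add: scalar_mult_eq_scaleR)
    also have "\<dots> = (\<Sum>i\<in>UNIV. h $ i * partial i f p)"
      by (simp add: linear_sum[OF lin] linear_scale[OF lin] partial_def)
    finally show ?thesis by (simp add: inner_vec_def grad_def)
  qed
  then have "frechet_derivative f (at p) = (\<lambda>h. h \<bullet> grad f p)" by blast
  then show ?thesis using d by (simp add: gderiv_def)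
qed

lemma diffableI: "(\<And>p. GDERIV f p :> g p) \<Longrightarrow> f \<in> diffable"
  by (auto simp: diffable_def gderiv_def differentiable_def)

lemma subspace_diffable: "subspace diffable"
  unfolding subspace_def diffable_def
  by (auto simp: zero_fun_def plus_fun_def scaleR_fun_def)

lemma partial_grad: "partial i f p = grad f p $ i"
  by (simp add: grad_def)

lemma grad_add: "f \<in> diffable \<Longrightarrow> g \<in> diffable \<Longrightarrow> grad (\<lambda>p. f p + g p) p = grad f p + grad g p"
  by (intro grad_eqI GDERIV_add diffable_GDERIV)

lemma grad_scale: "f \<in> diffable \<Longrightarrow> grad (\<lambda>p. c * f p) p = c *\<^sub>R grad f p"
  using GDERIV_mult[OF GDERIV_const[where k=c] diffable_GDERIV, of f p] by (auto intro!: grad_eqI)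

lemma grad_linear: "linear_op_on diffable grad"
  unfolding linear_op_on_def
  by (auto simp: subspace_diffable fun_eq_iff plus_fun_def scaleR_fun_def grad_add grad_scale)

lemma subspace_vec_fields: "subspace P \<Longrightarrow> subspace (vec_fields P)"
  unfolding subspace_def vec_fields_def
  by (auto simp: zero_fun_def plus_fun_def scaleR_fun_def)

lemma vec_fields_mono: "P \<subseteq> Q \<Longrightarrow> vec_fields P \<subseteq> vec_fields Q"
  by (auto simp: vec_fields_def)

lemma partial_add:
  "f \<in> diffable \<Longrightarrow> g \<in> diffable \<Longrightarrow> partial i (\<lambda>p. f p + g p) p = partial i f p + partial i g p"
  by (simp add: partial_grad grad_add)

lemma partial_scale: "f \<in> diffable \<Longrightarrow> partial i (\<lambda>p. c * f p) p = c * partial i f p"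
  by (simp add: partial_grad grad_scale)

lemma curl_linear: "linear_op_on (vec_fields diffable) curl"
  unfolding linear_op_on_def using subspace_vec_fields[OF subspace_diffable]
  by (auto simp: fun_eq_iff curl_def vec_fields_def
      partial_add partial_scale vec_eq_iff forall_3 algebra_simps)

lemma divergence_linear: "linear_op_on (vec_fields diffable) divergence"
  unfolding linear_op_on_def using subspace_vec_fields[OF subspace_diffable]
  by (auto simp: fun_eq_iff divergence_def vec_fields_def
      partial_add partial_scale sum.distrib sum_distrib_left)

lemma partial_scale_right: "f \<in> diffable \<Longrightarrow> partial i (\<lambda>p. f p * c) p = partial i f p * c"
  using partial_scale[of f i c p] by (simp add: mult.commute)

lemma curl_scaleR: "f \<in> diffable \<Longrightarrow> curl (\<lambda>p. f p *\<^sub>R w) p = cross3 (grad f p) w"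
  by (simp add: curl_def partial_scale_right cross3_def partial_grad[symmetric] vec_eq_iff forall_3)

lemma divergence_scaleR: "f \<in> diffable \<Longrightarrow> divergence (\<lambda>p. f p *\<^sub>R w) p = grad f p \<bullet> w"
  by (simp add: divergence_def partial_scale_right inner_vec_def partial_grad[symmetric])

lemma scaleR_const_vec_fields: "subspace P \<Longrightarrow> f \<in> P \<Longrightarrow> (\<lambda>p. f p *\<^sub>R w) \<in> vec_fields P"
  by (auto simp: vec_fields_def scaleR_fun_def mult.commute dest: subspace_scale)

lemma curl_add:
  "u \<in> vec_fields diffable \<Longrightarrow> v \<in> vec_fields diffable \<Longrightarrow> curl (\<lambda>p. u p + v p) p = curl u p + curl v p"
  using curl_linear unfolding linear_op_on_def by (force simp: plus_fun_def)

lemma curl_scale: "u \<in> vec_fields diffable \<Longrightarrow> curl (\<lambda>p. c *\<^sub>R u p) p = c *\<^sub>R curl u p"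
  using curl_linear unfolding linear_op_on_def by (force simp: scaleR_fun_def)

lemma curl_sum_fields:
  assumes "\<And>i. i \<in> I \<Longrightarrow> g i \<in> diffable"
  shows "curl (\<lambda>p. \<Sum>i\<in>I. g i p *\<^sub>R w i) p = (\<Sum>i\<in>I. cross3 (grad (g i) p) (w i))"
proof -
  \<comment> \<open>The factors 1 bring the sum into the form of
    \<open>linear_op_on_sum\<close>.\<close>
  have "curl (\<Sum>i\<in>I. 1 *\<^sub>R (\<lambda>p. g i p *\<^sub>R w i)) = (\<Sum>i\<in>I. 1 *\<^sub>R curl (\<lambda>p. g i p *\<^sub>R w i))"
    using assms by (intro linear_op_on_sum[OF curl_linear] scaleR_const_vec_fields subspace_diffable)
  moreover have "(\<Sum>i\<in>I. 1 *\<^sub>R (\<lambda>p. g i p *\<^sub>R w i)) = (\<lambda>p. \<Sum>i\<in>I. g i p *\<^sub>R w i)"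
    by (intro ext) (simp add: sum_fun_apply)
  ultimately show ?thesis using assms by (simp add: sum_fun_apply curl_scaleR)
qed

lemma divergence_sum_fields:
  assumes "\<And>i. i \<in> I \<Longrightarrow> g i \<in> diffable"
  shows "divergence (\<lambda>p. \<Sum>i\<in>I. g i p *\<^sub>R w i) p = (\<Sum>i\<in>I. grad (g i) p \<bullet> w i)"
proof -
  have "divergence (\<Sum>i\<in>I. 1 *\<^sub>R (\<lambda>p. g i p *\<^sub>R w i)) = (\<Sum>i\<in>I. 1 *\<^sub>R divergence (\<lambda>p. g i p *\<^sub>R w i))"
    using assms by (intro linear_op_on_sum[OF divergence_linear] scaleR_const_vec_fields subspace_diffable)
  moreover have "(\<Sum>i\<in>I. 1 *\<^sub>R (\<lambda>p. g i p *\<^sub>R w i)) = (\<lambda>p. \<Sum>i\<in>I. g i p *\<^sub>R w i)"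
    by (intro ext) (simp add: sum_fun_apply)
  ultimately show ?thesis using assms by (simp add: sum_fun_apply divergence_scaleR)
qed

lemma sum_vec_fields:
  assumes "subspace P" "\<And>i. i \<in> I \<Longrightarrow> v i \<in> vec_fields P"
  shows "(\<lambda>p. \<Sum>i\<in>I. v i p) \<in> vec_fields P"
proof -
  have "(\<lambda>p. \<Sum>i\<in>I. v i p) = (\<Sum>i\<in>I. v i)" by (intro ext) (simp add: sum_fun_apply)
  then show ?thesis using assms by (auto intro: subspace_sum subspace_vec_fields)
qed

lemma add_vec_fields:
  "subspace P \<Longrightarrow> u \<in> vec_fields P \<Longrightarrow> v \<in> vec_fields P \<Longrightarrow> (\<lambda>p. u p + v p) \<in> vec_fields P"
  using subspace_add[OF subspace_vec_fields, of P u v] by (simp add: plus_fun_def)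

lemma scale_vec_fields:
  "subspace P \<Longrightarrow> u \<in> vec_fields P \<Longrightarrow> (\<lambda>p. c *\<^sub>R u p) \<in> vec_fields P"
  using subspace_scale[OF subspace_vec_fields, of P u c] by (simp add: scaleR_fun_def)

lemma diff_vec_fields:
  "subspace P \<Longrightarrow> u \<in> vec_fields P \<Longrightarrow> v \<in> vec_fields P \<Longrightarrow> (\<lambda>p. u p - v p) \<in> vec_fields P"
  using add_vec_fields[of P u "\<lambda>p. (-1) *\<^sub>R v p"] scale_vec_fields[of P v "-1"] by simp

lemma curl_diff:
  assumes "u \<in> vec_fields diffable" "v \<in> vec_fields diffable"
  shows "curl (\<lambda>p. u p - v p) p = curl u p - curl v p"
  using curl_add[OF assms(1) scale_vec_fields[OF subspace_diffable assms(2), of "-1"]]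
    curl_scale[OF assms(2), of "-1"] by simp

lemma constant_if_grad_eq_0:
  assumes "f \<in> diffable" "grad f = 0" shows "\<exists>k. f = (\<lambda>_. k)"
proof -
  have "(f has_derivative (\<lambda>h. 0)) (at p within UNIV)" for p
    using diffable_GDERIV[OF assms(1), of p] assms(2) by (simp add: gderiv_def)
  then have "\<exists>k. \<forall>p\<in>UNIV. f p = k" by (intro has_derivative_zero_constant) auto
  then show ?thesis by blast
qed

lemma GDERIV_inner: "GDERIV (\<lambda>p. p \<bullet> a) p :> (a :: real^3)"
  unfolding gderiv_def by (auto intro!: derivative_eq_intros)

text \<open>Every member of \<open>V_low\<close> has this shape by \<open>V_low_form\<close>; its
  divergence sees only the radial coefficient \<open>t\<close>.\<close>

lemma divergence_radial: "divergence (\<lambda>p. t *\<^sub>R p + b) = (\<lambda>_. 3 * t)"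
proof
  fix p :: "real^3"
  have D: "GDERIV (\<lambda>q. (t *\<^sub>R q + b) $ i) p :> t *\<^sub>R axis i 1" for i :: 3
    unfolding gderiv_def
    by (auto intro!: derivative_eq_intros bounded_linear.has_derivative[OF bounded_linear_vec_nth]
        simp: inner_axis)
  have "partial i (\<lambda>q. (t *\<^sub>R q + b) $ i) p = t" for i :: 3
    unfolding partial_grad grad_eqI[OF D] by simp
  then show "divergence (\<lambda>p. t *\<^sub>R p + b) p = 3 * t" by (simp add: divergence_def)
qed

definition div_free :: "(real^3 \<Rightarrow> real^3) set" where
  "div_free = {v \<in> vec_fields diffable. divergence v = 0}"

lemma subspace_div_free: "subspace div_free"
proof -
  note s = linear_op_on_subspace[OF divergence_linear]
  have "\<And>u v. u \<in> vec_fields diffable \<Longrightarrow> v \<in> vec_fields diffable \<Longrightarrow> divergence (u + v) = divergence u + divergence v"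
    "\<And>u c. u \<in> vec_fields diffable \<Longrightarrow> divergence (c *\<^sub>R u) = c *\<^sub>R divergence u"
    using divergence_linear unfolding linear_op_on_def by blast+
  then show ?thesis
    unfolding div_free_def
    by (intro subspaceI) (auto simp: subspace_0[OF s] subspace_add[OF s] subspace_scale[OF s]
        linear_op_on_0[OF divergence_linear])
qed

lemma cross3_sum_left: "cross3 (\<Sum>i\<in>I. f i) w = (\<Sum>i\<in>I. cross3 (f i) w)"
  by (induction I rule: infinite_finite_induct) (simp_all add: cross_add_left)

lemma cross3_dot: "cross3 a b \<bullet> cross3 u v = (a \<bullet> u) * (b \<bullet> v) - (a \<bullet> v) * (b \<bullet> u)"
  by (simp add: cross3_simps)

section \<open>Barycentric coordinates\<close>

lemma sum_4: "(\<Sum>i=1..4. f i) = f 1 + f 2 + f 3 + f (4::nat)"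
proof -
  have "{1..4} = {1, 2, 3, 4::nat}" by auto
  then show ?thesis by (simp add: add.assoc)
qed

definition up :: "(nat \<Rightarrow> nat) \<Rightarrow> nat \<Rightarrow> nat \<Rightarrow> nat" where "up \<alpha> i = \<alpha>(i := \<alpha> i + 1)"
definition dn :: "(nat \<Rightarrow> nat) \<Rightarrow> nat \<Rightarrow> nat \<Rightarrow> nat" where "dn \<alpha> i = \<alpha>(i := \<alpha> i - 1)"

locale tetrahedron =
  fixes x :: "nat \<Rightarrow> real^3"
  assumes inj_x: "inj_on x {1..4}" and affine_indep: "\<not> affine_dependent (x ` {1..4})"
begin

lemma bary_unique:
  assumes "(\<Sum>i=1..4. l i *\<^sub>R x i) = (\<Sum>i=1..4. m i *\<^sub>R x i)" "(\<Sum>i=1..4. l i) = (\<Sum>i=1..4. m i)"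
    and "i \<in> {1..4}"
  shows "l i = m i"
proof (rule ccontr)
  assume "l i \<noteq> m i"
  \<comment> \<open>Affine dependence is phrased with coefficients on points, so the differences of
    the coordinates are carried over from the indices to the vertices.\<close>
  define U where "U = (\<lambda>v. l (inv_into {1..4} x v) - m (inv_into {1..4} x v))"
  have U: "U (x k) = l k - m k" if "k \<in> {1..4}" for k
    using that inj_x by (simp add: U_def inv_into_f_f)
  have "sum U (x ` {1..4}) = (\<Sum>k=1..4. l k - m k)"
    by (simp add: sum.reindex[OF inj_x] U)
  also have "\<dots> = 0" using assms(2) by (simp add: sum_subtractf)
  finally have 1: "sum U (x ` {1..4}) = 0" .
  have "(\<Sum>v\<in>x ` {1..4}. U v *\<^sub>R v) = (\<Sum>k=1..4. (l k - m k) *\<^sub>R x k)"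
    by (simp add: sum.reindex[OF inj_x] U)
  also have "\<dots> = 0" using assms(1) by (simp add: sum_subtractf scaleR_diff_left)
  finally have "(\<Sum>v\<in>x ` {1..4}. U v *\<^sub>R v) = 0" .
  moreover have "U (x i) \<noteq> 0" using U[OF assms(3)] \<open>l i \<noteq> m i\<close> by simp
  ultimately have "affine_dependent (x ` {1..4})"
    using 1 assms(3) unfolding affine_dependent_explicit_finite[OF finite_imageI[OF finite_atLeastAtMost]]
    by (intro exI[of _ U]) blast
  then show False using affine_indep by simp
qed

text \<open>Four affinely independent points have the whole space as affine hull. The zero values
  outside \<open>{1..4}\<close> make the function unique, and not only its values at the four
  indices.\<close>

lemma bary_ex1:
  "\<exists>!l. (\<forall>i. i \<notin> {1..4} \<longrightarrow> l i = 0) \<and> p = (\<Sum>i=1..4. l i *\<^sub>R x i) \<and> (\<Sum>i=1..4. l i) = 1"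
proof -
  have "card (x ` {1..4}) = Suc DIM(real^3)" by (simp add: card_image[OF inj_x])
  then have "affine hull (x ` {1..4}) = UNIV" using affine_indep by (intro affine_independent_span_eq)
  then have "p \<in> affine hull (x ` {1..4})" by simp
  then obtain u where u: "sum u (x ` {1..4}) = 1" "(\<Sum>v\<in>x ` {1..4}. u v *\<^sub>R v) = p"
    by (subst (asm) affine_hull_finite) auto
  define l where "l = (\<lambda>i. if i \<in> {1..4} then u (x i) else 0)"
  have "(\<Sum>i=1..4. l i) = 1" "p = (\<Sum>i=1..4. l i *\<^sub>R x i)"
    using u by (simp_all add: sum.reindex[OF inj_x] l_def)
  moreover have "\<forall>i. i \<notin> {1..4} \<longrightarrow> l i = 0" by (simp add: l_def)
  ultimately show ?thesis
  proof (intro ex1I[of _ l], goal_cases)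
    case (2 m)
    then show ?case using bary_unique[of m l] by (intro ext) (metis (no_types, lifting))
  qed simp
qed

lemma
  shows bary_outside: "i \<notin> {1..4} \<Longrightarrow> bary x i p = 0"
    and bary_combination: "(\<Sum>i=1..4. bary x i p *\<^sub>R x i) = p"
    and bary_sum: "(\<Sum>i=1..4. bary x i p) = 1"
  using theI'[OF bary_ex1[of p]] unfolding bary_def by auto

lemma bary_eqI:
  assumes "p = (\<Sum>i=1..4. l i *\<^sub>R x i)" "(\<Sum>i=1..4. l i) = 1" "i \<in> {1..4}"
  shows "bary x i p = l i"
  using assms bary_unique[of "\<lambda>i. bary x i p" l i] bary_combination[of p] bary_sum[of p] by simp

text \<open>The right-hand side solves the equations that determine the coordinates. The cases
  \<open>c = 1\<close> and \<open>p = 0\<close> yield additivity and homogeneity from one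
  formula.\<close>

lemma bary_affine:
  "bary x k (p + c *\<^sub>R q) = bary x k p + c * (bary x k q - bary x k 0)"
proof (cases "k \<in> {1..4}")
  case True
  let ?l = "\<lambda>k. bary x k p + c * (bary x k q - bary x k 0)"
  have "(\<Sum>k=1..4. ?l k *\<^sub>R x k) = p + c *\<^sub>R (q - 0)"
    by (simp only: scaleR_add_left scaleR_diff_left sum.distrib sum_subtractf
        scaleR_scaleR[symmetric] scaleR_sum_right[symmetric] bary_combination)
  moreover have "(\<Sum>k=1..4. ?l k) = 1"
    by (simp add: sum.distrib sum_subtractf sum_distrib_left[symmetric] bary_sum)
  ultimately show ?thesis using True by (intro bary_eqI) auto
qed (simp add: bary_outside)

text \<open>The gradients are constant by \<open>grad_bary\<close>, so evaluation at the origin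
  fixes them.\<close>

definition G :: "nat \<Rightarrow> real^3" where "G k = grad (bary x k) 0"

lemma GDERIV_bary: "GDERIV (bary x k) p :> G k"
  and bary_add: "bary x k (p + q) = bary x k p + G k \<bullet> q"
proof -
  define L where "L = (\<lambda>q. bary x k q - bary x k 0)"
  have lin: "linear L"
    using bary_affine[of k _ 1] bary_affine[of k 0] by (intro linearI) (auto simp: L_def)
  define g where "g = (\<chi> i. L (axis i 1))"
  have L: "L q = q \<bullet> g" for q
  proof -
    have "L q = L (\<Sum>i\<in>UNIV. q $ i *\<^sub>R axis i 1)"
      using basis_expansion[of q] by (simp add: scalar_mult_eq_scaleR)
    also have "\<dots> = (\<Sum>i\<in>UNIV. q $ i * g $ i)"
      by (simp add: linear_sum[OF lin] linear_scale[OF lin] g_def)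
    finally show ?thesis by (simp add: inner_vec_def)
  qed
  have b: "bary x k = (\<lambda>q. bary x k 0 + q \<bullet> g)"
  proof
    fix q show "bary x k q = bary x k 0 + q \<bullet> g" using L[of q] unfolding L_def by linarith
  qed
  have D: "GDERIV (bary x k) p :> g" for p
    unfolding gderiv_def by (subst b) (auto intro!: derivative_eq_intros)
  then have "G k = g" unfolding G_def by (rule grad_eqI)
  then show "GDERIV (bary x k) p :> G k" using D by simp
  show "bary x k (p + q) = bary x k p + G k \<bullet> q"
    using bary_affine[of k p 1 q] L[of q] \<open>G k = g\<close> by (simp add: L_def inner_commute)
qed

lemma grad_bary [simp]: "grad (bary x k) p = G k"
  by (rule grad_eqI[OF GDERIV_bary])

lemma bary_diffable: "bary x k \<in> diffable"
  by (rule diffableI[OF GDERIV_bary])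

lemma bary_vertex: "i \<in> {1..4} \<Longrightarrow> bary x k (x i) = of_bool (k = i)"
proof (cases "k \<in> {1..4}")
  case True
  assume "i \<in> {1..4}"
  then show ?thesis using True
    by (intro bary_eqI) (simp_all add: of_bool_def if_distrib[of "\<lambda>c. c *\<^sub>R _"] if_distribR cong: if_cong)
qed (auto simp: bary_outside)

lemma sum_G: "(\<Sum>k=1..4. G k) = 0"
proof -
  have "(\<Sum>k=1..4. bary x k 0) + (\<Sum>k=1..4. G k) \<bullet> q = 1" for q
    using bary_sum[of "0 + q"] unfolding bary_add sum.distrib inner_sum_left .
  then have "(\<Sum>k=1..4. G k) \<bullet> q = 0" for q
    unfolding bary_sum by simp
  then show ?thesis using inner_eq_zero_iff by blast
qed

lemma G_combination: "(\<Sum>k=1..4. (G k \<bullet> q) *\<^sub>R x k) = q"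
proof -
  have "(\<Sum>k=1..4. bary x k 0 *\<^sub>R x k) + (\<Sum>k=1..4. (G k \<bullet> q) *\<^sub>R x k) = 0 + q"
    using bary_combination[of "0 + q"] unfolding bary_add scaleR_add_left sum.distrib .
  then show ?thesis unfolding bary_combination by simp
qed

text \<open>By \<open>G_combination\<close> a vector is recovered from its products with the four
  gradients. Vectors are compared in this way without singling out a basis.\<close>

lemma G_eqI:
  assumes "\<And>k. k \<in> {1..4} \<Longrightarrow> G k \<bullet> u = G k \<bullet> v" shows "u = v"
proof -
  have "(\<Sum>k=1..4. (G k \<bullet> u) *\<^sub>R x k) = (\<Sum>k=1..4. (G k \<bullet> v) *\<^sub>R x k)"
    by (intro sum.cong refl) (simp add: assms)
  then show ?thesis unfolding G_combination .
qed

lemma G_vertex: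
  assumes "j \<in> {1..4}"
  shows "G k \<bullet> (p - x j) = bary x k p - of_bool (k = j)"
  using bary_add[of k "x j" "p - x j"] bary_vertex[OF assms, of k] by simp

lemma G_edge:
  assumes "i \<in> {1..4}" "j \<in> {1..4}"
  shows "G k \<bullet> (x i - x j) = of_bool (k = i) - of_bool (k = j)"
  using assms by (simp add: G_vertex bary_vertex)

abbreviation "vol i j k \<equiv> G i \<bullet> cross3 (G j) (G k)"

text \<open>Otherwise \<open>cross3 (G i) (G j)\<close> would be orthogonal to all four gradients
  and hence zero, although its product with the cross product of the dual edge vectors is 1 by the
  Binet-Cauchy identity \<open>cross3_dot\<close>.\<close>

lemma vol_nonzero:
  assumes "i \<in> {1..4}" "j \<in> {1..4}" "l \<in> {1..4}" "i \<noteq> j" "i \<noteq> l" "j \<noteq> l"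
  shows "vol l i j \<noteq> 0"
proof
  assume 0: "vol l i j = 0"
  let ?w = "cross3 (G i) (G j)"
  obtain k where k: "k \<in> {1..4}" "k \<noteq> i" "k \<noteq> j" "k \<noteq> l" "{1..4} = {i, j, l, k}"
  proof -
    have "card ({1..4} - {i, j, l}) = 1" using assms by (subst card_Diff_subset) auto
    then obtain k where "{1..4} - {i, j, l} = {k}" by (rule card_1_singletonE)
    then show ?thesis using that[of k] assms by blast
  qed
  have "G i + G j + G l + G k = 0"
    using sum_G k assms by (simp add: add.assoc)
  then have "G k = - (G i + G j + G l)" by (simp add: eq_neg_iff_add_eq_0 algebra_simps)
  then have "G k \<bullet> ?w = 0" using 0 by (simp add: inner_diff_left dot_cross_self)
  then have "G m \<bullet> ?w = G m \<bullet> 0" if "m \<in> {1..4}" for m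
    using that 0 k(5) by (auto simp: dot_cross_self)
  then have "?w = 0" by (rule G_eqI)
  moreover have "?w \<bullet> cross3 (x i - x k) (x j - x k) = 1"
    using assms k by (simp add: cross3_dot G_edge)
  ultimately show False by simp
qed

section \<open>Divided powers of the barycentric coordinates\<close>

definition dpow :: "(nat \<Rightarrow> nat) \<Rightarrow> real^3 \<Rightarrow> real" where
  "dpow \<alpha> p = (\<Prod>i=1..4. bary x i p ^ \<alpha> i / fact (\<alpha> i))"

text \<open>The partial derivative of \<open>dpow \<alpha>\<close> in \<open>\<lambda>\<^sub>i\<close>.\<close>

definition dp :: "(nat \<Rightarrow> nat) \<Rightarrow> nat \<Rightarrow> real^3 \<Rightarrow> real" where
  "dp \<alpha> i = (if \<alpha> i = 0 then 0 else dpow (dn \<alpha> i))"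

lemma bern_dpow: "bern x n \<alpha> = (\<lambda>p. fact n * dpow \<alpha> p)"
  by (simp add: bern_def dpow_def prod_dividef fun_eq_iff)

lemma dpow_remove:
  "i \<in> {1..4} \<Longrightarrow> dpow \<alpha> p = bary x i p ^ \<alpha> i / fact (\<alpha> i) * (\<Prod>j\<in>{1..4}-{i}. bary x j p ^ \<alpha> j / fact (\<alpha> j))"
  by (simp add: dpow_def prod.remove[of "{1..4}" i])

lemma bary_dpow:
  assumes "i \<in> {1..4}"
  shows "bary x i p * dpow \<alpha> p = real (\<alpha> i + 1) * dpow (up \<alpha> i) p"
proof -
  have "(\<Prod>j\<in>{1..4}-{i}. bary x j p ^ up \<alpha> i j / fact (up \<alpha> i j)) =
    (\<Prod>j\<in>{1..4}-{i}. bary x j p ^ \<alpha> j / fact (\<alpha> j))"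
    by (intro prod.cong) (auto simp: up_def)
  moreover have "up \<alpha> i i = Suc (\<alpha> i)" by (simp add: up_def)
  ultimately show ?thesis by (simp add: dpow_remove[OF assms] divide_simps)
qed

text \<open>The function is multiplied by the sum of the coordinates, which is 1; this raises the
  degree without changing the polynomial.\<close>

lemma dpow_expand: "dpow \<alpha> p = (\<Sum>k=1..4. real (\<alpha> k + 1) * dpow (up \<alpha> k) p)"
proof -
  have "dpow \<alpha> p = (\<Sum>k=1..4. bary x k p) * dpow \<alpha> p" by (simp add: bary_sum)
  also have "\<dots> = (\<Sum>k=1..4. real (\<alpha> k + 1) * dpow (up \<alpha> k) p)"
    unfolding sum_distrib_right by (intro sum.cong refl bary_dpow)
  finally show ?thesis .
qed

lemma bary_dp:
  assumes "i \<in> {1..4}" shows "bary x i p * dp \<alpha> i p = real (\<alpha> i) * dpow \<alpha> p"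
  using bary_dpow[OF assms, of p "dn \<alpha> i"] by (auto simp: dp_def dn_def up_def)

lemma GDERIV_dpow: "GDERIV (dpow \<alpha>) p :> (\<Sum>i=1..4. dp \<alpha> i p *\<^sub>R G i)"
proof -
  let ?f = "\<lambda>i q. bary x i q ^ \<alpha> i / fact (\<alpha> i)"
  \<comment> \<open>\<open>t ^ k / fact k\<close> has the derivative
    \<open>t ^ (k - 1) / fact (k - 1)\<close>. At \<open>k = 0\<close> truncated subtraction would
    turn this into 1, so the value 0 is given explicitly.\<close>
  let ?d = "\<lambda>i. if \<alpha> i = 0 then 0 else bary x i p ^ (\<alpha> i - 1) / fact (\<alpha> i - 1)"
  have f: "(?f i has_derivative (\<lambda>h. ?d i * (h \<bullet> G i))) (at p)" for i
  proof -
    have "((\<lambda>q. bary x i q ^ \<alpha> i / fact (\<alpha> i)) has_derivative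
      (\<lambda>h. of_nat (\<alpha> i) * (h \<bullet> G i) * bary x i p ^ (\<alpha> i - 1) / fact (\<alpha> i))) (at p)"
      using GDERIV_bary[of i p] unfolding gderiv_def by (auto intro!: derivative_eq_intros)
    moreover have "of_nat (\<alpha> i) * (h \<bullet> G i) * bary x i p ^ (\<alpha> i - 1) / fact (\<alpha> i) = ?d i * (h \<bullet> G i)" for h
      by (cases "\<alpha> i") (simp_all add: divide_simps)
    ultimately show ?thesis by simp
  qed
  have eq: "?d i * (\<Prod>j\<in>{1..4}-{i}. ?f j p) = dp \<alpha> i p" if "i \<in> {1..4}" for i
    using dpow_remove[OF that, of "dn \<alpha> i" p] by (auto simp: dp_def dn_def intro!: prod.cong)
  have "(dpow \<alpha> has_derivative (\<lambda>h. \<Sum>i=1..4. ?d i * (h \<bullet> G i) * (\<Prod>j\<in>{1..4}-{i}. ?f j p))) (at p)"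
    unfolding dpow_def by (rule has_derivative_prod[OF f])
  also have "(\<lambda>h. \<Sum>i=1..4. ?d i * (h \<bullet> G i) * (\<Prod>j\<in>{1..4}-{i}. ?f j p)) =
     (\<lambda>h. h \<bullet> (\<Sum>i=1..4. dp \<alpha> i p *\<^sub>R G i))"
    unfolding inner_sum_right inner_scaleR_right
    by (intro ext sum.cong refl) (simp add: eq[symmetric] mult_ac)
  finally show ?thesis by (simp add: gderiv_def)
qed

lemma grad_dpow: "grad (dpow \<alpha>) p = (\<Sum>i=1..4. dp \<alpha> i p *\<^sub>R G i)"
  by (rule grad_eqI[OF GDERIV_dpow])

lemma dpow_diffable: "dpow \<alpha> \<in> diffable"
  by (rule diffableI[OF GDERIV_dpow])

lemma dp_diffable: "dp \<alpha> i \<in> diffable"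
  using subspace_0[OF subspace_diffable] by (simp add: dp_def dpow_diffable)

end

section \<open>Multi-indices\<close>

lemma finite_indices [simp]: "finite (indices n)"
proof (rule finite_subset)
  show "indices n \<subseteq> {\<alpha>. \<forall>i. (i \<in> {1..4} \<longrightarrow> \<alpha> i \<in> {..n}) \<and> (i \<notin> {1..4} \<longrightarrow> \<alpha> i = 0)}"
    by (auto simp: indices_def intro: member_le_sum)
  show "finite {\<alpha>::nat \<Rightarrow> nat. \<forall>i. (i \<in> {1..4} \<longrightarrow> \<alpha> i \<in> {..n}) \<and> (i \<notin> {1..4} \<longrightarrow> \<alpha> i = 0)}"
    by (intro finite_set_of_finite_funs) auto
qed

lemma indices_le: "\<alpha> \<in> indices n \<Longrightarrow> \<alpha> i \<le> n"
  by (cases "i \<in> {1..4}") (auto simp: indices_def intro: member_le_sum)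

lemma face_indices_subset: "face_indices n A \<subseteq> indices n"
  by (auto simp: face_indices_def)

lemma interior_indices_subset: "interior_indices n A \<subseteq> indices n"
  by (auto simp: interior_indices_def)

lemma finite_face_indices [simp]: "finite (face_indices n A)"
  by (rule finite_subset[OF face_indices_subset]) simp

lemma finite_interior_indices [simp]: "finite (interior_indices n A)"
  by (rule finite_subset[OF interior_indices_subset]) simp

lemma face_indices_full: "face_indices n {1..4} = indices n"
  by (auto simp: face_indices_def)

text \<open>A polynomial with infinitely many roots is zero, and distinct exponents keep the
  coefficients apart.\<close>

lemma sum_powers_eq_0:
  fixes c :: "'i \<Rightarrow> real"
  assumes I: "finite I" "inj_on e I" and 0: "\<And>t. t > 0 \<Longrightarrow> (\<Sum>i\<in>I. c i * t ^ e i) = 0" and j: "j \<in> I"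
  shows "c j = 0"
proof -
  define p where "p = (\<Sum>i\<in>I. monom (c i) (e i))"
  have "p = 0"
  proof (rule ccontr)
    assume "p \<noteq> 0"
    then have "finite {t. poly p t = 0}" by (rule poly_roots_finite)
    moreover have "{0<..} \<subseteq> {t. poly p t = 0}"
      using 0 by (auto simp: p_def poly_sum poly_monom)
    ultimately show False using infinite_Ioi finite_subset by blast
  qed
  then have "0 = coeff p (e j)" by simp
  also have "\<dots> = (\<Sum>i\<in>I. if i = j then c i else 0)"
    unfolding p_def coeff_sum coeff_monom using I j by (intro sum.cong) (auto dest: inj_onD)
  also have "\<dots> = c j" using I j by simp
  finally show ?thesis by simp
qed

lemma digits_eq:
  fixes a b c d N :: nat
  assumes "a + N * b = c + N * d" "a < N" "c < N"
  shows "a = c \<and> b = d"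
proof -
  have "a = (a + N * b) mod N" "b = (a + N * b) div N" using assms(2) by simp_all
  moreover have "c = (c + N * d) mod N" "d = (c + N * d) div N" using assms(3) by simp_all
  ultimately show ?thesis using assms(1) by metis
qed

lemma interval_4: "{1..4} = {1, 2, 3, 4::nat}"
  by auto

text \<open>The entries of a multi-index of degree \<open>n\<close> are at most \<open>n\<close>,
  hence digits in base \<open>n + 1\<close>, and a number determines its digits.\<close>

lemma inj_on_digits:
  "inj_on (\<lambda>\<alpha>. \<Sum>i=1..4. \<alpha> i * Suc n ^ (i - 1)) (indices n)"
proof (rule inj_onI)
  fix \<alpha> \<beta> assume a: "\<alpha> \<in> indices n" and b: "\<beta> \<in> indices n"
    and eq: "(\<Sum>i=1..4. \<alpha> i * Suc n ^ (i - 1)) = (\<Sum>i=1..4. \<beta> i * Suc n ^ (i - 1))"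
  have lt: "\<alpha> i < Suc n" "\<beta> i < Suc n" for i using a b indices_le by (auto simp: less_Suc_eq_le)
  have ex: "(\<Sum>i=1..4. \<gamma> i * Suc n ^ (i - 1)) = \<gamma> 1 + Suc n * (\<gamma> 2 + Suc n * (\<gamma> 3 + Suc n * \<gamma> 4))"
    for \<gamma> :: "nat \<Rightarrow> nat"
    by (simp add: sum_4 algebra_simps power2_eq_square power3_eq_cube)
  have 1: "\<alpha> 1 = \<beta> 1 \<and> \<alpha> 2 + Suc n * (\<alpha> 3 + Suc n * \<alpha> 4) = \<beta> 2 + Suc n * (\<beta> 3 + Suc n * \<beta> 4)"
    using eq lt unfolding ex by (intro digits_eq)
  have 2: "\<alpha> 2 = \<beta> 2 \<and> \<alpha> 3 + Suc n * \<alpha> 4 = \<beta> 3 + Suc n * \<beta> 4"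
    by (rule digits_eq[OF conjunct2[OF 1] lt])
  have 3: "\<alpha> 3 = \<beta> 3 \<and> \<alpha> 4 = \<beta> 4"
    by (rule digits_eq[OF conjunct2[OF 2] lt])
  have "\<alpha> i = \<beta> i" if "i \<in> {1..4}" for i using that 1 2 3 unfolding interval_4 by auto
  moreover have "\<alpha> i = \<beta> i" if "i \<notin> {1..4}" for i using that a b by (auto simp: indices_def)
  ultimately show "\<alpha> = \<beta>" by blast
qed

lemma up_indices: "\<alpha> \<in> indices n \<Longrightarrow> i \<in> {1..4} \<Longrightarrow> up \<alpha> i \<in> indices (Suc n)"
proof -
  assume "\<alpha> \<in> indices n" "i \<in> {1..4}"
  moreover have "(\<Sum>k=1..4. up \<alpha> i k) = Suc (\<Sum>k=1..4. \<alpha> k)" if "i \<in> {1..4}"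
    using that by (simp add: sum.remove[of "{1..4}" i] up_def)
  ultimately show ?thesis by (auto simp: indices_def up_def)
qed

lemma up_dn: "\<alpha> i \<noteq> 0 \<Longrightarrow> up (dn \<alpha> i) i = \<alpha>"
  by (auto simp: up_def dn_def)

lemma dn_up: "dn (up \<alpha> i) i = \<alpha>"
  by (auto simp: up_def dn_def)

lemma dn_indices: "\<alpha> \<in> indices (Suc n) \<Longrightarrow> \<alpha> i \<noteq> 0 \<Longrightarrow> dn \<alpha> i \<in> indices n"
proof -
  assume a: "\<alpha> \<in> indices (Suc n)" "\<alpha> i \<noteq> 0"
  then have i: "i \<in> {1..4}" by (auto simp: indices_def)
  have "(\<Sum>k=1..4. \<alpha> k) = Suc (\<Sum>k=1..4. dn \<alpha> i k)"
    using i a(2) by (simp add: sum.remove[of "{1..4}" i] dn_def)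
  then show ?thesis using a by (auto simp: indices_def dn_def)
qed

lemma move_face_indices:
  assumes "\<alpha> \<in> face_indices n A" "\<alpha> i \<noteq> 0" "j \<in> A" "j \<in> {1..4}" "i \<noteq> j"
  shows "dn (up \<alpha> j) i \<in> face_indices n A"
proof -
  have "up \<alpha> j \<in> indices (Suc n)" using assms by (intro up_indices) (auto simp: face_indices_def)
  then have "dn (up \<alpha> j) i \<in> indices n" using assms by (intro dn_indices) (auto simp: up_def)
  then show ?thesis using assms by (auto simp: face_indices_def dn_def up_def)
qed

section \<open>Polynomial spaces\<close>

lemma prod_graded:
  fixes f :: "'i \<Rightarrow> 'a \<Rightarrow> real"
  assumes one: "(\<lambda>p. 1) \<in> H' (0::nat)"
    and mult: "\<And>m n f g. f \<in> H' m \<Longrightarrow> g \<in> H' n \<Longrightarrow> (\<lambda>p. f p * g p) \<in> H' (m + n)"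
    and "finite A" "\<And>i. i \<in> A \<Longrightarrow> f i \<in> H' (d i)"
  shows "(\<lambda>p. \<Prod>i\<in>A. f i p) \<in> H' (\<Sum>i\<in>A. d i)"
  using assms(3,4)
proof (induction A rule: finite_induct)
  case (insert a A)
  have "(\<lambda>p. f a p * (\<Prod>i\<in>A. f i p)) \<in> H' (d a + (\<Sum>i\<in>A. d i))"
    by (rule mult[OF insert.prems[OF insertI1] insert.IH[OF insert.prems[OF insertI2]]])
  then show ?case by (simp only: prod.insert[OF insert.hyps] sum.insert[OF insert.hyps])
qed (simp add: one)

text \<open>Stated for any multiplicative filtration, because both inclusions between
  \<open>H\<close> and \<open>polys\<close> use it.\<close>

lemma power_graded:
  fixes f :: "'a \<Rightarrow> real"
  assumes one: "(\<lambda>p. 1) \<in> H' (0::nat)"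
    and mult: "\<And>m n f g. f \<in> H' m \<Longrightarrow> g \<in> H' n \<Longrightarrow> (\<lambda>p. f p * g p) \<in> H' (m + n)"
    and "f \<in> H' 1"
  shows "(\<lambda>p. f p ^ k) \<in> H' k"
proof (induction k)
  case (Suc k)
  have "(\<lambda>p. f p * f p ^ k) \<in> H' (1 + k)" by (intro mult assms(3) Suc)
  then show ?case by (simp only: power_Suc plus_1_eq_Suc)
qed (simp add: one)

text \<open>Products are bilinear, so membership extends from generators to spans one factor at a
  time.\<close>

lemma mult_span:
  fixes f g :: "'a \<Rightarrow> real"
  assumes "\<And>u v. u \<in> S \<Longrightarrow> v \<in> T \<Longrightarrow> (\<lambda>p. u p * v p) \<in> W" "subspace W" "f \<in> span S" "g \<in> span T"
  shows "(\<lambda>p. f p * g p) \<in> W"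
proof -
  note W = subspace_add[OF assms(2)] subspace_scale[OF assms(2)] subspace_0[OF assms(2)]
  have 1: "(\<lambda>p. u p * g p) \<in> W" if "u \<in> S" for u
  proof (rule span_induct[OF assms(4), of "\<lambda>g. (\<lambda>p. u p * g p) \<in> W"])
    show "subspace {v. (\<lambda>p. u p * v p) \<in> W}"
      unfolding subspace_def
    proof (intro conjI ballI allI; clarsimp)
      show "(\<lambda>p. 0) \<in> W" using W(3) by (simp add: zero_fun_def)
      show "(\<lambda>p. u p * (v p + w p)) \<in> W" if "(\<lambda>p. u p * v p) \<in> W" "(\<lambda>p. u p * w p) \<in> W" for v w
        using W(1)[OF that] by (simp add: plus_fun_def algebra_simps)
      show "(\<lambda>p. u p * (c * v p)) \<in> W" if "(\<lambda>p. u p * v p) \<in> W" for v and c :: real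
        using W(2)[OF that, of c] by (simp add: scaleR_fun_def mult.left_commute)
    qed
  qed (use assms(1) that in auto)
  show ?thesis
  proof (rule span_induct[OF assms(3), of "\<lambda>f. (\<lambda>p. f p * g p) \<in> W"])
    show "subspace {v. (\<lambda>p. v p * g p) \<in> W}"
      unfolding subspace_def
    proof (intro conjI ballI allI; clarsimp)
      show "(\<lambda>p. 0) \<in> W" using W(3) by (simp add: zero_fun_def)
      show "(\<lambda>p. (v p + w p) * g p) \<in> W" if "(\<lambda>p. v p * g p) \<in> W" "(\<lambda>p. w p * g p) \<in> W" for v w
        using W(1)[OF that] by (simp add: plus_fun_def algebra_simps)
      show "(\<lambda>p. c * v p * g p) \<in> W" if "(\<lambda>p. v p * g p) \<in> W" for v and c :: real
        using W(2)[OF that, of c] by (simp add: scaleR_fun_def mult.assoc)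
    qed
  qed (use 1 in auto)
qed

lemma polys_mult:
  assumes "f \<in> polys m" "g \<in> polys n" shows "(\<lambda>p. f p * g p) \<in> polys (m + n)"
proof (rule mult_span)
  fix u v :: "real^3 \<Rightarrow> real"
  assume "u \<in> monomial3 ` {(a, b, c). a + b + c \<le> m}" "v \<in> monomial3 ` {(a, b, c). a + b + c \<le> n}"
  then obtain a b c a' b' c' where "a + b + c \<le> m" "a' + b' + c' \<le> n"
    "u = monomial3 (a, b, c)" "v = monomial3 (a', b', c')" by blast
  then have "(\<lambda>p. u p * v p) = monomial3 (a + a', b + b', c + c')"
    "(a + a') + (b + b') + (c + c') \<le> m + n"
    by (auto simp: monomial3_def power_add)
  then show "(\<lambda>p. u p * v p) \<in> polys (m + n)" unfolding polys_def by (auto intro: span_base)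
qed (use assms in \<open>auto simp: polys_def\<close>)

lemma monomial3_polys: "a + b + c \<le> n \<Longrightarrow> monomial3 (a, b, c) \<in> polys n"
  unfolding polys_def by (auto intro: span_base)

lemma subspace_polys: "subspace (polys n)"
  by (simp add: polys_def)

lemma one_polys: "(\<lambda>p. 1) \<in> polys n"
  using monomial3_polys[of 0 0 0 n] by (simp add: monomial3_def)

lemma coord_polys: "(\<lambda>p. p $ i) \<in> polys 1"
  using monomial3_polys[of 1 0 0 1] monomial3_polys[of 0 1 0 1] monomial3_polys[of 0 0 1 1]
    exhaust_3[of i] by (auto simp: monomial3_def)

lemma polys_mono: "m \<le> n \<Longrightarrow> polys m \<subseteq> polys n"
  unfolding polys_def by (intro span_mono image_mono) auto

context tetrahedron
begin

text \<open>Substituting \<open>\<lambda>\<^sub>i \<propto> t\<^bsup>N\<^sup>i\<^esup>\<close> with \<open>N > n\<close> separates the monomials of degree \<open>n\<close>.\<close>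

lemma dpow_coeffs_eq_0:
  assumes 0: "\<And>p. p \<in> convex hull (x ` {1..4}) \<Longrightarrow> (\<Sum>\<alpha>\<in>indices n. c \<alpha> * dpow \<alpha> p) = 0"
    and a: "\<alpha> \<in> indices n"
  shows "c \<alpha> = 0"
proof -
  let ?e = "\<lambda>\<alpha>. \<Sum>i=1..4. \<alpha> i * Suc n ^ (i - 1)"
  let ?F = "\<lambda>\<alpha>. \<Prod>i=1..4. fact (\<alpha> i) :: real"
  have "c \<alpha> / ?F \<alpha> = 0"
  proof (rule sum_powers_eq_0[OF finite_indices inj_on_digits _ a])
    fix t :: real assume t: "t > 0"
    define l where "l = (\<lambda>i::nat. t ^ (Suc n ^ (i - 1)))"
    \<comment> \<open>Dividing by \<open>s\<close> makes the weights convex, so the test point lies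
      in the tetrahedron itself. The power \<open>s ^ n\<close> is common to all monomials of degree
      \<open>n\<close> and can be cleared.\<close>
    define s where "s = (\<Sum>i=1..4. l i)"
    have l: "l i > 0" for i using t by (simp add: l_def)
    then have s: "s > 0" unfolding s_def by (intro sum_pos) auto
    define p where "p = (\<Sum>i=1..4. (l i / s) *\<^sub>R x i)"
    have s1: "(\<Sum>i=1..4. l i / s) = 1" using s by (simp add: sum_divide_distrib[symmetric] s_def[symmetric])
    have "p \<in> convex hull (x ` {1..4})"
      unfolding p_def
    proof (rule convex_sum)
      show "0 \<le> l i / s" for i using l[of i] s by simp
      show "x i \<in> convex hull (x ` {1..4})" if "i \<in> {1..4}" for i using that by (intro hull_inc) blast
    qed (use s1 in auto)
    then have z: "(\<Sum>\<alpha>\<in>indices n. c \<alpha> * dpow \<alpha> p) = 0" by (rule 0)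
    have b: "bary x i p = l i / s" if "i \<in> {1..4}" for i
      using p_def s1 that by (rule bary_eqI)
    have "dpow \<beta> p = t ^ ?e \<beta> / (s ^ n * ?F \<beta>)" if "\<beta> \<in> indices n" for \<beta>
    proof -
      have "dpow \<beta> p = (\<Prod>i=1..4. (l i ^ \<beta> i / s ^ \<beta> i) / fact (\<beta> i))"
        unfolding dpow_def by (intro prod.cong refl) (simp only: b power_divide)
      also have "\<dots> = (\<Prod>i=1..4. l i ^ \<beta> i) / (\<Prod>i=1..4. s ^ \<beta> i) / ?F \<beta>"
        unfolding prod_dividef ..
      also have "(\<Prod>i=1..4. s ^ \<beta> i) = s ^ n"
        using that unfolding power_sum[symmetric] by (simp add: indices_def)
      also have "(\<Prod>i=1..4. l i ^ \<beta> i) = t ^ ?e \<beta>"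
        unfolding l_def power_sum power_mult[symmetric] by (simp only: mult.commute)
      finally show ?thesis by simp
    qed
    then have "(\<Sum>\<alpha>\<in>indices n. c \<alpha> * dpow \<alpha> p) = (\<Sum>\<alpha>\<in>indices n. c \<alpha> / ?F \<alpha> * t ^ ?e \<alpha>) / s ^ n"
      unfolding sum_divide_distrib by (intro sum.cong refl) (simp add: mult_ac)
    then show "(\<Sum>\<alpha>\<in>indices n. c \<alpha> / ?F \<alpha> * t ^ ?e \<alpha>) = 0" using z s by simp
  qed
  then show ?thesis by simp
qed

lemma dpow_indep: "indep_family dpow (indices n)"
  unfolding indep_family_def
proof (intro conjI allI impI ballI)
  fix c \<alpha> assume 0: "(\<Sum>\<alpha>\<in>indices n. c \<alpha> *\<^sub>R dpow \<alpha>) = 0" and a: "\<alpha> \<in> indices n"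
  have "(\<Sum>\<alpha>\<in>indices n. c \<alpha> * dpow \<alpha> p) = 0" for p
    using fun_cong[OF 0, of p] by (simp add: sum_fun_apply)
  then show "c \<alpha> = 0" using a by (rule dpow_coeffs_eq_0)
qed simp

text \<open>A linear form with prescribed values on the divided powers of degree \<open>n\<close>.
  Applied to an identity between polynomials, it extracts a coefficient or any weighted sum of
  coefficients.\<close>

lemma dpow_functional:
  fixes c :: "(nat \<Rightarrow> nat) \<Rightarrow> real"
  obtains K :: "(real^3 \<Rightarrow> real) \<Rightarrow> real" where "linear K" "\<And>\<alpha>. \<alpha> \<in> indices n \<Longrightarrow> K (dpow \<alpha>) = c \<alpha>"
proof -
  obtain K where "linear K" "\<forall>f\<in>dpow ` indices n. K f = c (inv_into (indices n) dpow f)"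
    using linear_independent_extend[OF indep_family_independent[OF dpow_indep[of n]],
        where f="\<lambda>f. c (inv_into (indices n) dpow f)"] by blast
  then show ?thesis using that[of K] inv_into_f_f[OF indep_family_inj[OF dpow_indep]] by auto
qed

text \<open>The Bernstein description of the polynomials of degree at most \<open>n\<close>;
  \<open>H_eq_polys\<close> identifies it with \<open>polys n\<close>.\<close>

definition H :: "nat \<Rightarrow> (real^3 \<Rightarrow> real) set" where "H n = span (dpow ` indices n)"

lemma subspace_H [simp]: "subspace (H n)"
  by (simp add: H_def)

lemma dpow_H: "\<alpha> \<in> indices n \<Longrightarrow> dpow \<alpha> \<in> H n"
  by (simp add: H_def span_base)

lemma H_mult:
  assumes "f \<in> H m" "g \<in> H n" shows "(\<lambda>p. f p * g p) \<in> H (m + n)"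
proof (rule mult_span)
  fix u v assume "u \<in> dpow ` indices m" "v \<in> dpow ` indices n"
  then obtain \<alpha> \<beta> where ab: "\<alpha> \<in> indices m" "\<beta> \<in> indices n" "u = dpow \<alpha>" "v = dpow \<beta>" by blast
  let ?c = "\<Prod>i=1..4. fact (\<alpha> i + \<beta> i) / (fact (\<alpha> i) * fact (\<beta> i)) :: real"
  have "u p * v p = ?c * dpow (\<lambda>i. \<alpha> i + \<beta> i) p" for p
    unfolding ab dpow_def prod.distrib[symmetric] by (intro prod.cong) (auto simp: power_add)
  moreover have "(\<lambda>i. \<alpha> i + \<beta> i) \<in> indices (m + n)"
    using ab by (auto simp: indices_def sum.distrib)
  ultimately show "(\<lambda>p. u p * v p) \<in> H (m + n)"
    using subspace_scale[OF subspace_H dpow_H, of "\<lambda>i. \<alpha> i + \<beta> i" "m + n" ?c]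
    by (simp add: scaleR_fun_def)
qed (use assms in \<open>auto simp: H_def\<close>)

lemma one_H: "(\<lambda>p. 1) \<in> H 0"
proof -
  have "dpow (\<lambda>_. 0) = (\<lambda>p. 1)" by (simp add: dpow_def fun_eq_iff)
  then show ?thesis using dpow_H[of "\<lambda>_. 0" 0] by (simp add: indices_def)
qed

lemma H_Suc: "H n \<subseteq> H (Suc n)"
  unfolding H_def
proof (rule span_minimal[OF image_subsetI])
  fix \<alpha> assume a: "\<alpha> \<in> indices n"
  have "dpow \<alpha> = (\<Sum>k=1..4. real (\<alpha> k + 1) *\<^sub>R dpow (up \<alpha> k))"
    using dpow_expand[of \<alpha>] by (intro ext) (simp add: sum_fun_apply)
  also have "\<dots> \<in> span (dpow ` indices (Suc n))"
    by (intro span_sum span_scale span_base imageI up_indices[OF a])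
  finally show "dpow \<alpha> \<in> span (dpow ` indices (Suc n))" .
qed simp

lemma H_mono: "m \<le> n \<Longrightarrow> H m \<subseteq> H n"
  using H_Suc by (rule lift_Suc_mono_le)

lemma bary_H: "k \<in> {1..4} \<Longrightarrow> bary x k \<in> H 1"
proof -
  assume k: "k \<in> {1..4}"
  have "bary x k p = dpow (up (\<lambda>_. 0) k) p" for p
    using bary_dpow[OF k, of p "\<lambda>_. 0"] by (simp add: dpow_def)
  then have "bary x k = dpow (up (\<lambda>_. 0) k)" by blast
  then show ?thesis using up_indices[of "\<lambda>_. 0" 0 k] k by (auto simp: indices_def intro: dpow_H)
qed

lemma coord_H: "(\<lambda>p. p $ i) \<in> H 1"
proof -
  have "(\<lambda>p. p $ i) = (\<Sum>k=1..4. (x k $ i) *\<^sub>R bary x k)"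
  proof
    fix p :: "real^3"
    have "p $ i = (\<Sum>k=1..4. bary x k p *\<^sub>R x k) $ i" by (simp only: bary_combination)
    then show "p $ i = (\<Sum>k=1..4. (x k $ i) *\<^sub>R bary x k) p" by (simp add: sum_fun_apply mult.commute)
  qed
  then show ?thesis using bary_H by (auto intro!: subspace_sum subspace_scale)
qed

lemma polys_subset_H: "polys n \<subseteq> H n"
  unfolding polys_def
proof (rule span_minimal[OF _ subspace_H], clarify)
  fix a b c :: nat assume abc: "a + b + c \<le> n"
  note pw = power_graded[of H, OF one_H H_mult coord_H]
  have "(\<lambda>p. p $ 1 ^ a * p $ 2 ^ b * p $ 3 ^ c) \<in> H (a + b + c)"
    by (intro H_mult pw)
  then show "monomial3 (a, b, c) \<in> H n" using H_mono[OF abc] by (auto simp: monomial3_def)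
qed

lemma bary_polys: "bary x k \<in> polys 1"
proof -
  have "bary x k = bary x k 0 *\<^sub>R (\<lambda>p. 1) + (\<Sum>i\<in>UNIV. (G k $ i) *\<^sub>R (\<lambda>p. p $ i))"
  proof
    fix p show "bary x k p = (bary x k 0 *\<^sub>R (\<lambda>p. 1) + (\<Sum>i\<in>UNIV. (G k $ i) *\<^sub>R (\<lambda>p. p $ i))) p"
      using bary_add[of k 0 p] by (simp add: sum_fun_apply inner_vec_def)
  qed
  also have "\<dots> \<in> polys 1"
    by (intro subspace_add subspace_sum subspace_scale subspace_polys one_polys coord_polys)
  finally show ?thesis .
qed

lemma H_eq_polys: "H n = polys n"
proof
  show "H n \<subseteq> polys n"
    unfolding H_def
  proof (rule span_minimal[OF image_subsetI subspace_polys])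
    fix \<alpha> assume a: "\<alpha> \<in> indices n"
    have "(\<lambda>p. bary x i p ^ \<alpha> i / fact (\<alpha> i)) \<in> polys (\<alpha> i)" for i
    proof -
      have "(\<lambda>p. bary x i p ^ \<alpha> i) \<in> polys (\<alpha> i)"
        by (intro power_graded[of polys] one_polys polys_mult bary_polys)
      then have "inverse (fact (\<alpha> i)) *\<^sub>R (\<lambda>p. bary x i p ^ \<alpha> i) \<in> polys (\<alpha> i)"
        by (intro subspace_scale subspace_polys)
      moreover have "inverse (fact (\<alpha> i)) *\<^sub>R (\<lambda>p. bary x i p ^ \<alpha> i) =
          (\<lambda>p. bary x i p ^ \<alpha> i / fact (\<alpha> i))"
        by (intro ext) (simp add: divide_inverse)
      ultimately show ?thesis by simp
    qed
    then have "(\<lambda>p. \<Prod>i=1..4. bary x i p ^ \<alpha> i / fact (\<alpha> i)) \<in> polys (\<Sum>i=1..4. \<alpha> i)"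
      by (intro prod_graded[of polys, OF one_polys polys_mult]) auto
    then show "dpow \<alpha> \<in> polys n" using a by (simp add: dpow_def[abs_def] indices_def)
  qed
qed (rule polys_subset_H)

text \<open>By \<open>dpow_coeffs_eq_0\<close> the values on the tetrahedron alone determine the
  coefficients. This makes \<open>restr\<close> injective on polynomial spaces.\<close>

lemma H_restr_eq_0:
  assumes "f \<in> H n" "restr (convex hull (x ` {1..4})) f = 0" shows "f = 0"
proof -
  obtain c where c: "f = (\<Sum>\<alpha>\<in>indices n. c \<alpha> *\<^sub>R dpow \<alpha>)"
    using assms(1) unfolding H_def by (rule span_familyE) simp_all
  have "(\<Sum>\<alpha>\<in>indices n. c \<alpha> * dpow \<alpha> p) = 0" if "p \<in> convex hull (x ` {1..4})" for p
    using fun_cong[OF assms(2), of p] that by (simp add: restr_def c sum_fun_apply)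
  then have "c \<alpha> = 0" if "\<alpha> \<in> indices n" for \<alpha> using that by (rule dpow_coeffs_eq_0)
  then show ?thesis unfolding c by simp
qed

lemma vec_H_restr_eq_0:
  assumes "v \<in> vec_fields (H n)" "restr (convex hull (x ` {1..4})) v = 0" shows "v = 0"
proof -
  have "(\<lambda>p. v p $ i) = 0" for i
  proof (rule H_restr_eq_0)
    show "(\<lambda>p. v p $ i) \<in> H n" using assms(1) by (simp add: vec_fields_def)
    show "restr (convex hull (x ` {1..4})) (\<lambda>p. v p $ i) = 0"
    proof
      fix p show "restr (convex hull (x ` {1..4})) (\<lambda>p. v p $ i) p = 0 p"
        using fun_cong[OF assms(2), of p] by (auto simp: restr_def split: if_splits)
    qed
  qed
  then show ?thesis by (auto simp: fun_eq_iff vec_eq_iff)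
qed

lemma dp_H: "\<alpha> \<in> indices (Suc n) \<Longrightarrow> dp \<alpha> i \<in> H n"
  by (auto simp: dp_def dn_indices intro!: dpow_H subspace_0)

section \<open>The weighted graph Laplacian on multi-indices\<close>

text \<open>\<open>A\<close> is the vertex set of a face or of the whole tetrahedron, and each term
  moves one unit from \<open>i\<close> to \<open>j\<close>. Where \<open>\<alpha> i = 0\<close> and
  \<open>dn\<close> truncates, the weight is zero.\<close>

definition lap :: "nat set \<Rightarrow> (nat \<Rightarrow> nat) \<Rightarrow> real^3 \<Rightarrow> real" where
  "lap A \<alpha> = (\<Sum>i\<in>A. \<Sum>j\<in>A - {i}. (real (\<alpha> i) * real (\<alpha> j + 1)) *\<^sub>R (dpow \<alpha> - dpow (dn (up \<alpha> j) i)))"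

text \<open>
  Evaluating the equation with the functional \<open>dpow \<alpha> \<mapsto> c \<alpha>\<close> turns its left-hand side into the
  Dirichlet form \<open>\<Sum> w (c \<alpha> - c \<beta>)\<^sup>2 / 2\<close> over the edges \<open>\<alpha>, \<beta>\<close> of the graph.
\<close>

lemma lap_kernel:
  assumes A: "A \<subseteq> {1..4}" "A \<noteq> {}"
    and eq: "(\<Sum>\<alpha>\<in>face_indices n A. c \<alpha> *\<^sub>R lap A \<alpha>) + d *\<^sub>R (\<Sum>\<alpha>\<in>indices n. dpow \<alpha>) + R = 0"
    and R: "R \<in> span (dpow ` (indices n - face_indices n A))"
  shows "d = 0" and "\<alpha> \<in> face_indices n A \<Longrightarrow> \<beta> \<in> face_indices n A \<Longrightarrow> c \<alpha> = c \<beta>"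
proof -
  let ?F = "face_indices n A"
  let ?m = "\<lambda>\<alpha> i j. dn (up \<alpha> j) i"
  have finA: "finite A" using A finite_subset by blast
  \<comment> \<open>A functional that vanishes on the indices off the face removes \<open>R\<close>.
    It leaves one scalar equation for every weight \<open>k\<close> on the face indices.\<close>
  have test: "(\<Sum>\<alpha>\<in>?F. c \<alpha> * (\<Sum>i\<in>A. \<Sum>j\<in>A - {i}. real (\<alpha> i) * real (\<alpha> j + 1) * (k \<alpha> - k (?m \<alpha> i j))))
      + d * (\<Sum>\<alpha>\<in>?F. k \<alpha>) = 0" for k :: "(nat \<Rightarrow> nat) \<Rightarrow> real"
  proof -
    obtain K :: "(real^3 \<Rightarrow> real) \<Rightarrow> real" where K: "linear K"
      "\<And>\<alpha>. \<alpha> \<in> indices n \<Longrightarrow> K (dpow \<alpha>) = (if \<alpha> \<in> ?F then k \<alpha> else 0)"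
      using dpow_functional[of n "\<lambda>\<alpha>. if \<alpha> \<in> ?F then k \<alpha> else 0"] by blast
    have KR: "K R = 0"
      by (rule linear_eq_0_on_span[OF K(1) _ R]) (auto simp: K(2))
    have Kl: "K (lap A \<alpha>) = (\<Sum>i\<in>A. \<Sum>j\<in>A - {i}. real (\<alpha> i) * real (\<alpha> j + 1) * (k \<alpha> - k (?m \<alpha> i j)))"
      if a: "\<alpha> \<in> ?F" for \<alpha>
      unfolding lap_def linear_sum[OF K(1)] linear_scale[OF K(1)] linear_diff[OF K(1)] real_scaleR_def
    proof (intro sum.cong refl)
      fix i j assume ij: "i \<in> A" "j \<in> A - {i}"
      show "real (\<alpha> i) * real (\<alpha> j + 1) * (K (dpow \<alpha>) - K (dpow (?m \<alpha> i j))) =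
        real (\<alpha> i) * real (\<alpha> j + 1) * (k \<alpha> - k (?m \<alpha> i j))"
      proof (cases "\<alpha> i = 0")
        case False
        then have "?m \<alpha> i j \<in> ?F" using a ij A by (intro move_face_indices) auto
        then show ?thesis using a K(2) face_indices_subset by (auto simp: subset_iff)
      qed simp
    qed
    have "K (\<Sum>\<alpha>\<in>indices n. dpow \<alpha>) = (\<Sum>\<alpha>\<in>?F. k \<alpha>)"
      unfolding linear_sum[OF K(1)] using face_indices_subset
      by (intro sum.mono_neutral_cong_right) (auto simp: K(2) subset_iff)
    moreover have "K ((\<Sum>\<alpha>\<in>?F. c \<alpha> *\<^sub>R lap A \<alpha>) + d *\<^sub>R (\<Sum>\<alpha>\<in>indices n. dpow \<alpha>) + R) = 0"
      unfolding eq by (rule linear_0[OF K(1)])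
    ultimately show ?thesis
      by (simp add: linear_add[OF K(1)] linear_sum[OF K(1), of _ ?F] linear_scale[OF K(1)] KR Kl)
  qed
  \<comment> \<open>For the weight 1 all differences vanish, and only \<open>d\<close> times the
    number of face indices is left.\<close>
  show d: "d = 0"
  proof -
    obtain a where a: "a \<in> A" using A by blast
    have "(\<lambda>i. if i = a then n else 0) \<in> ?F" using a A by (auto simp: face_indices_def indices_def)
    then have "card ?F \<noteq> 0" by auto
    then show ?thesis using test[of "\<lambda>_. 1"] by simp
  qed
  \<comment> \<open>\<open>Q\<close> is the set of directed edges of positive weight and
    \<open>s\<close> reverses an edge. The sum tested with \<open>c\<close> is added to its reversed
    copy, which completes the squares of the differences.\<close>
  define Q where "Q = (SIGMA \<alpha>:?F. SIGMA i:{i\<in>A. \<alpha> i \<noteq> 0}. A - {i})"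
  define w where "w = (\<lambda>(\<alpha> :: nat \<Rightarrow> nat, i :: nat, j). real (\<alpha> i) * real (\<alpha> j + 1))"
  define s where "s = (\<lambda>(\<alpha>, i, j). (?m \<alpha> i j, j, i))"
  let ?c' = "\<lambda>(\<alpha>, i, j). c (?m \<alpha> i j)"
  have finQ: "finite Q" unfolding Q_def using finA by (intro finite_SigmaI) auto
  have sQ: "s q \<in> Q" and ss: "s (s q) = q" and ws: "w (s q) = w q"
    and cs: "c (fst (s q)) = ?c' q" "?c' (s q) = c (fst q)" and wpos: "w q > 0" if "q \<in> Q" for q
  proof -
    obtain \<alpha> i j where q: "q = (\<alpha>, i, j)" by (cases q) auto
    have q': "\<alpha> \<in> ?F" "i \<in> A" "j \<in> A" "i \<noteq> j" "\<alpha> i \<noteq> 0" using that by (auto simp: Q_def q)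
    show "s q \<in> Q" using move_face_indices[of \<alpha> n A i j] q' A
      by (auto simp: s_def q Q_def) (auto simp: up_def dn_def)
    have m: "?m (?m \<alpha> i j) j i = \<alpha>" using q' by (auto simp: up_def dn_def)
    show "s (s q) = q" by (simp add: s_def q m)
    show "c (fst (s q)) = ?c' q" "?c' (s q) = c (fst q)" by (simp_all add: s_def q m)
    show "w (s q) = w q" using q' by (auto simp: s_def q w_def up_def dn_def of_nat_diff)
    show "w q > 0" using q' by (auto simp: q w_def)
  qed
  have "(\<Sum>q\<in>Q. w q * (c (fst q) - ?c' q) * c (fst q)) =
    (\<Sum>\<alpha>\<in>?F. \<Sum>i\<in>{i\<in>A. \<alpha> i \<noteq> 0}. \<Sum>j\<in>A - {i}. c \<alpha> * (real (\<alpha> i) * real (\<alpha> j + 1) * (c \<alpha> - c (?m \<alpha> i j))))"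
  proof -
    have inner: "(\<Sum>i\<in>{i\<in>A. \<alpha> i \<noteq> 0}. \<Sum>j\<in>A - {i}. f i j) =
        (\<Sum>r\<in>(SIGMA i:{i\<in>A. \<alpha> i \<noteq> 0}. A - {i}). f (fst r) (snd r))" for \<alpha> and f :: "nat \<Rightarrow> nat \<Rightarrow> real"
      using finA by (simp add: sum.Sigma split_def)
    have fin: "\<forall>\<alpha>\<in>?F. finite (SIGMA i:{i\<in>A. \<alpha> i \<noteq> 0}. A - {i})"
      using finA by (intro ballI finite_SigmaI) auto
    show ?thesis
      unfolding Q_def inner sum.Sigma[OF finite_face_indices fin]
      by (intro sum.cong refl) (simp add: split_def w_def mult_ac)
  qed
  also have "\<dots> = (\<Sum>\<alpha>\<in>?F. c \<alpha> * (\<Sum>i\<in>A. \<Sum>j\<in>A - {i}. real (\<alpha> i) * real (\<alpha> j + 1) * (c \<alpha> - c (?m \<alpha> i j))))"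
    unfolding sum_distrib_left using finA
    by (intro sum.cong refl sum.mono_neutral_left) auto
  also have "\<dots> = 0" using test[of c] d by simp
  finally have S: "(\<Sum>q\<in>Q. w q * (c (fst q) - ?c' q) * c (fst q)) = 0" .
  have "(\<Sum>q\<in>Q. w q * (c (fst q) - ?c' q) * c (fst q)) =
     (\<Sum>q\<in>Q. w (s q) * (c (fst (s q)) - ?c' (s q)) * c (fst (s q)))"
    by (rule sum.reindex_bij_witness[of Q s s]) (simp_all add: sQ ss)
  also have "\<dots> = (\<Sum>q\<in>Q. w q * (?c' q - c (fst q)) * ?c' q)"
    by (intro sum.cong refl) (simp only: ws cs)
  finally have "(\<Sum>q\<in>Q. w q * (c (fst q) - ?c' q) * c (fst q) + w q * (?c' q - c (fst q)) * ?c' q) = 0"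
    using S unfolding sum.distrib by simp
  moreover have "w q * (c (fst q) - ?c' q) * c (fst q) + w q * (?c' q - c (fst q)) * ?c' q =
    w q * (c (fst q) - ?c' q)\<^sup>2" for q
    by (simp add: power2_eq_square algebra_simps)
  ultimately have "(\<Sum>q\<in>Q. w q * (c (fst q) - ?c' q)\<^sup>2) = 0" by simp
  moreover have "0 \<le> w q * (c (fst q) - ?c' q)\<^sup>2" if "q \<in> Q" for q
    by (intro mult_nonneg_nonneg less_imp_le[OF wpos[OF that]] zero_le_power2)
  ultimately have terms: "w q * (c (fst q) - ?c' q)\<^sup>2 = 0" if "q \<in> Q" for q
    using sum_nonneg_eq_0_iff[OF finQ, of "\<lambda>q. w q * (c (fst q) - ?c' q)\<^sup>2"] that by blast
  have edge: "c (fst q) = ?c' q" if "q \<in> Q" for q using wpos[OF that] terms[OF that] by simp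
  have step: "c \<alpha> = c (?m \<alpha> i j)" if "\<alpha> \<in> ?F" "i \<in> A" "j \<in> A" "i \<noteq> j" "\<alpha> i \<noteq> 0" for \<alpha> i j
    using that edge[of "(\<alpha>, i, j)"] by (simp add: Q_def)
  obtain a where a: "a \<in> A" using A by blast
  \<comment> \<open>Connectedness: moving units to the fixed vertex \<open>a\<close> ends at the
    index concentrated there, and \<open>c\<close> is unchanged along each move.\<close>
  have const: "c \<alpha> = c (\<lambda>i. if i = a then n else 0)" if "\<alpha> \<in> ?F" for \<alpha>
    using that
  proof (induction "n - \<alpha> a" arbitrary: \<alpha> rule: less_induct)
    case less
    show ?case
    proof (cases "\<exists>i\<in>A. i \<noteq> a \<and> \<alpha> i \<noteq> 0")
      case True
      then obtain i where i: "i \<in> A" "i \<noteq> a" "\<alpha> i \<noteq> 0" by blast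
      have mem: "?m \<alpha> i a \<in> ?F" using less.prems i a A by (intro move_face_indices) auto
      have ma: "?m \<alpha> i a a = Suc (\<alpha> a)" using i by (simp add: up_def dn_def)
      have "?m \<alpha> i a a \<le> n" using mem face_indices_subset indices_le by blast
      then have "c (?m \<alpha> i a) = c (\<lambda>i. if i = a then n else 0)"
        using ma by (intro less.hyps mem) simp
      then show ?thesis using step[OF less.prems i(1) a i(2,3)] by simp
    next
      case False
      then have z: "\<alpha> i = 0" if "i \<noteq> a" for i
        using that less.prems by (cases "i \<in> {1..4}") (auto simp: face_indices_def indices_def)
      have "(\<Sum>i=1..4. \<alpha> i) = \<alpha> a"
        using a A z by (subst sum.mono_neutral_right[of _ "{a}"]) auto
      then have "\<alpha> a = n" using less.prems by (simp add: face_indices_def indices_def)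
      then have "\<alpha> = (\<lambda>i. if i = a then n else 0)" using z by auto
      then show ?thesis by simp
    qed
  qed
  show "c \<alpha> = c \<beta>" if "\<alpha> \<in> ?F" "\<beta> \<in> ?F" using const[OF that(1)] const[OF that(2)] by simp
qed

end

lemma fact_plus_1: "fact (n + 1) = (real n + 1) * fact n"
  unfolding Suc_eq_plus1[symmetric] fact_Suc by simp

context tetrahedron
begin

text \<open>The multinomial expansion of the power of the coordinate sum, divided by
  \<open>fact n\<close>. It shows that a constant function has equal coefficients at all
  indices.\<close>

lemma sum_dpow: "(\<Sum>\<alpha>\<in>indices n. dpow \<alpha> p) = 1 / fact n"
proof (induction n)
  case 0
  have "\<alpha> i = 0" if "\<alpha> \<in> indices 0" for \<alpha> i using indices_le[OF that, of i] by simp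
  moreover have "(\<lambda>_. 0) \<in> indices 0" by (simp add: indices_def)
  ultimately have "indices 0 = {\<lambda>_. 0}" by blast
  then show ?case by (simp add: dpow_def)
next
  case (Suc n)
  \<comment> \<open>Reindexing by \<open>\<beta> = up \<alpha> k\<close>; the indices that are not
    reached have \<open>\<beta> k = 0\<close> and contribute nothing.\<close>
  have eq: "(\<Sum>\<alpha>\<in>indices n. real (\<alpha> k + 1) * dpow (up \<alpha> k) p) = (\<Sum>\<beta>\<in>indices (Suc n). real (\<beta> k) * dpow \<beta> p)"
    if k: "k \<in> {1..4}" for k
  proof -
    have "(\<Sum>\<alpha>\<in>indices n. real (\<alpha> k + 1) * dpow (up \<alpha> k) p) =
        (\<Sum>\<beta>\<in>{\<beta>\<in>indices (Suc n). \<beta> k \<noteq> 0}. real (\<beta> k) * dpow \<beta> p)"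
      using k by (intro sum.reindex_bij_witness[of _ "\<lambda>\<beta>. dn \<beta> k" "\<lambda>\<alpha>. up \<alpha> k"])
        (auto simp: up_indices dn_indices dn_up up_dn, simp_all add: up_def)
    also have "\<dots> = (\<Sum>\<beta>\<in>indices (Suc n). real (\<beta> k) * dpow \<beta> p)"
      by (intro sum.mono_neutral_left) auto
    finally show ?thesis .
  qed
  have "(\<Sum>\<alpha>\<in>indices n. dpow \<alpha> p) = (\<Sum>\<alpha>\<in>indices n. \<Sum>k=1..4. real (\<alpha> k + 1) * dpow (up \<alpha> k) p)"
    by (intro sum.cong refl dpow_expand)
  also have "\<dots> = (\<Sum>k=1..4. \<Sum>\<beta>\<in>indices (Suc n). real (\<beta> k) * dpow \<beta> p)"
    by (subst sum.swap) (intro sum.cong refl eq)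
  also have "\<dots> = (\<Sum>\<beta>\<in>indices (Suc n). real (\<Sum>k=1..4. \<beta> k) * dpow \<beta> p)"
    by (subst sum.swap) (simp add: sum_distrib_right)
  also have "\<dots> = (\<Sum>\<beta>\<in>indices (Suc n). real (Suc n) * dpow \<beta> p)"
    by (intro sum.cong refl) (simp add: indices_def)
  also have "\<dots> = real (Suc n) * (\<Sum>\<beta>\<in>indices (Suc n). dpow \<beta> p)"
    by (simp only: sum_distrib_left)
  finally have "1 / fact n = real (Suc n) * (\<Sum>\<beta>\<in>indices (Suc n). dpow \<beta> p)" unfolding Suc .
  then show ?case by (simp add: divide_simps) (simp add: algebra_simps)
qed

section \<open>Curls and divergences of the spanning families\<close>

lemma grad_dp: "grad (dp \<alpha> i) p = (\<Sum>k=1..4. (if \<alpha> i = 0 then 0 else dp (dn \<alpha> i) k p) *\<^sub>R G k)"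
proof (cases "\<alpha> i = 0")
  case True
  then have "dp \<alpha> i = (\<lambda>_. 0)" by (simp add: dp_def fun_eq_iff)
  then show ?thesis using True grad_eqI[OF GDERIV_const[of "0::real" p]] by simp
next
  case False
  then have "dp \<alpha> i = dpow (dn \<alpha> i)" by (simp add: dp_def)
  then show ?thesis using False by (simp add: grad_dpow)
qed

lemma grad_dpow_fun: "grad (dpow \<alpha>) = (\<lambda>p. \<Sum>i=1..4. dp \<alpha> i p *\<^sub>R G i)"
  by (intro ext grad_dpow)

lemma grad_dpow_fields: "grad (dpow \<alpha>) \<in> vec_fields diffable"
  unfolding grad_dpow_fun by (intro sum_vec_fields scaleR_const_vec_fields subspace_diffable dp_diffable)

text \<open>The second derivatives \<open>s\<close> are symmetric while the cross product is
  antisymmetric, so the double sum equals its own negative.\<close>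

lemma curl_grad_dpow: "curl (grad (dpow \<alpha>)) p = 0"
proof -
  define s where "s = (\<lambda>i k. if \<alpha> i = 0 then 0 else dp (dn \<alpha> i) k p)"
  have sym: "s i k = s k i" for i k
    unfolding s_def dp_def by (cases "i = k") (auto simp: dn_def fun_upd_twist)
  let ?S = "\<Sum>i=1..4. \<Sum>k=1..4. s i k *\<^sub>R cross3 (G k) (G i)"
  have "curl (grad (dpow \<alpha>)) p = (\<Sum>i=1..4. cross3 (grad (dp \<alpha> i) p) (G i))"
    unfolding grad_dpow_fun by (intro curl_sum_fields dp_diffable)
  also have "\<dots> = ?S"
    by (simp add: grad_dp cross3_sum_left cross_mult_left s_def)
  finally have 1: "curl (grad (dpow \<alpha>)) p = ?S" .
  have "?S = (\<Sum>k=1..4. \<Sum>i=1..4. s i k *\<^sub>R cross3 (G k) (G i))" by (rule sum.swap)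
  also have "\<dots> = (\<Sum>k=1..4. \<Sum>i=1..4. - (s k i *\<^sub>R cross3 (G i) (G k)))"
    by (intro sum.cong refl) (subst sym, subst cross_skew, simp)
  also have "\<dots> = - ?S" by (simp add: sum_negf)
  finally have "?S + ?S = 0" by simp
  then have "2 *\<^sub>R ?S = 0" by (simp only: scaleR_2)
  then show ?thesis unfolding 1 by (simp only: scaleR_eq_0_iff) simp
qed

lemma omega_eq: "omega x i j p = bary x i p *\<^sub>R G j - bary x j p *\<^sub>R G i"
  by (simp add: omega_def)

lemma grad_bern: "grad (bern x n \<alpha>) p = fact n *\<^sub>R grad (dpow \<alpha>) p"
  unfolding bern_dpow by (rule grad_scale[OF dpow_diffable])

lemma Psi_eq:
  "Psi x n l \<alpha> p = fact (n + 1) *\<^sub>R (dpow (dn \<alpha> l) p *\<^sub>R G l - (real (\<alpha> l) / real (n + 1)) *\<^sub>R grad (dpow \<alpha>) p)"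
  unfolding Psi_def grad_bern by (simp add: bern_dpow dn_def scaleR_diff_right mult_ac fact_plus_1)

lemma Psi_fields: "Psi x n l \<alpha> \<in> vec_fields diffable"
  unfolding Psi_eq[abs_def]
  by (intro scale_vec_fields diff_vec_fields scaleR_const_vec_fields subspace_diffable dpow_diffable grad_dpow_fields)

text \<open>The gradient part has no curl, so only the product of a scalar function with the
  constant vector \<open>G l\<close> contributes.\<close>

lemma curl_Psi: "curl (Psi x n l \<alpha>) p = fact (n + 1) *\<^sub>R cross3 (grad (dpow (dn \<alpha> l)) p) (G l)"
proof -
  note VF = scale_vec_fields[OF subspace_diffable grad_dpow_fields]
    scaleR_const_vec_fields[OF subspace_diffable dpow_diffable]
  show ?thesis
    unfolding Psi_eq[abs_def]
    by (simp add: curl_scale curl_diff VF diff_vec_fields[OF subspace_diffable] grad_dpow_fields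
        curl_scaleR dpow_diffable curl_grad_dpow)
qed

text \<open>The curl of \<open>dpow \<alpha>\<close> times \<open>omega x j k\<close>, by
  \<open>curl_dpow_omega\<close>; the linear factors of \<open>omega\<close> are absorbed by raising
  the index.\<close>

definition face_curl :: "(nat \<Rightarrow> nat) \<Rightarrow> nat \<Rightarrow> nat \<Rightarrow> real^3 \<Rightarrow> real^3" where
  "face_curl \<alpha> j k p = real (\<alpha> j + 1) *\<^sub>R cross3 (grad (dpow (up \<alpha> j)) p) (G k)
     - real (\<alpha> k + 1) *\<^sub>R cross3 (grad (dpow (up \<alpha> k)) p) (G j)"

lemma dpow_omega:
  assumes "j \<in> {1..4}" "k \<in> {1..4}"
  shows "dpow \<alpha> p *\<^sub>R omega x j k p =
    real (\<alpha> j + 1) *\<^sub>R (dpow (up \<alpha> j) p *\<^sub>R G k) - real (\<alpha> k + 1) *\<^sub>R (dpow (up \<alpha> k) p *\<^sub>R G j)"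
  using bary_dpow[OF assms(1), of p \<alpha>] bary_dpow[OF assms(2), of p \<alpha>]
  by (simp add: omega_eq scaleR_diff_right mult.commute)

lemma dpow_omega_fields:
  assumes "j \<in> {1..4}" "k \<in> {1..4}"
  shows "(\<lambda>p. dpow \<alpha> p *\<^sub>R omega x j k p) \<in> vec_fields diffable"
  unfolding dpow_omega[OF assms]
  by (intro diff_vec_fields scale_vec_fields scaleR_const_vec_fields subspace_diffable dpow_diffable)

lemma curl_dpow_omega:
  assumes "j \<in> {1..4}" "k \<in> {1..4}"
  shows "curl (\<lambda>p. dpow \<alpha> p *\<^sub>R omega x j k p) p = face_curl \<alpha> j k p"
  unfolding dpow_omega[OF assms] face_curl_def
  by (simp only: curl_diff curl_scale curl_scaleR scale_vec_fields scaleR_const_vec_fields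
      subspace_diffable dpow_diffable)

lemma Phi_eq:
  "Phi x f n \<alpha> p = fact (n + 1) *\<^sub>R (real (\<alpha> (f 1)) *\<^sub>R (dpow \<alpha> p *\<^sub>R omega x (f 2) (f 3) p)
    + real (\<alpha> (f 2)) *\<^sub>R (dpow \<alpha> p *\<^sub>R omega x (f 3) (f 1) p)
    + real (\<alpha> (f 3)) *\<^sub>R (dpow \<alpha> p *\<^sub>R omega x (f 1) (f 2) p))"
  unfolding Phi_def by (simp add: bern_dpow scaleR_add_right mult_ac fact_plus_1)

lemma Phi_fields:
  assumes "f 1 \<in> {1..4}" "f 2 \<in> {1..4}" "f 3 \<in> {1..4}"
  shows "Phi x f n \<alpha> \<in> vec_fields diffable"
  unfolding Phi_eq[abs_def] using assms
  by (intro scale_vec_fields add_vec_fields subspace_diffable dpow_omega_fields)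

lemma curl_Phi:
  assumes "f 1 \<in> {1..4}" "f 2 \<in> {1..4}" "f 3 \<in> {1..4}"
  shows "curl (Phi x f n \<alpha>) p = fact (n + 1) *\<^sub>R (real (\<alpha> (f 1)) *\<^sub>R face_curl \<alpha> (f 2) (f 3) p
    + real (\<alpha> (f 2)) *\<^sub>R face_curl \<alpha> (f 3) (f 1) p + real (\<alpha> (f 3)) *\<^sub>R face_curl \<alpha> (f 1) (f 2) p)"
  unfolding Phi_eq[abs_def] using assms
  by (simp only: curl_scale curl_add scale_vec_fields add_vec_fields subspace_diffable
      dpow_omega_fields curl_dpow_omega)

section \<open>Normal components of the curls on the faces\<close>

lemma G_cyclic:
  assumes "{1..4} = {i, j, k, l}" "distinct [i, j, k, l]"
  shows "vol l j k = vol l i j" "vol l k i = vol l i j"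
proof -
  have "G i + G j + G k + G l = 0" using sum_G assms by (simp add: add.assoc)
  then have k: "G k = - (G i + G j + G l)" by (simp add: eq_neg_iff_add_eq_0 algebra_simps)
  show "vol l j k = vol l i j" "vol l k i = vol l i j"
    unfolding k by (simp_all add: cross3_simps)
qed

text \<open>The term \<open>k\<close> dies in the cross product and the term \<open>l\<close> in the
  product with \<open>G l\<close>. The two remaining triple products are opposite by
  \<open>G_cyclic\<close>.\<close>

lemma grad_dpow_cross:
  assumes "{1..4} = {i, j, k, l}" "distinct [i, j, k, l]"
  shows "cross3 (grad (dpow \<beta>) p) (G k) \<bullet> G l = vol l i j * (dp \<beta> j p - dp \<beta> i p)"
proof -
  have "cross3 (grad (dpow \<beta>) p) (G k) = (\<Sum>m\<in>{i, j, k, l}. dp \<beta> m p *\<^sub>R cross3 (G m) (G k))"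
    unfolding grad_dpow assms(1) cross3_sum_left cross_mult_left ..
  then have "cross3 (grad (dpow \<beta>) p) (G k) \<bullet> G l = dp \<beta> i p * vol l i k + dp \<beta> j p * vol l j k"
    using assms(2) by (simp add: inner_commute[of _ "G l"] inner_add_right dot_cross_self)
  moreover have "vol l i k = - vol l k i" by (subst cross_skew) simp
  ultimately show ?thesis using G_cyclic[OF assms] by (simp add: algebra_simps)
qed

text \<open>The factor \<open>\<alpha> i\<close> stands on both sides because lowering the entry at
  \<open>i\<close> is meaningful only if it is positive; at zero both sides vanish.\<close>

lemma face_curl_dot:
  assumes "{1..4} = {i, j, k, l}" "distinct [i, j, k, l]"
  shows "real (\<alpha> i) * (face_curl \<alpha> j k p \<bullet> G l) = vol l i j * (real (\<alpha> i) *
    (real (\<alpha> j + 1) * (dpow \<alpha> p - dpow (dn (up \<alpha> j) i) p) + real (\<alpha> k + 1) * (dpow \<alpha> p - dpow (dn (up \<alpha> k) i) p)))"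
proof (cases "\<alpha> i = 0")
  case False
  have "{1..4} = {i, k, j, l}" "distinct [i, k, j, l]" using assms by auto
  note 2 = grad_dpow_cross[OF this, of "up \<alpha> k" p]
  have "vol l i k = - vol l k i" by (subst cross_skew) simp
  then have v: "vol l i k = - vol l i j" using G_cyclic[OF assms] by simp
  have d: "dp (up \<alpha> m) m = dpow \<alpha>" for m by (simp add: dp_def dn_up) (simp add: up_def)
  have d': "dp (up \<alpha> m) i = dpow (dn (up \<alpha> m) i)" if "m \<noteq> i" for m
    using that False by (simp add: dp_def up_def)
  show ?thesis
    using assms(2) unfolding face_curl_def inner_diff_left inner_scaleR_left grad_dpow_cross[OF assms] 2 v d
    by (simp add: d' algebra_simps)
qed simp

text \<open>Each vertex of the face contributes the Laplacian moves that start at it. The three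
  triple products agree by \<open>G_cyclic\<close>, so the contributions add up to the Laplacian of
  the face.\<close>

lemma curl_Phi_dot:
  assumes "{1..4} = {f 1, f 2, f 3, l}" "distinct [f 1, f 2, f 3, l]"
  shows "curl (Phi x f n \<alpha>) p \<bullet> G l = fact (n + 1) * vol l (f 1) (f 2) * lap {f 1, f 2, f 3} \<alpha> p"
proof -
  have r: "{1..4} = {f 2, f 3, f 1, l}" "distinct [f 2, f 3, f 1, l]"
    "{1..4} = {f 3, f 1, f 2, l}" "distinct [f 3, f 1, f 2, l]" using assms by auto
  have c: "vol l (f 2) (f 3) = vol l (f 1) (f 2)" "vol l (f 3) (f 1) = vol l (f 1) (f 2)"
    using G_cyclic[OF assms] by auto
  have m: "f 1 \<in> {1..4}" "f 2 \<in> {1..4}" "f 3 \<in> {1..4}" unfolding assms(1) by auto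
  have "curl (Phi x f n \<alpha>) p \<bullet> G l = fact (n + 1) * (real (\<alpha> (f 1)) * (face_curl \<alpha> (f 2) (f 3) p \<bullet> G l)
    + real (\<alpha> (f 2)) * (face_curl \<alpha> (f 3) (f 1) p \<bullet> G l) + real (\<alpha> (f 3)) * (face_curl \<alpha> (f 1) (f 2) p \<bullet> G l))"
    unfolding curl_Phi[where f=f, OF m] by (simp add: inner_add_left)
  also have "\<dots> = fact (n + 1) * vol l (f 1) (f 2) * lap {f 1, f 2, f 3} \<alpha> p"
    unfolding face_curl_dot[OF assms] face_curl_dot[OF r(1,2)] face_curl_dot[OF r(3,4)] c
    using assms(2) by (simp add: lap_def sum_fun_apply insert_Diff_if algebra_simps)
  finally show ?thesis .
qed

text \<open>The polynomials of degree \<open>n\<close> that vanish on the face opposite to vertex \<open>l\<close>.\<close>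

definition off_face :: "nat \<Rightarrow> nat \<Rightarrow> (real^3 \<Rightarrow> real) set" where
  "off_face n l = span (dpow ` (indices n - face_indices n ({1..4} - {l})))"

lemma dpow_off_face: "\<beta> \<in> indices n \<Longrightarrow> \<beta> l \<noteq> 0 \<Longrightarrow> dpow \<beta> \<in> off_face n l"
  unfolding off_face_def
  by (intro span_base imageI) (auto simp: face_indices_def indices_def)

text \<open>Only differentiation in the coordinate \<open>l\<close> could lower the entry at
  \<open>l\<close>, and this term is annihilated by the product with \<open>G l\<close>.\<close>

lemma grad_cross_off_face:
  assumes "\<beta> \<in> indices (Suc n)" "\<beta> l \<noteq> 0 \<or> k = l"
  shows "(\<lambda>p. cross3 (grad (dpow \<beta>) p) (G k) \<bullet> G l) \<in> off_face n l"
proof (cases "k = l")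
  case False
  have "(\<lambda>p. cross3 (grad (dpow \<beta>) p) (G k) \<bullet> G l) = (\<Sum>m=1..4. (cross3 (G m) (G k) \<bullet> G l) *\<^sub>R dp \<beta> m)"
    by (intro ext) (simp add: grad_dpow cross3_sum_left cross_mult_left inner_sum_left sum_fun_apply mult.commute)
  also have "\<dots> \<in> off_face n l"
    unfolding off_face_def
  proof (intro span_sum, fold off_face_def)
    fix m
    show "(cross3 (G m) (G k) \<bullet> G l) *\<^sub>R dp \<beta> m \<in> off_face n l"
    proof (cases "m = l \<or> \<beta> m = 0")
      case True
      then have 0: "(cross3 (G m) (G k) \<bullet> G l) *\<^sub>R dp \<beta> m = 0" by (auto simp: dp_def dot_cross_self)
      show ?thesis unfolding 0 off_face_def by (rule span_zero)
    next
      case m: False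
      then have "dp \<beta> m \<in> off_face n l"
        using assms False by (auto simp: dp_def dn_indices intro!: dpow_off_face) (auto simp: dn_def)
      then show ?thesis by (simp add: off_face_def span_scale)
    qed
  qed
  finally show ?thesis .
next
  case True
  then have 0: "(\<lambda>p. cross3 (grad (dpow \<beta>) p) (G k) \<bullet> G l) = 0"
    by (intro ext) (simp add: dot_cross_self)
  show ?thesis unfolding 0 off_face_def by (rule span_zero)
qed

text \<open>If \<open>\<alpha> i\<close> is nonzero, then in each of the two terms either the raised
  index is positive at \<open>l\<close> or the cross product is taken with
  \<open>G l\<close>.\<close>

lemma face_curl_off_face:
  assumes "\<alpha> \<in> indices n" "i \<in> {1..4}" "j \<in> {1..4}" "k \<in> {1..4}" "l \<in> {i, j, k}"
  shows "(\<lambda>p. real (\<alpha> i) * (face_curl \<alpha> j k p \<bullet> G l)) \<in> off_face n l"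
proof -
  have sub: "subspace (off_face n l)" by (simp add: off_face_def)
  have *: "(\<lambda>p. cross3 (grad (dpow (up \<alpha> j')) p) (G k') \<bullet> G l) \<in> off_face n l"
    if "\<alpha> i \<noteq> 0" "{j', k'} = {j, k}" for j' k'
    using that assms by (intro grad_cross_off_face up_indices) (auto simp: up_def doubleton_eq_iff)
  show ?thesis
  proof (cases "\<alpha> i = 0")
    case True
    then show ?thesis using subspace_0[OF sub] by (simp add: zero_fun_def)
  next
    case False
    have "(\<lambda>p. real (\<alpha> i) * (face_curl \<alpha> j k p \<bullet> G l)) = real (\<alpha> i) *\<^sub>R
      (real (\<alpha> j + 1) *\<^sub>R (\<lambda>p. cross3 (grad (dpow (up \<alpha> j)) p) (G k) \<bullet> G l)
      - real (\<alpha> k + 1) *\<^sub>R (\<lambda>p. cross3 (grad (dpow (up \<alpha> k)) p) (G j) \<bullet> G l))"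
      by (intro ext) (simp add: face_curl_def inner_diff_left)
    also have "\<dots> \<in> off_face n l"
      using False by (intro subspace_scale[OF sub] subspace_diff[OF sub] *) auto
    finally show ?thesis .
  qed
qed

lemma curl_Phi_off_face:
  assumes "\<alpha> \<in> indices n" "f 1 \<in> {1..4}" "f 2 \<in> {1..4}" "f 3 \<in> {1..4}" "l \<in> {f 1, f 2, f 3}"
  shows "(\<lambda>p. curl (Phi x f n \<alpha>) p \<bullet> G l) \<in> off_face n l"
proof -
  have sub: "subspace (off_face n l)" by (simp add: off_face_def)
  have "(\<lambda>p. curl (Phi x f n \<alpha>) p \<bullet> G l) = fact (n + 1) *\<^sub>R
     ((\<lambda>p. real (\<alpha> (f 1)) * (face_curl \<alpha> (f 2) (f 3) p \<bullet> G l))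
    + (\<lambda>p. real (\<alpha> (f 2)) * (face_curl \<alpha> (f 3) (f 1) p \<bullet> G l))
    + (\<lambda>p. real (\<alpha> (f 3)) * (face_curl \<alpha> (f 1) (f 2) p \<bullet> G l)))"
    unfolding curl_Phi[where f=f, OF assms(2-4)] by (intro ext) (simp add: inner_add_left)
  also have "\<dots> \<in> off_face n l"
    using assms by (intro subspace_scale[OF sub] subspace_add[OF sub] face_curl_off_face) auto
  finally show ?thesis .
qed

text \<open>An interior index stays positive at \<open>l\<close> after it is lowered at
  \<open>k\<close>, unless \<open>k = l\<close>, and in that case the product with
  \<open>G l\<close> vanishes.\<close>

lemma curl_Psi_off_face:
  assumes "\<alpha> \<in> interior_indices (Suc (Suc n)) {1..4}" "k \<in> {1..4}" "l \<in> {1..4}"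
  shows "(\<lambda>p. curl (Psi x (Suc n) k \<alpha>) p \<bullet> G l) \<in> off_face n l"
proof -
  have sub: "subspace (off_face n l)" by (simp add: off_face_def)
  have "(\<lambda>p. curl (Psi x (Suc n) k \<alpha>) p \<bullet> G l) =
      fact (Suc n + 1) *\<^sub>R (\<lambda>p. cross3 (grad (dpow (dn \<alpha> k)) p) (G k) \<bullet> G l)"
    unfolding curl_Psi by (intro ext) simp
  also have "\<dots> \<in> off_face n l"
    using assms
    by (intro subspace_scale[OF sub] grad_cross_off_face dn_indices) (auto simp: interior_indices_def dn_def)
  finally show ?thesis .
qed

text \<open>Both sides are tested with the four gradients. For \<open>i\<close>, \<open>j\<close>
  and \<open>k\<close> a single triple product survives on the left; the case of \<open>l\<close>
  follows from these because the gradients sum to 0 and the coordinates to 1.\<close>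

lemma whitney:
  assumes "{1..4} = {i, j, k, l}" "distinct [i, j, k, l]"
  shows "bary x i p *\<^sub>R cross3 (G j) (G k) - bary x j p *\<^sub>R cross3 (G i) (G k) + bary x k p *\<^sub>R cross3 (G i) (G j)
    = vol i j k *\<^sub>R (p - x l)"
proof (rule G_eqI)
  have l: "l \<in> {1..4}" and sum: "bary x i p + (bary x j p + (bary x k p + bary x l p)) = 1"
    using bary_sum[of p] assms by auto
  have "G i + (G j + (G k + G l)) = 0" using sum_G assms by simp
  then have Gl: "G l = - (G i + G j + G k)" by (simp add: eq_neg_iff_add_eq_0 algebra_simps)
  have v: "vol j i k = - vol i j k" "vol k i j = vol i j k" by (simp_all add: cross3_simps)
  fix m :: nat assume "m \<in> {1..4}"
  then consider "m = i" | "m = j" | "m = k" | "m = l" using assms(1) by auto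
  then show "G m \<bullet> (bary x i p *\<^sub>R cross3 (G j) (G k) - bary x j p *\<^sub>R cross3 (G i) (G k)
      + bary x k p *\<^sub>R cross3 (G i) (G j)) = G m \<bullet> (vol i j k *\<^sub>R (p - x l))"
  proof cases
    case 4
    have "bary x l p - of_bool (l = l) = - (bary x i p + bary x j p + bary x k p)" using sum by simp
    note b = G_vertex[OF l, of l p, unfolded this]
    show ?thesis
      unfolding 4 inner_scaleR_right b
      by (simp add: Gl inner_add_right inner_diff_right inner_diff_left dot_cross_self v)
        (simp add: algebra_simps)
  qed (use assms(2) in \<open>simp_all add: G_vertex[OF l] inner_add_right
      inner_diff_right[of _ "_ *\<^sub>R _" "_ *\<^sub>R _"] dot_cross_self v\<close>)
qed

text \<open>By \<open>whitney\<close> the lowest-order face fields are radial about the opposite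
  vertex. Expressing all triple products through \<open>vol 2 3 4\<close> produces the alternating
  sign that \<open>Upsilon\<close> compensates.\<close>

lemma chi_eq:
  assumes "l \<in> {1..4}"
  shows "chi x l p = ((-1) ^ l * - vol 2 3 4) *\<^sub>R (p - x l)"
proof -
  have s: "G 1 = - (G 2 + G 3 + G 4)"
    using sum_G unfolding sum_4 by (simp add: eq_neg_iff_add_eq_0 algebra_simps)
  have v: "vol 1 3 4 = - vol 2 3 4" "vol 1 2 4 = vol 2 3 4" "vol 1 2 3 = - vol 2 3 4"
    unfolding s by (simp_all add: cross3_simps)
  consider "l = 1" | "l = 2" | "l = 3" | "l = 4" using assms unfolding interval_4 by auto
  then show ?thesis
  proof cases
    case 1
    then show ?thesis using whitney[of 2 3 4 1 p] by (auto simp: chi_def interval_4)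
  next
    case 2
    then show ?thesis using whitney[of 1 3 4 2 p] by (auto simp: chi_def interval_4 v)
  next
    case 3
    then show ?thesis using whitney[of 1 2 4 3 p] by (auto simp: chi_def interval_4 v)
  next
    case 4
    then show ?thesis using whitney[of 1 2 3 4 p] by (auto simp: chi_def interval_4 v)
  qed
qed

lemma Upsilon_eq:
  "Upsilon x n \<alpha> p = (fact (n + 1) * - vol 2 3 4) *\<^sub>R (\<Sum>l=1..4. real (\<alpha> l) *\<^sub>R (dpow \<alpha> p *\<^sub>R (p - x l)))"
proof -
  have "(\<Sum>l=1..4. ((-1) ^ l * real (\<alpha> l)) *\<^sub>R chi x l p) =
      (- vol 2 3 4) *\<^sub>R (\<Sum>l=1..4. real (\<alpha> l) *\<^sub>R (p - x l))"
    unfolding scaleR_sum_right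
  proof (intro sum.cong refl)
    fix l :: nat assume "l \<in> {1..4}"
    then show "((-1) ^ l * real (\<alpha> l)) *\<^sub>R chi x l p = (- vol 2 3 4) *\<^sub>R (real (\<alpha> l) *\<^sub>R (p - x l))"
      by (subst chi_eq) (auto simp: power_mult_distrib[symmetric])
  qed
  moreover have "(\<Sum>l=1..4. real (\<alpha> l) *\<^sub>R (dpow \<alpha> p *\<^sub>R (p - x l))) =
      dpow \<alpha> p *\<^sub>R (\<Sum>l=1..4. real (\<alpha> l) *\<^sub>R (p - x l))"
    unfolding scaleR_sum_right by (intro sum.cong refl) (simp only: scaleR_scaleR mult.commute)
  moreover have "real (n + 1) * (fact n * d) * - V = fact (n + 1) * - V * d" for d V :: real
    by (simp add: fact_plus_1)
  ultimately show ?thesis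
    unfolding Upsilon_def bern_dpow by (simp only: scaleR_scaleR)
qed

lemma position_eq: "p - x l = (\<Sum>k=1..4. bary x k p *\<^sub>R (x k - x l))"
  unfolding scaleR_diff_right sum_subtractf bary_combination scaleR_sum_left[symmetric] bary_sum by simp

text \<open>Scalar functions times constant vectors, the form to which
  \<open>divergence_sum_fields\<close> applies.\<close>

lemma scaled_position:
  "f p *\<^sub>R (p - x l) = (\<Sum>k=1..4. (f p * bary x k p) *\<^sub>R (x k - x l))"
  unfolding position_eq[of p l] scaleR_sum_right by simp

lemma mult_bary_diffable:
  assumes "f \<in> diffable" shows "(\<lambda>p. f p * bary x k p) \<in> diffable"
  using GDERIV_mult[OF diffable_GDERIV[OF assms] GDERIV_bary[of k]] by (rule diffableI)

lemma scaled_position_fields: "f \<in> diffable \<Longrightarrow> (\<lambda>p. f p *\<^sub>R (p - x l)) \<in> vec_fields diffable"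
  unfolding scaled_position
  by (intro sum_vec_fields scaleR_const_vec_fields subspace_diffable mult_bary_diffable)

text \<open>The product rule on each summand. The 3 counts the vertices \<open>k\<close> other than
  \<open>l\<close>, each with \<open>G k \<bullet> (x k - x l) = 1\<close>.\<close>

lemma divergence_scaled_position:
  assumes f: "f \<in> diffable" and l: "l \<in> {1..4}"
  shows "divergence (\<lambda>p. f p *\<^sub>R (p - x l)) p = 3 * f p + grad f p \<bullet> (p - x l)"
proof -
  have g: "grad (\<lambda>p. f p * bary x k p) p = f p *\<^sub>R G k + bary x k p *\<^sub>R grad f p" for k
    by (intro grad_eqI GDERIV_mult diffable_GDERIV f GDERIV_bary)
  have "divergence (\<lambda>p. f p *\<^sub>R (p - x l)) p = (\<Sum>k=1..4. grad (\<lambda>p. f p * bary x k p) p \<bullet> (x k - x l))"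
    unfolding scaled_position by (intro divergence_sum_fields mult_bary_diffable f)
  also have "\<dots> = f p * (\<Sum>k=1..4. G k \<bullet> (x k - x l)) + grad f p \<bullet> (p - x l)"
    unfolding g position_eq[of p l] inner_add_left sum.distrib sum_distrib_left inner_sum_right by simp
  also have "(\<Sum>k=1..4. G k \<bullet> (x k - x l)) = (\<Sum>k=1..4. 1 - of_bool (k = l))"
    using l by (intro sum.cong refl) (simp add: G_edge)
  also have "\<dots> = 3" using l by (simp add: sum_subtractf of_bool_def)
  finally show ?thesis by simp
qed

text \<open>Euler's identity for a homogeneous expression in the coordinates contributes
  \<open>n\<close>, and the centre \<open>x l\<close> subtracts the derivative in the coordinate
  \<open>l\<close>.\<close>

lemma divergence_dpow_position:
  assumes a: "\<alpha> \<in> indices n" and l: "l \<in> {1..4}"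
  shows "divergence (\<lambda>p. dpow \<alpha> p *\<^sub>R (p - x l)) p = real (n + 3) * dpow \<alpha> p - dp \<alpha> l p"
proof -
  have "grad (dpow \<alpha>) p \<bullet> (p - x l) = (\<Sum>k=1..4. dp \<alpha> k p * (bary x k p - of_bool (k = l)))"
    by (simp add: grad_dpow inner_sum_left G_vertex[OF l])
  also have "\<dots> = (\<Sum>k=1..4. bary x k p * dp \<alpha> k p) - (\<Sum>k=1..4. if k = l then dp \<alpha> k p else 0)"
    unfolding sum_subtractf[symmetric] by (intro sum.cong) (auto simp: algebra_simps)
  also have "(\<Sum>k=1..4. bary x k p * dp \<alpha> k p) = (\<Sum>k=1..4. real (\<alpha> k) * dpow \<alpha> p)"
    by (intro sum.cong refl bary_dp)
  also have "\<dots> = real n * dpow \<alpha> p"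
    using a unfolding sum_distrib_right[symmetric] of_nat_sum[symmetric] by (simp add: indices_def)
  also have "(\<Sum>k=1..4. if k = l then dp \<alpha> k p else 0) = dp \<alpha> l p" using l by simp
  finally show ?thesis
    unfolding divergence_scaled_position[OF dpow_diffable l] by (simp add: distrib_right)
qed

text \<open>Raising the degree of \<open>dp \<alpha> l\<close> by \<open>dpow_expand\<close>
  produces the moves out of \<open>l\<close>. The weights \<open>\<alpha> j + 1\<close> without
  \<open>j = l\<close> sum to \<open>n + 3 - \<alpha> l\<close>, and the diagonal term of the
  expansion accounts for \<open>\<alpha> l\<close>.\<close>

lemma lap_full:
  assumes a: "\<alpha> \<in> indices n"
  shows "lap {1..4} \<alpha> p = (\<Sum>l=1..4. real (\<alpha> l) * (real (n + 3) * dpow \<alpha> p - dp \<alpha> l p))"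
  unfolding lap_def sum_fun_apply
proof (intro sum.cong refl)
  fix l :: nat assume l: "l \<in> {1..4}"
  show "(\<Sum>j\<in>{1..4} - {l}. ((real (\<alpha> l) * real (\<alpha> j + 1)) *\<^sub>R (dpow \<alpha> - dpow (dn (up \<alpha> j) l))) p) =
    real (\<alpha> l) * (real (n + 3) * dpow \<alpha> p - dp \<alpha> l p)"
  proof (cases "\<alpha> l = 0")
    case False
    have "(\<Sum>j=1..4. real (\<alpha> j + 1)) = real (n + 4)"
      using a by (simp add: sum.distrib indices_def of_nat_sum[symmetric] del: of_nat_sum)
    then have s: "(\<Sum>j\<in>{1..4} - {l}. real (\<alpha> j + 1)) = real (n + 3) - real (\<alpha> l)"
      using l by (simp add: sum_diff1)
    have "dp \<alpha> l p = (\<Sum>k=1..4. real (dn \<alpha> l k + 1) * dpow (up (dn \<alpha> l) k) p)"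
      using False by (simp add: dp_def dpow_expand[of "dn \<alpha> l"])
    also have "\<dots> = real (dn \<alpha> l l + 1) * dpow (up (dn \<alpha> l) l) p
        + (\<Sum>k\<in>{1..4} - {l}. real (dn \<alpha> l k + 1) * dpow (up (dn \<alpha> l) k) p)"
      using l by (intro sum.remove) auto
    also have "real (dn \<alpha> l l + 1) * dpow (up (dn \<alpha> l) l) p = real (\<alpha> l) * dpow \<alpha> p"
      using False by (simp add: up_dn) (simp add: dn_def of_nat_diff)
    also have "(\<Sum>k\<in>{1..4} - {l}. real (dn \<alpha> l k + 1) * dpow (up (dn \<alpha> l) k) p) =
        (\<Sum>k\<in>{1..4} - {l}. real (\<alpha> k + 1) * dpow (dn (up \<alpha> k) l) p)"
      by (intro sum.cong refl) (auto simp: dn_def up_def fun_upd_twist)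
    finally have d: "dp \<alpha> l p = real (\<alpha> l) * dpow \<alpha> p
        + (\<Sum>k\<in>{1..4} - {l}. real (\<alpha> k + 1) * dpow (dn (up \<alpha> k) l) p)" .
    have "(\<Sum>j\<in>{1..4} - {l}. ((real (\<alpha> l) * real (\<alpha> j + 1)) *\<^sub>R (dpow \<alpha> - dpow (dn (up \<alpha> j) l))) p) =
      real (\<alpha> l) * ((\<Sum>j\<in>{1..4} - {l}. real (\<alpha> j + 1)) * dpow \<alpha> p
        - (\<Sum>j\<in>{1..4} - {l}. real (\<alpha> j + 1) * dpow (dn (up \<alpha> j) l) p))"
      unfolding sum_distrib_right sum_subtractf[symmetric] sum_distrib_left
      by (intro sum.cong refl) (simp add: algebra_simps)
    also have "\<dots> = real (\<alpha> l) * (real (n + 3) * dpow \<alpha> p - dp \<alpha> l p)"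
      unfolding s d by (simp add: algebra_simps)
    finally show ?thesis .
  qed simp
qed

lemma Upsilon_fields: "Upsilon x n \<alpha> \<in> vec_fields diffable"
  unfolding Upsilon_eq[abs_def]
  by (intro scale_vec_fields sum_vec_fields subspace_diffable scaled_position_fields dpow_diffable)

lemma divergence_Upsilon:
  assumes a: "\<alpha> \<in> indices n"
  shows "divergence (Upsilon x n \<alpha>) = (fact (n + 1) * - vol 2 3 4) *\<^sub>R lap {1..4} \<alpha>"
proof
  fix p
  have mem: "(\<lambda>p. dpow \<alpha> p *\<^sub>R (p - x l)) \<in> vec_fields diffable" for l
    by (intro scaled_position_fields dpow_diffable)
  let ?S = "\<Sum>l=1..4. real (\<alpha> l) *\<^sub>R (\<lambda>p. dpow \<alpha> p *\<^sub>R (p - x l))"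
  let ?c = "fact (n + 1) * - vol 2 3 4"
  have U: "Upsilon x n \<alpha> = ?c *\<^sub>R ?S"
    by (intro ext) (simp add: Upsilon_eq sum_fun_apply)
  have S: "?S \<in> vec_fields diffable"
    by (intro subspace_sum subspace_scale subspace_vec_fields subspace_diffable mem)
  have "divergence (?c *\<^sub>R ?S) = ?c *\<^sub>R divergence ?S"
    using divergence_linear S unfolding linear_op_on_def by blast
  also have "divergence ?S = (\<Sum>l=1..4. real (\<alpha> l) *\<^sub>R divergence (\<lambda>p. dpow \<alpha> p *\<^sub>R (p - x l)))"
    by (rule linear_op_on_sum[OF divergence_linear mem])
  finally have D: "divergence (?c *\<^sub>R ?S) =
    ?c *\<^sub>R (\<Sum>l=1..4. real (\<alpha> l) *\<^sub>R divergence (\<lambda>p. dpow \<alpha> p *\<^sub>R (p - x l)))" .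
  show "divergence (Upsilon x n \<alpha>) p = (?c *\<^sub>R lap {1..4} \<alpha>) p"
    unfolding U D by (simp add: sum_fun_apply lap_full[OF a] divergence_dpow_position[OF a])
qed

end

section \<open>Independence\<close>

abbreviation "cells \<equiv> set edges \<union> set faces \<union> {{1..4}}"

lemma cells_bounds:
  assumes "A \<in> cells" shows "A \<subseteq> {1..4}" "i \<in> {1..4} \<Longrightarrow> \<exists>j\<in>A. j \<noteq> i"
proof -
  have "{1..4} = {1, 2, 3, 4::nat}" by auto
  then show "A \<subseteq> {1..4}" "i \<in> {1..4} \<Longrightarrow> \<exists>j\<in>A. j \<noteq> i"
    using assms by (auto simp: edges_def faces_def)
qed

text \<open>The support recovers the cell, so the interior index sets of different cells are
  disjoint.\<close>

lemma interior_support: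
  assumes "\<alpha> \<in> interior_indices n A" "A \<subseteq> {1..4}" shows "A = {i\<in>{1..4}. \<alpha> i > 0}"
  using assms by (auto simp: interior_indices_def split: if_splits)

lemma faces_opposite:
  assumes "F \<in> set faces"
  obtains l where "l \<in> {1..4}" "F = {1..4} - {l}" "\<And>F'. F' \<in> set faces \<Longrightarrow> F' \<noteq> F \<Longrightarrow> l \<in> F'"
proof -
  have i: "{1..4} = {1, 2, 3, 4::nat}" by auto
  consider "F = {1, 2, 3}" | "F = {1, 2, 4}" | "F = {1, 3, 4}" | "F = {2, 3, 4}"
    using assms by (auto simp: faces_def)
  then show ?thesis
  proof cases
    case 1 then show ?thesis by (intro that[of 4]) (auto simp: faces_def i)
  next
    case 2 then show ?thesis by (intro that[of 3]) (auto simp: faces_def i)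
  next
    case 3 then show ?thesis by (intro that[of 2]) (auto simp: faces_def i)
  next
    case 4 then show ?thesis by (intro that[of 1]) (auto simp: faces_def i)
  qed
qed

lemma faces_opposite_vertex: "l \<in> {1..4} \<Longrightarrow> {1..4} - {l} \<in> set faces"
proof -
  assume "l \<in> {1..4}"
  then consider "l = 1" | "l = 2" | "l = 3" | "l = 4" by fastforce
  moreover have "{1..4} - {1} = {2, 3, 4::nat}" "{1..4} - {2} = {1, 3, 4::nat}"
    "{1..4} - {3} = {1, 2, 4::nat}" "{1..4} - {4} = {1, 2, 3::nat}" by auto
  ultimately show ?thesis by cases (simp_all add: faces_def)
qed

lemma finite_Psi_indices [simp]: "finite (Psi_indices n)"
proof (rule finite_subset)
  show "Psi_indices n \<subseteq> {1, 2, 3} \<times> indices (n + 1)"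
    using interior_indices_subset by (auto simp: Psi_indices_def)
qed auto

text \<open>Splits products of indicators into point masses that \<open>sum.delta\<close>
  evaluates.\<close>

lemma of_bool_terms:
  "d * (of_bool A * (of_bool P - of_bool Q) - of_bool B * (of_bool R - of_bool S)) =
   (if A \<and> P then d else 0) - (if A \<and> Q then d else 0) - (if B \<and> R then d else 0)
     + (if B \<and> S then d else (0::real))"
  by (cases A; cases B; cases P; cases Q; cases R; cases S) simp_all

text \<open>The numbering of the faces and the removed indices are parameters, so the results hold
  for every choice of them.\<close>

locale tetrahedron_choice = tetrahedron x for x :: "nat \<Rightarrow> real^3" +
  fixes num :: "nat set \<Rightarrow> nat \<Rightarrow> nat"
    and rF :: "nat \<Rightarrow> nat set \<Rightarrow> nat \<Rightarrow> nat"
    and rT :: "nat \<Rightarrow> nat \<Rightarrow> nat"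
  assumes num: "\<And>F. F \<in> set faces \<Longrightarrow> F = {num F 1, num F 2, num F 3}"
    and rF: "\<And>n F. F \<in> set faces \<Longrightarrow> rF n F \<in> face_indices n F"
    and rT: "\<And>n. rT n \<in> indices n"
begin

lemma num_mem:
  assumes "F \<in> set faces"
  shows "num F 1 \<in> {1..4}" "num F 2 \<in> {1..4}" "num F 3 \<in> {1..4}"
proof -
  have "F \<subseteq> {1..4}" using assms cells_bounds(1) by blast
  then have "{num F 1, num F 2, num F 3} \<subseteq> {1..4}" using num[OF assms] by (rule back_subst)
  then show "num F 1 \<in> {1..4}" "num F 2 \<in> {1..4}" "num F 3 \<in> {1..4}" by blast+
qed

lemma num_opposite:
  assumes "F \<in> set faces" "l \<in> {1..4}" "F = {1..4} - {l}"
  shows "{1..4} = {num F 1, num F 2, num F 3, l}" "distinct [num F 1, num F 2, num F 3, l]"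
proof -
  have "{1..4} = insert l F" using assms by blast
  then show i: "{1..4} = {num F 1, num F 2, num F 3, l}"
    using num[OF assms(1)] by (metis insert_commute)
  \<comment> \<open>Four names that cover four vertices are distinct.\<close>
  have "card (set [num F 1, num F 2, num F 3, l]) = 4"
    using i by (metis (no_types) card_atLeastAtMost list.set(1) list.set(2) diff_Suc_1 Suc_eq_plus1)
  then show "distinct [num F 1, num F 2, num F 3, l]" by (intro card_distinct) simp
qed

text \<open>With the coefficient 0 put at the removed index, \<open>lap_kernel\<close> makes all
  coefficients equal to that one. The constant function enters as a multiple of the sum in
  \<open>sum_dpow\<close>.\<close>

lemma lap_indep:
  assumes A: "A \<subseteq> {1..4}" "A \<noteq> {}" and r: "r \<in> face_indices n A"
    and eq: "(\<Sum>\<alpha>\<in>face_indices n A - {r}. c \<alpha> *\<^sub>R lap A \<alpha>) + (\<lambda>_. k) + R = 0"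
    and R: "R \<in> span (dpow ` (indices n - face_indices n A))"
  shows "k = 0" and "\<alpha> \<in> face_indices n A - {r} \<Longrightarrow> c \<alpha> = 0"
proof -
  define c' where "c' = (\<lambda>\<alpha>. if \<alpha> = r then 0 else c \<alpha>)"
  have "(\<Sum>\<alpha>\<in>face_indices n A. c' \<alpha> *\<^sub>R lap A \<alpha>) = (\<Sum>\<alpha>\<in>face_indices n A - {r}. c \<alpha> *\<^sub>R lap A \<alpha>)"
    by (intro sum.mono_neutral_cong_right) (auto simp: c'_def)
  moreover have "(k * fact n) *\<^sub>R (\<Sum>\<alpha>\<in>indices n. dpow \<alpha>) = (\<lambda>_. k)"
    by (intro ext) (simp add: sum_fun_apply sum_dpow)
  ultimately have "(\<Sum>\<alpha>\<in>face_indices n A. c' \<alpha> *\<^sub>R lap A \<alpha>)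
      + (k * fact n) *\<^sub>R (\<Sum>\<alpha>\<in>indices n. dpow \<alpha>) + R = 0"
    using eq by (simp only:)
  note ker = lap_kernel[OF A this R]
  show "k = 0" using ker(1) by simp
  show "c \<alpha> = 0" if "\<alpha> \<in> face_indices n A - {r}"
    using ker(2)[of \<alpha> r] that r by (simp add: c'_def)
qed

lemma divergence_Upsilon_indep:
  assumes eq: "(\<Sum>\<alpha>\<in>indices n - {rT n}. c \<alpha> *\<^sub>R divergence (Upsilon x n \<alpha>)) + (\<lambda>_. k) = 0"
  shows "k = 0" and "\<alpha> \<in> indices n - {rT n} \<Longrightarrow> c \<alpha> = 0"
proof -
  let ?C = "fact (n + 1) * - vol 2 3 4"
  have C: "?C \<noteq> 0" using vol_nonzero[of 3 4 2] by simp
  have "(\<Sum>\<alpha>\<in>indices n - {rT n}. c \<alpha> *\<^sub>R divergence (Upsilon x n \<alpha>)) =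
      (\<Sum>\<alpha>\<in>indices n - {rT n}. (c \<alpha> * ?C) *\<^sub>R lap {1..4} \<alpha>)"
    by (intro sum.cong refl) (simp add: divergence_Upsilon)
  then have eq': "(\<Sum>\<alpha>\<in>face_indices n {1..4} - {rT n}. (c \<alpha> * ?C) *\<^sub>R lap {1..4} \<alpha>) + (\<lambda>_. k) + 0 = 0"
    using eq by (simp add: face_indices_full)
  note 1 = lap_indep[OF _ _ _ eq' span_zero, unfolded face_indices_full, OF subset_refl _ rT]
  show "k = 0" by (rule 1(1)) simp
  have "{1..4::nat} \<noteq> {}" by simp
  then show "c \<alpha> = 0" if "\<alpha> \<in> indices n - {rT n}" using 1(2)[OF _ that] C by simp
qed

section \<open>Independence of the curls of the cell fields\<close>

lemma dp_functional:
  assumes K: "linear K" "\<And>\<gamma>. \<gamma> \<in> indices N \<Longrightarrow> K (dpow \<gamma>) = of_bool (\<gamma> = \<beta>)" and \<gamma>: "\<gamma> \<in> indices (Suc N)"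
  shows "K (dp \<gamma> i) = (of_bool (\<gamma> = up \<beta> i) :: real)"
proof (cases "\<gamma> i = 0")
  case True
  then show ?thesis using linear_0[OF K(1)] by (auto simp: dp_def up_def)
next
  case False
  then have "dp \<gamma> i = dpow (dn \<gamma> i)" "dn \<gamma> i \<in> indices N" using \<gamma> by (simp_all add: dp_def dn_indices)
  moreover have "dn \<gamma> i = \<beta> \<longleftrightarrow> \<gamma> = up \<beta> i" using False up_dn dn_up by metis
  ultimately show ?thesis by (simp add: K(2))
qed

text \<open>
  The coefficient of \<open>dpow \<beta>\<close> in the inner product of the equation with
  \<open>(x\<^sub>3 - x\<^sub>4) \<times> (x\<^sub>a - x\<^sub>4)\<close>, to which only the summands with \<open>l \<in> {a, 3}\<close> contribute.
\<close>

lemma curl_Psi_relation: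
  assumes 0: "(\<Sum>(l, \<alpha>)\<in>Psi_indices (Suc N). d (l, \<alpha>) *\<^sub>R curl (Psi x (Suc N) l \<alpha>)) = 0"
    and e: "e = (\<lambda>q. if q \<in> Psi_indices (Suc N) then d q else 0)"
    and a: "a \<in> {1, 2}"
  shows "e (a, up (up \<beta> 3) a) - e (a, up (up \<beta> 4) a) - e (3, up (up \<beta> a) 3) + e (3, up (up \<beta> 4) 3) = 0"
proof (cases "\<beta> \<in> indices N")
  case False
  \<comment> \<open>A twice raised index has the degree and support of an admissible one only if
    \<beta> does, so here \<open>e\<close> vanishes at all four arguments.\<close>
  have "up (up \<beta> i) j \<notin> indices (Suc (Suc N))" if "i \<in> {1..4}" "j \<in> {1..4}" for i j
  proof
    assume "up (up \<beta> i) j \<in> indices (Suc (Suc N))"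
    then have "dn (dn (up (up \<beta> i) j) j) i \<in> indices N"
      by (intro dn_indices) (simp_all add: dn_up, simp_all add: up_def)
    then show False using False by (simp add: dn_up)
  qed
  then have "(l, up (up \<beta> i) j) \<notin> Psi_indices (Suc N)" if "i \<in> {1..4}" "j \<in> {1..4}" for i j l
    using that by (simp add: Psi_indices_def interior_indices_def flip: Suc_eq_plus1)
  then have "e (l, up (up \<beta> i) j) = 0" if "i \<in> {1..4}" "j \<in> {1..4}" for i j l
    using that by (simp add: e)
  moreover have "a \<in> {1..4}" using a by auto
  ultimately show ?thesis by simp
next
  case True
  let ?J = "Psi_indices (Suc N)"
  let ?g = "\<lambda>q. dn (snd q) (fst q)"
  let ?f = "\<lambda>q. of_bool (fst q = a) *\<^sub>R (dp (?g q) 3 - dp (?g q) 4)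
    - of_bool (fst q = 3) *\<^sub>R (dp (?g q) a - dp (?g q) 4)"
  let ?t = "\<lambda>q p. of_bool (fst q = a) * (dp (?g q) 3 p - dp (?g q) 4 p)
    - of_bool (fst q = 3) * (dp (?g q) a p - dp (?g q) 4 p)"
  let ?i = "\<lambda>q. (if q = (a, up (up \<beta> 3) a) then d q else 0) - (if q = (a, up (up \<beta> 4) a) then d q else 0)
      - (if q = (3, up (up \<beta> a) 3) then d q else 0) + (if q = (3, up (up \<beta> 4) 3) then d q else 0)"
  obtain K :: "(real^3 \<Rightarrow> real) \<Rightarrow> real" where K: "linear K"
    "\<And>\<gamma>. \<gamma> \<in> indices N \<Longrightarrow> K (dpow \<gamma>) = of_bool (\<gamma> = \<beta>)"
    using dpow_functional[of N "\<lambda>\<gamma>. of_bool (\<gamma> = \<beta>)"] by blast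
  let ?k = "\<lambda>q. of_bool (fst q = a) * (K (dp (?g q) 3) - K (dp (?g q) 4))
    - of_bool (fst q = 3) * (K (dp (?g q) a) - K (dp (?g q) 4))"
  have J: "l \<in> {1, 2, 3}" "\<alpha> l \<noteq> 0" "\<alpha> \<in> indices (Suc (Suc N))" if "(l, \<alpha>) \<in> ?J" for l \<alpha>
    using that by (auto simp: Psi_indices_def interior_indices_def simp flip: Suc_eq_plus1)
  have "(\<Sum>q\<in>?J. d q *\<^sub>R ?f q) = 0"
  proof
    fix p
    let ?w = "cross3 (x 3 - x 4) (x a - x 4)"
    have gr: "grad (dpow \<gamma>) p \<bullet> (x i - x j) = dp \<gamma> i p - dp \<gamma> j p" if "i \<in> {1..4}" "j \<in> {1..4}" for \<gamma> i j
      using that by (simp add: grad_dpow inner_sum_left G_edge right_diff_distrib sum_subtractf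
          of_bool_def if_distribR if_distrib[of "\<lambda>c. _ * c"] cong: if_cong)
    have "0 = (\<Sum>(l, \<alpha>)\<in>?J. d (l, \<alpha>) *\<^sub>R curl (Psi x (Suc N) l \<alpha>)) p \<bullet> ?w"
      unfolding 0 by simp
    also have "\<dots> = (\<Sum>q\<in>?J. d q * (curl (Psi x (Suc N) (fst q) (snd q)) p \<bullet> ?w))"
      by (simp add: sum_fun_apply inner_sum_left split_def)
    also have "\<dots> = (\<Sum>q\<in>?J. fact (Suc N + 1) * (d q * ?t q p))"
    proof (intro sum.cong refl)
      fix q assume "q \<in> ?J"
      then have l: "fst q \<in> {1, 2, 3}" using J(1)[of "fst q" "snd q"] by simp
      \<comment> \<open>The Binet-Cauchy identity splits the product into derivatives along edges
        and products of \<open>G\<close> with edge vectors. As the label is not 4, the latter are 0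
        or 1.\<close>
      have "cross3 (grad (dpow \<gamma>) p) (G (fst q)) \<bullet> ?w =
        of_bool (fst q = a) * (dp \<gamma> 3 p - dp \<gamma> 4 p) - of_bool (fst q = 3) * (dp \<gamma> a p - dp \<gamma> 4 p)" for \<gamma>
        using l a unfolding cross3_dot by (subst (1 2) gr) (auto simp: G_edge)
      then show "d q * (curl (Psi x (Suc N) (fst q) (snd q)) p \<bullet> ?w) =
        fact (Suc N + 1) * (d q * ?t q p)"
        unfolding curl_Psi inner_scaleR_left by (simp only: mult.left_commute)
    qed
    finally have "0 = (fact (Suc N + 1) :: real) * (\<Sum>q\<in>?J. d q * ?t q p)"
      by (simp only: sum_distrib_left)
    then show "(\<Sum>q\<in>?J. d q *\<^sub>R ?f q) p = 0 p"
      by (simp add: sum_fun_apply del: fact_Suc)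
  qed
  then have "0 = K (\<Sum>q\<in>?J. d q *\<^sub>R ?f q)"
    by (simp only: linear_0[OF K(1)])
  also have "\<dots> = (\<Sum>q\<in>?J. d q * ?k q)"
    unfolding linear_sum[OF K(1)] linear_scale[OF K(1)] linear_diff[OF K(1)] real_scaleR_def ..
  also have "\<dots> = (\<Sum>q\<in>?J. ?i q)"
  proof (intro sum.cong refl)
    fix q assume q: "q \<in> ?J"
    obtain l \<alpha> where la: "q = (l, \<alpha>)" by (cases q)
    have at: "(l = m \<and> \<alpha> = up \<gamma> l) = ((l, \<alpha>) = (m, up \<gamma> m))" for m \<gamma> by auto
    have K': "K (dp (dn \<alpha> l) i) = of_bool (\<alpha> = up (up \<beta> i) l)" for i
    proof -
      have "dn \<alpha> l = up \<beta> i \<longleftrightarrow> \<alpha> = up (up \<beta> i) l" using J(2)[of l \<alpha>] q la up_dn dn_up by metis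
      then show ?thesis using dp_functional[OF K dn_indices[of \<alpha> "Suc N" l]] J[of l \<alpha>] q la by simp
    qed
    show "d q * ?k q = ?i q"
      unfolding la fst_conv snd_conv K' of_bool_terms at ..
  qed
  also have "\<dots> = e (a, up (up \<beta> 3) a) - e (a, up (up \<beta> 4) a) - e (3, up (up \<beta> a) 3) + e (3, up (up \<beta> 4) 3)"
    unfolding sum.distrib sum_subtractf e by (simp only: sum.delta finite_Psi_indices)
  finally show ?thesis by (rule sym)
qed

text \<open>A suitable relation from \<open>curl_Psi_relation\<close> expresses a coefficient
  through one with a smaller entry at vertex 4. The coefficients for \<open>l = 1\<close> and
  \<open>l = 2\<close> come first: the restriction \<open>\<alpha> 3 = 1\<close> for
  \<open>l = 3\<close> removes the terms that couple them.\<close>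

lemma curl_Psi_indep: "indep_family (\<lambda>(l, \<alpha>). curl (Psi x n l \<alpha>)) (Psi_indices n)"
proof (cases n)
  case 0
  have "interior_indices (n + 1) {1..4} = {}"
  proof (rule ccontr)
    assume "interior_indices (n + 1) {1..4} \<noteq> {}"
    then obtain \<alpha> :: "nat \<Rightarrow> nat" where a: "(\<Sum>i=1..4. \<alpha> i) = 1" "\<forall>i\<in>{1..4}. \<alpha> i > 0"
      by (auto simp: 0 interior_indices_def indices_def)
    then have "\<alpha> 1 > 0" "\<alpha> 2 > 0" by simp_all
    then show False using a(1) unfolding sum_4 by linarith
  qed
  then have "Psi_indices n = {}" by (auto simp: Psi_indices_def)
  then show ?thesis by (simp add: indep_family_def)
next
  case (Suc N)
  show ?thesis
    unfolding indep_family_def Suc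
  proof (intro conjI allI impI)
    fix d assume "(\<Sum>q\<in>Psi_indices (Suc N). d q *\<^sub>R (case q of (l, \<alpha>) \<Rightarrow> curl (Psi x (Suc N) l \<alpha>))) = 0"
    then have 0: "(\<Sum>(l, \<alpha>)\<in>Psi_indices (Suc N). d (l, \<alpha>) *\<^sub>R curl (Psi x (Suc N) l \<alpha>)) = 0"
      by (simp add: split_def)
    define e where "e = (\<lambda>q. if q \<in> Psi_indices (Suc N) then d q else 0)"
    note rel = curl_Psi_relation[OF 0 e_def]
    have int: "0 < \<alpha> i" if "e (l, \<alpha>) \<noteq> 0" "i \<in> {1..4}" for l \<alpha> i
      using that by (auto simp: e_def Psi_indices_def interior_indices_def split: if_splits)
    have e3: "e (3, \<alpha>) = 0" if "\<alpha> 3 \<noteq> 1" for \<alpha>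
      using that by (auto simp: e_def Psi_indices_def)
    have ea: "e (a, \<gamma>) = 0" if a: "a \<in> {1, 2}" for a \<gamma>
    proof (induction "\<gamma> 4" arbitrary: \<gamma> rule: less_induct)
      case less
      show ?case
      proof (rule ccontr)
        assume ne: "e (a, \<gamma>) \<noteq> 0"
        then have pos: "\<gamma> a > 0" "\<gamma> 3 > 0" "\<gamma> 4 > 0" using a int by auto
        \<comment> \<open>This makes \<gamma> the second index of the relation. The first index has
          a smaller entry at 4, and the two with label 3 have third entry at least 2, where
          \<open>e3\<close> applies.\<close>
        define \<beta> where "\<beta> = dn (dn \<gamma> a) 4"
        have b: "up (up \<beta> 4) a = \<gamma>" "up (up \<beta> 3) a 4 < \<gamma> 4" "up (up \<beta> a) 3 3 \<noteq> 1" "up (up \<beta> 4) 3 3 \<noteq> 1"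
          using pos a by (auto simp: \<beta>_def up_def dn_def)
        show False using rel[OF a, of \<beta>] less[of "up (up \<beta> 3) a", OF b(2)] e3[of "up (up \<beta> a) 3", OF b(3)]
            e3[of "up (up \<beta> 4) 3", OF b(4)] b(1) ne by simp
      qed
    qed
    have "e (3, \<gamma>) = 0" for \<gamma>
    proof (induction "\<gamma> 4" arbitrary: \<gamma> rule: less_induct)
      case less
      show ?case
      proof (rule ccontr)
        assume ne: "e (3, \<gamma>) \<noteq> 0"
        then have pos: "\<gamma> 3 > 0" "\<gamma> 4 > 0" using int by auto
        \<comment> \<open>The coefficients with label 1 are known to be 0, so the relation links
          \<gamma> to an index with a smaller entry at 4.\<close>
        define \<beta> where "\<beta> = dn (dn \<gamma> 3) 4"
        have b: "up (up \<beta> 4) 3 = \<gamma>" "up (up \<beta> 1) 3 4 < \<gamma> 4"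
          using pos by (auto simp: \<beta>_def up_def dn_def)
        show False using rel[of 1 \<beta>] less[of "up (up \<beta> 1) 3", OF b(2)] ea[of 1] b(1) ne by simp
      qed
    qed
    then have "e q = 0" if "q \<in> Psi_indices (Suc N)" for q
      using that ea by (auto simp: Psi_indices_def)
    then show "\<forall>q\<in>Psi_indices (Suc N). d q = 0" by (simp add: e_def)
  qed simp
qed

lemma Psi_indep: "indep_family (\<lambda>(l, \<alpha>). Psi x n l \<alpha>) (Psi_indices n)"
proof (rule indep_family_from_image[OF curl_linear])
  show "(case q of (l, \<alpha>) \<Rightarrow> Psi x n l \<alpha>) \<in> vec_fields diffable" for q
    by (simp add: Psi_fields split: prod.split)
  have "(\<lambda>q. curl (case q of (l, \<alpha>) \<Rightarrow> Psi x n l \<alpha>)) = (\<lambda>(l, \<alpha>). curl (Psi x n l \<alpha>))"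
    by (auto simp: fun_eq_iff)
  then show "indep_family (\<lambda>q. curl (case q of (l, \<alpha>) \<Rightarrow> Psi x n l \<alpha>)) (Psi_indices n)"
    using curl_Psi_indep[of n] by simp
qed

lemma E_cell_curl: "curl ` E_cell x n = span ((\<lambda>(l, \<alpha>). curl (Psi x n l \<alpha>)) ` Psi_indices n)"
proof -
  have "curl ` E_cell x n = span ((\<lambda>q. curl (case q of (l, \<alpha>) \<Rightarrow> Psi x n l \<alpha>)) ` Psi_indices n)"
    unfolding E_cell_def
    by (rule linear_op_on_image_span[OF curl_linear]) (auto simp: Psi_fields split: prod.split)
  also have "(\<lambda>q. curl (case q of (l, \<alpha>) \<Rightarrow> Psi x n l \<alpha>)) = (\<lambda>(l, \<alpha>). curl (Psi x n l \<alpha>))"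
    by (auto simp: fun_eq_iff)
  finally show ?thesis .
qed

section \<open>Independence of the face fields and of the fields with divergence\<close>

abbreviation "Phi_indices n F \<equiv> face_indices n F - {rF n F}"

lemma E_face_curl:
  assumes "F \<in> set faces"
  shows "curl ` E_face x num rF n F = span ((\<lambda>\<alpha>. curl (Phi x (num F) n \<alpha>)) ` Phi_indices n F)"
  unfolding E_face_def
  by (rule linear_op_on_image_span[OF curl_linear]) (auto intro: Phi_fields num_mem[OF assms])

lemma V_cell_divergence:
  "divergence ` V_cell x rT n = span ((\<lambda>\<alpha>. divergence (Upsilon x n \<alpha>)) ` (indices n - {rT n}))"
  unfolding V_cell_def
  by (rule linear_op_on_image_span[OF divergence_linear]) (auto intro: Upsilon_fields)

text \<open>
  On each face only the constant \<open>b\<close> and the fields of that face have a normal component.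
\<close>

lemma boundary_indep:
  assumes eq: "(\<lambda>_. b) + (\<Sum>F\<in>set faces. \<Sum>\<alpha>\<in>Phi_indices n F. c F \<alpha> *\<^sub>R curl (Phi x (num F) n \<alpha>)) + w = 0"
    and w: "w \<in> curl ` E_cell x (n + 1)"
  shows "b = 0" and "F \<in> set faces \<Longrightarrow> \<alpha> \<in> Phi_indices n F \<Longrightarrow> c F \<alpha> = 0"
proof -
  have face: "b \<bullet> G l = 0 \<and> (\<forall>\<alpha>\<in>Phi_indices n F. c F \<alpha> = 0)"
    if F: "F \<in> set faces" and l: "l \<in> {1..4}" "F = {1..4} - {l}"
      "\<And>F'. F' \<in> set faces \<Longrightarrow> F' \<noteq> F \<Longrightarrow> l \<in> F'" for F l
  proof -
    \<comment> \<open>Up to a factor this is the normal component on the face opposite to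
      \<open>l\<close>.\<close>
    define h where "h = (\<lambda>(v :: real^3 \<Rightarrow> real^3) p. v p \<bullet> G l)"
    have lin: "linear h"
      by (rule linearI) (auto simp: h_def fun_eq_iff inner_add_left)
    have sub: "subspace (off_face n l)" by (simp add: off_face_def)
    note n = num_opposite[OF F l(1,2)]
    let ?D = "fact (n + 1) * vol l (num F 1) (num F 2)"
    have D: "?D \<noteq> 0" using vol_nonzero[OF num_mem(1,2)[OF F] l(1)] n(2) by simp
    let ?s = "\<lambda>F. \<Sum>\<alpha>\<in>Phi_indices n F. c F \<alpha> *\<^sub>R h (curl (Phi x (num F) n \<alpha>))"
    have hF: "?s F = (\<Sum>\<alpha>\<in>Phi_indices n F. (c F \<alpha> * ?D) *\<^sub>R lap F \<alpha>)"
    proof (intro sum.cong refl)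
      fix \<alpha>
      show "c F \<alpha> *\<^sub>R h (curl (Phi x (num F) n \<alpha>)) = (c F \<alpha> * ?D) *\<^sub>R lap F \<alpha>"
        unfolding h_def by (intro ext, subst (2) num[OF F]) (simp only: curl_Phi_dot[OF n] scaleR_fun_apply real_scaleR_def mult.assoc)
    qed
    \<comment> \<open>The contributions of the other faces and of the cell fields, all of which lie
      in \<open>off_face n l\<close>.\<close>
    define R where "R = (\<Sum>F'\<in>set faces - {F}. ?s F') + h w"
    have w_off: "h w \<in> off_face n l"
    proof -
      obtain d where "w = (\<Sum>q\<in>Psi_indices (n + 1). d q *\<^sub>R (case q of (l, \<alpha>) \<Rightarrow> curl (Psi x (n + 1) l \<alpha>)))"
        using w unfolding E_cell_curl by (rule span_familyE) simp
      then have "h w = (\<Sum>q\<in>Psi_indices (n + 1). d q *\<^sub>R h (curl (Psi x (n + 1) (fst q) (snd q))))"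
        by (simp only: linear_sum[OF lin] linear_scale[OF lin] split_def)
      moreover have "h (curl (Psi x (n + 1) (fst q) (snd q))) \<in> off_face n l" if "q \<in> Psi_indices (n + 1)" for q
        using that curl_Psi_off_face[of "snd q" n "fst q" l] l unfolding h_def
        by (auto simp: Psi_indices_def simp flip: Suc_eq_plus1)
      ultimately show ?thesis by (simp only:) (intro subspace_sum[OF sub] subspace_scale[OF sub])
    qed
    have F_off: "?s F' \<in> off_face n l" if "F' \<in> set faces - {F}" for F'
    proof (intro subspace_sum[OF sub] subspace_scale[OF sub])
      fix \<alpha> assume "\<alpha> \<in> Phi_indices n F'"
      moreover have "l \<in> {num F' 1, num F' 2, num F' 3}" using l(3)[of F'] num[of F'] that by blast
      ultimately show "h (curl (Phi x (num F') n \<alpha>)) \<in> off_face n l"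
        using that face_indices_subset unfolding h_def
        by (intro curl_Phi_off_face num_mem) auto
    qed
    have R: "R \<in> off_face n l"
      unfolding R_def by (rule subspace_add[OF sub subspace_sum[OF sub F_off] w_off])
    have "h ((\<lambda>_. b) + (\<Sum>F\<in>set faces. \<Sum>\<alpha>\<in>Phi_indices n F. c F \<alpha> *\<^sub>R curl (Phi x (num F) n \<alpha>)) + w) = 0"
      unfolding eq by (rule linear_0[OF lin])
    then have "h (\<lambda>_. b) + (\<Sum>F\<in>set faces. ?s F) + h w = 0"
      by (simp only: linear_add[OF lin] linear_sum[OF lin] linear_scale[OF lin])
    moreover have "(\<Sum>F\<in>set faces. ?s F) = ?s F + (\<Sum>F'\<in>set faces - {F}. ?s F')"
      using F by (intro sum.remove) auto
    moreover have "h (\<lambda>_. b) = (\<lambda>_. b \<bullet> G l)" by (simp add: h_def)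
    ultimately have "(\<Sum>\<alpha>\<in>face_indices n F - {rF n F}. (c F \<alpha> * ?D) *\<^sub>R lap F \<alpha>) + (\<lambda>_. b \<bullet> G l) + R = 0"
      unfolding R_def hF by (simp add: algebra_simps)
    note lap = lap_indep[OF _ _ rF[OF F] this R[unfolded off_face_def l(2)[symmetric]]]
    have "F \<subseteq> {1..4}" "F \<noteq> {}" using l(2) F by (auto simp: faces_def)
    then show ?thesis using lap D by auto
  qed
  show "c F \<alpha> = 0" if "F \<in> set faces" "\<alpha> \<in> Phi_indices n F"
    using faces_opposite[OF that(1)] face[OF that(1)] that(2) by metis
  \<comment> \<open>Every vertex is opposite to some face, so \<open>b\<close> is orthogonal to all
    four gradients.\<close>
  have "b \<bullet> G l = 0" if l: "l \<in> {1..4}" for l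
  proof -
    obtain l' where l': "l' \<in> {1..4}" "{1..4} - {l} = {1..4} - {l'}"
      "\<And>F'. F' \<in> set faces \<Longrightarrow> F' \<noteq> {1..4} - {l} \<Longrightarrow> l' \<in> F'"
      using faces_opposite[OF faces_opposite_vertex[OF l]] by metis
    then have "l' = l" using l by blast
    then show ?thesis using face[OF faces_opposite_vertex[OF l] l'] by simp
  qed
  then show "b = 0" by (intro G_eqI) (simp add: inner_commute)
qed

text \<open>Zero coefficients on the other faces single out one face in
  \<open>boundary_indep\<close>.\<close>

lemma curl_Phi_indep:
  assumes F: "F \<in> set faces"
  shows "indep_family (\<lambda>\<alpha>. curl (Phi x (num F) n \<alpha>)) (Phi_indices n F)"
  unfolding indep_family_def
proof (intro conjI allI impI ballI)
  fix c \<alpha> assume 0: "(\<Sum>\<alpha>\<in>Phi_indices n F. c \<alpha> *\<^sub>R curl (Phi x (num F) n \<alpha>)) = 0" and a: "\<alpha> \<in> Phi_indices n F"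
  define c' where "c' = (\<lambda>F' \<alpha>. if F' = F then c \<alpha> else 0)"
  have "(\<Sum>F'\<in>set faces. \<Sum>\<alpha>\<in>Phi_indices n F'. c' F' \<alpha> *\<^sub>R curl (Phi x (num F') n \<alpha>)) = 0"
  proof (rule sum.neutral, rule ballI)
    fix F'
    show "(\<Sum>\<alpha>\<in>Phi_indices n F'. c' F' \<alpha> *\<^sub>R curl (Phi x (num F') n \<alpha>)) = 0"
      using 0 by (cases "F' = F") (simp_all add: c'_def)
  qed
  then have "(\<lambda>_. 0) + (\<Sum>F'\<in>set faces. \<Sum>\<alpha>\<in>Phi_indices n F'. c' F' \<alpha> *\<^sub>R curl (Phi x (num F') n \<alpha>)) + 0 = 0"
    by (simp add: zero_fun_def)
  moreover have "0 \<in> curl ` E_cell x (n + 1)" unfolding E_cell_curl by (rule span_zero)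
  ultimately have "c' F \<alpha> = 0" using F a by (rule boundary_indep(2))
  then show "c \<alpha> = 0" by (simp add: c'_def)
qed simp

lemma Phi_indep: "F \<in> set faces \<Longrightarrow> indep_family (Phi x (num F) n) (Phi_indices n F)"
  by (rule indep_family_from_image[OF curl_linear])
    (auto intro: Phi_fields num_mem curl_Phi_indep)

lemma divergence_Upsilon_indep_family:
  "indep_family (\<lambda>\<alpha>. divergence (Upsilon x n \<alpha>)) (indices n - {rT n})"
  unfolding indep_family_def
proof (intro conjI allI impI ballI)
  fix c \<alpha> assume "(\<Sum>\<alpha>\<in>indices n - {rT n}. c \<alpha> *\<^sub>R divergence (Upsilon x n \<alpha>)) = 0" "\<alpha> \<in> indices n - {rT n}"
  then show "c \<alpha> = 0" using divergence_Upsilon_indep(2)[where n=n and c=c and k=0] by (simp add: zero_fun_def[symmetric])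
qed simp

lemma Upsilon_indep: "indep_family (Upsilon x n) (indices n - {rT n})"
  by (rule indep_family_from_image[OF divergence_linear])
    (simp_all add: Upsilon_fields divergence_Upsilon_indep_family)

section \<open>Bernstein polynomials, their gradients and the lowest-order families\<close>

lemma bern_scaleR: "bern x n \<alpha> = fact n *\<^sub>R dpow \<alpha>"
  by (intro ext) (simp add: bern_dpow)

lemma bern_indep: "indep_family (bern x n) (interior_indices n A)"
proof -
  have "indep_family (\<lambda>\<alpha>. fact n *\<^sub>R dpow \<alpha>) (interior_indices n A)"
    by (rule indep_family_scale[OF indep_family_subset[OF dpow_indep interior_indices_subset]]) simp
  then show ?thesis by (simp add: bern_scaleR[abs_def])
qed

lemma bern_diffable: "bern x n \<alpha> \<in> diffable"
  unfolding bern_scaleR by (intro subspace_scale subspace_diffable dpow_diffable)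

text \<open>The cell has a vertex other than \<open>i\<close>; the coordinate of that vertex divides
  the Bernstein polynomial and vanishes at \<open>x i\<close>.\<close>

lemma bern_vertex:
  assumes "\<alpha> \<in> interior_indices n A" "A \<in> cells" "i \<in> {1..4}"
  shows "bern x n \<alpha> (x i) = 0"
proof -
  obtain j where j: "j \<in> A" "j \<noteq> i" "j \<in> {1..4}" using cells_bounds[OF assms(2)] assms(3) by blast
  then have "\<alpha> j \<noteq> 0" using assms(1) by (auto simp: interior_indices_def)
  then have "bary x j (x i) ^ \<alpha> j = 0" using j assms(3) by (simp add: bary_vertex)
  then have "(\<Prod>i'=1..4. bary x i' (x i) ^ \<alpha> i') = 0" using j(3) by (intro prod_zero) auto
  then show ?thesis by (simp add: bern_def)
qed

lemma S_space_vertex: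
  assumes "u \<in> S_space x n A" "A \<in> cells" "i \<in> {1..4}" shows "u (x i) = 0"
proof -
  obtain c where "u = (\<Sum>\<alpha>\<in>interior_indices n A. c \<alpha> *\<^sub>R bern x n \<alpha>)"
    using assms(1) unfolding S_space_def by (rule span_familyE) simp
  then show ?thesis using bern_vertex[OF _ assms(2,3)] by (simp add: sum_fun_apply)
qed

text \<open>A combination with zero gradient is constant. By \<open>S_space_vertex\<close> it
  vanishes at a vertex, hence everywhere, and \<open>bern_indep\<close> applies.\<close>

lemma grad_bern_indep:
  assumes A: "A \<in> cells"
  shows "indep_family (\<lambda>\<alpha>. grad (bern x n \<alpha>)) (interior_indices n A)"
  unfolding indep_family_def
proof (intro conjI allI impI)
  fix c assume 0: "(\<Sum>\<alpha>\<in>interior_indices n A. c \<alpha> *\<^sub>R grad (bern x n \<alpha>)) = 0"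
  let ?u = "\<Sum>\<alpha>\<in>interior_indices n A. c \<alpha> *\<^sub>R bern x n \<alpha>"
  have "grad ?u = 0" unfolding linear_op_on_sum[OF grad_linear bern_diffable] 0 ..
  moreover have "?u \<in> diffable" by (intro subspace_sum subspace_scale subspace_diffable bern_diffable)
  ultimately obtain k where k: "?u = (\<lambda>_. k)" using constant_if_grad_eq_0 by blast
  have "?u \<in> S_space x n A" unfolding S_space_def by (intro span_sum span_scale span_base imageI)
  then have "?u (x 1) = 0" using A by (rule S_space_vertex) simp
  then have "?u = 0" unfolding k by (simp add: fun_eq_iff)
  then show "\<forall>\<alpha>\<in>interior_indices n A. c \<alpha> = 0" using indep_familyD[OF bern_indep] by blast
qed simp

lemma grad_S_space: "grad ` S_space x n A = span ((\<lambda>\<alpha>. grad (bern x n \<alpha>)) ` interior_indices n A)"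
  unfolding S_space_def by (rule linear_op_on_image_span[OF grad_linear bern_diffable]) simp

lemma bary_indep: "indep_family (bary x) {1..4}"
  unfolding indep_family_def
proof (intro conjI allI impI ballI)
  fix c i assume 0: "(\<Sum>i=1..4. c i *\<^sub>R bary x i) = 0" and i: "i \<in> {1..4::nat}"
  have "(\<Sum>j=1..4. c j *\<^sub>R bary x j) (x i) = c i"
    using i by (simp add: sum_fun_apply bary_vertex of_bool_def if_distrib[of "\<lambda>c. _ * c"] cong: if_cong)
  then show "c i = 0" unfolding 0 by simp
qed simp

text \<open>Evaluation at \<open>x i\<close> in the direction \<open>x j - x i\<close> gives 1 on
  \<open>omega x i j\<close> and 0 on all other ordered pairs.\<close>

lemma omega_indep: "indep_family (\<lambda>(i, j). omega x i j) low_edges"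
  unfolding indep_family_def
proof (intro conjI allI impI ballI)
  show fin: "finite low_edges"
    by (rule finite_subset[of _ "{1..4} \<times> {1..4}"]) (auto simp: low_edges_def)
  fix c q assume 0: "(\<Sum>q\<in>low_edges. c q *\<^sub>R (case q of (i, j) \<Rightarrow> omega x i j)) = 0" and q: "q \<in> low_edges"
  obtain i j where ij: "q = (i, j)" "i \<in> {1..4}" "j \<in> {1..4}" "i < j" using q by (auto simp: low_edges_def)
  have "0 = (\<Sum>q\<in>low_edges. c q *\<^sub>R (case q of (i, j) \<Rightarrow> omega x i j)) (x i) \<bullet> (x j - x i)"
    unfolding 0 by simp
  also have "\<dots> = (\<Sum>q'\<in>low_edges. c q' * (omega x (fst q') (snd q') (x i) \<bullet> (x j - x i)))"
    by (simp add: sum_fun_apply inner_sum_left split_def)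
  also have "\<dots> = (\<Sum>q'\<in>low_edges. if q' = q then c q' else 0)"
  proof (intro sum.cong refl)
    fix q' assume "q' \<in> low_edges"
    then show "c q' * (omega x (fst q') (snd q') (x i) \<bullet> (x j - x i)) = (if q' = q then c q' else 0)"
      using ij by (auto simp: low_edges_def omega_eq bary_vertex inner_diff_left G_edge)
  qed
  also have "\<dots> = c q" using fin q by simp
  finally show "c q = 0" by simp
qed

text \<open>By \<open>chi_eq\<close>, at a vertex other than \<open>x m\<close> the product of
  \<open>chi x l\<close> with \<open>G m\<close> is nonzero exactly for
  \<open>l = m\<close>.\<close>

lemma chi_indep: "indep_family (chi x) {1..4}"
  unfolding indep_family_def
proof (intro conjI allI impI ballI)
  fix c m assume 0: "(\<Sum>l=1..4. c l *\<^sub>R chi x l) = 0" and m: "m \<in> {1..4::nat}"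
  obtain k :: nat where k: "k \<in> {1..4}" "k \<noteq> m" by (metis atLeastAtMost_iff one_le_numeral order_refl numeral_eq_iff semiring_norm(85) one_eq_numeral_iff)
  have V: "vol 2 3 4 \<noteq> 0" using vol_nonzero[of 3 4 2] by simp
  have "0 = (\<Sum>l=1..4. c l *\<^sub>R chi x l) (x k) \<bullet> G m" unfolding 0 by simp
  also have "\<dots> = (\<Sum>l=1..4. c l * (chi x l (x k) \<bullet> G m))"
    by (simp add: sum_fun_apply inner_sum_left)
  also have "\<dots> = (\<Sum>l=1..4. if l = m then c l * ((-1) ^ l * vol 2 3 4) else 0)"
  proof (intro sum.cong refl)
    fix l :: nat assume l: "l \<in> {1..4}"
    show "c l * (chi x l (x k) \<bullet> G m) = (if l = m then c l * ((-1) ^ l * vol 2 3 4) else 0)"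
      using k by (simp add: chi_eq[OF l] inner_commute[of _ "G m"] G_vertex[OF l] bary_vertex)
  qed
  also have "\<dots> = c m * ((-1) ^ m * vol 2 3 4)" using m by simp
  finally show "c m = 0" using V by simp
qed simp

end

lemma antisym_sum_eq_0:
  fixes t :: "nat \<Rightarrow> nat \<Rightarrow> real"
  assumes "\<And>i k. t i k = - t k i"
  shows "(\<Sum>i=1..4. \<Sum>k=1..4. t i k) = 0"
proof -
  have "(\<Sum>i=1..4. \<Sum>k=1..4. t i k) = (\<Sum>k=1..4. \<Sum>i=1..4. t i k)" by (rule sum.swap)
  also have "\<dots> = (\<Sum>k=1..4. \<Sum>i=1..4. - t k i)" by (intro sum.cong refl assms)
  also have "\<dots> = - (\<Sum>i=1..4. \<Sum>k=1..4. t i k)" by (simp add: sum_negf)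
  finally show ?thesis by simp
qed

context tetrahedron_choice
begin

section \<open>Directness of the sums\<close>

text \<open>Evaluation at the vertices sees only \<open>v\<close>. Each Bernstein coefficient is
  then read off by a functional, and its index belongs to one cell only.\<close>

lemma S_direct:
  assumes v: "v \<in> S_low x" and u: "\<And>A. A \<in> cells \<Longrightarrow> u A \<in> S_space x n A"
    and eq: "v + (\<Sum>A\<in>cells. u A) = 0"
  shows "v = 0" and "A \<in> cells \<Longrightarrow> u A = 0"
proof -
  obtain c where c: "v = (\<Sum>i=1..4. c i *\<^sub>R bary x i)"
    using v unfolding S_low_def by (rule span_familyE) simp
  have "c j = 0" if j: "j \<in> {1..4}" for j
  proof -
    have "v (x j) + (\<Sum>A\<in>cells. u A (x j)) = 0"
      using fun_cong[OF eq, of "x j"] by (simp add: sum_fun_apply)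
    moreover have "(\<Sum>A\<in>cells. u A (x j)) = 0"
      using S_space_vertex[OF u _ j] by (intro sum.neutral) blast
    moreover have "v (x j) = c j"
      using j by (simp add: c sum_fun_apply bary_vertex of_bool_def if_distrib[of "\<lambda>c. _ * c"] cong: if_cong)
    ultimately show ?thesis by simp
  qed
  then show v0: "v = 0" unfolding c by simp
  have "\<forall>A\<in>cells. \<exists>d. u A = (\<Sum>\<alpha>\<in>interior_indices n A. d \<alpha> *\<^sub>R bern x n \<alpha>)"
  proof
    fix A assume "A \<in> cells"
    then show "\<exists>d. u A = (\<Sum>\<alpha>\<in>interior_indices n A. d \<alpha> *\<^sub>R bern x n \<alpha>)"
      using u[of A] unfolding S_space_def by (blast elim: span_familyE[OF _ finite_interior_indices])
  qed
  from bchoice[OF this] obtain d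
    where d: "\<And>A. A \<in> cells \<Longrightarrow> u A = (\<Sum>\<alpha>\<in>interior_indices n A. d A \<alpha> *\<^sub>R bern x n \<alpha>)"
    by blast
  have "d A \<gamma> = 0" if A: "A \<in> cells" and g: "\<gamma> \<in> interior_indices n A" for A \<gamma>
  proof -
    obtain K :: "(real^3 \<Rightarrow> real) \<Rightarrow> real" where K: "linear K"
      "\<And>\<alpha>. \<alpha> \<in> indices n \<Longrightarrow> K (dpow \<alpha>) = of_bool (\<alpha> = \<gamma>)"
      using dpow_functional[of n "\<lambda>\<alpha>. of_bool (\<alpha> = \<gamma>)"] by blast
    have Ku: "K (u B) = (if B = A then d A \<gamma> * fact n else 0)" if B: "B \<in> cells" for B
    proof -
      have "K (u B) = (\<Sum>\<alpha>\<in>interior_indices n B. d B \<alpha> * (fact n * K (dpow \<alpha>)))"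
        unfolding d[OF B] bern_scaleR by (simp add: linear_sum[OF K(1)] linear_scale[OF K(1)] mult.assoc)
      also have "\<dots> = (\<Sum>\<alpha>\<in>interior_indices n B. if \<alpha> = \<gamma> then d B \<alpha> * fact n else 0)"
        using interior_indices_subset by (intro sum.cong refl) (auto simp: K(2) subset_iff)
      also have "\<dots> = (if \<gamma> \<in> interior_indices n B then d B \<gamma> * fact n else 0)" by simp
      also have "\<gamma> \<in> interior_indices n B \<longleftrightarrow> B = A"
        using interior_support[OF _ cells_bounds(1)[OF A]] interior_support[OF _ cells_bounds(1)[OF B]] g
        by metis
      finally show ?thesis by simp
    qed
    have "K (\<Sum>A\<in>cells. u A) = 0" using eq v0 linear_0[OF K(1)] by simp
    then have "(\<Sum>B\<in>cells. K (u B)) = 0" by (simp only: linear_sum[OF K(1)])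
    moreover have "(\<Sum>B\<in>cells. K (u B)) = (\<Sum>B\<in>cells. if B = A then d A \<gamma> * fact n else 0)"
      by (intro sum.cong refl Ku)
    moreover have "\<dots> = d A \<gamma> * fact n" using A by (subst sum.delta) auto
    ultimately show ?thesis by simp
  qed
  then show "u A = 0" if "A \<in> cells" using d[OF that] that by simp
qed

section \<open>Divergence-free curls and directness of the sums of curls\<close>

lemma grad_cross_eq: "cross3 (grad (dpow \<beta>) p) w = (\<Sum>m=1..4. dp \<beta> m p *\<^sub>R cross3 (G m) w)"
  unfolding grad_dpow cross3_sum_left cross_mult_left ..

text \<open>Symmetric second derivatives meet a triple product that is antisymmetric in the two
  differentiation directions.\<close>

lemma divergence_grad_cross: "divergence (\<lambda>p. cross3 (grad (dpow \<beta>) p) w) p = 0"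
proof -
  define s where "s = (\<lambda>i k. if \<beta> i = 0 then 0 else dp (dn \<beta> i) k p)"
  have sym: "s i k = s k i" for i k
    unfolding s_def dp_def by (cases "i = k") (auto simp: dn_def fun_upd_twist)
  have "divergence (\<lambda>p. cross3 (grad (dpow \<beta>) p) w) p = (\<Sum>m=1..4. grad (dp \<beta> m) p \<bullet> cross3 (G m) w)"
    unfolding grad_cross_eq by (intro divergence_sum_fields dp_diffable)
  also have "\<dots> = (\<Sum>m=1..4. \<Sum>k=1..4. s m k * (G k \<bullet> cross3 (G m) w))"
    by (simp add: grad_dp inner_sum_left s_def)
  also have "\<dots> = 0"
  proof (rule antisym_sum_eq_0)
    fix i k
    have "G k \<bullet> cross3 (G i) w = - (G i \<bullet> cross3 (G k) w)" by (simp add: cross3_simps)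
    then show "s i k * (G k \<bullet> cross3 (G i) w) = - (s k i * (G i \<bullet> cross3 (G k) w))"
      by (simp add: sym[of i k])
  qed
  finally show ?thesis .
qed

lemma grad_cross_fields: "(\<lambda>p. cross3 (grad (dpow \<beta>) p) w) \<in> vec_fields diffable"
  unfolding grad_cross_eq by (intro sum_vec_fields scaleR_const_vec_fields subspace_diffable dp_diffable)

lemma grad_cross_div_free: "(\<lambda>p. cross3 (grad (dpow \<beta>) p) w) \<in> div_free"
  unfolding div_free_def using grad_cross_fields[of \<beta> w] divergence_grad_cross[of \<beta> w] by auto

lemma curl_Psi_fun:
  "curl (Psi x n l \<alpha>) = fact (n + 1) *\<^sub>R (\<lambda>p. cross3 (grad (dpow (dn \<alpha> l)) p) (G l))"
  by (intro ext) (simp add: curl_Psi)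

lemma face_curl_fun:
  "face_curl \<alpha> j k = real (\<alpha> j + 1) *\<^sub>R (\<lambda>p. cross3 (grad (dpow (up \<alpha> j)) p) (G k))
     - real (\<alpha> k + 1) *\<^sub>R (\<lambda>p. cross3 (grad (dpow (up \<alpha> k)) p) (G j))"
  by (intro ext) (simp add: face_curl_def)

lemma curl_Phi_fun:
  assumes "F \<in> set faces"
  shows "curl (Phi x (num F) n \<alpha>) = fact (n + 1) *\<^sub>R (real (\<alpha> (num F 1)) *\<^sub>R face_curl \<alpha> (num F 2) (num F 3)
    + real (\<alpha> (num F 2)) *\<^sub>R face_curl \<alpha> (num F 3) (num F 1) + real (\<alpha> (num F 3)) *\<^sub>R face_curl \<alpha> (num F 1) (num F 2))"
  using curl_Phi[where f="num F", OF num_mem[OF assms]] by (intro ext) simp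

lemma curl_E_cell_div_free: "curl ` E_cell x n \<subseteq> div_free"
  unfolding E_cell_curl
  by (rule span_minimal[OF _ subspace_div_free])
    (auto simp: curl_Psi_fun simp del: fact_Suc intro!: subspace_scale[OF subspace_div_free] grad_cross_div_free)

lemma curl_E_face_div_free:
  assumes "F \<in> set faces" shows "curl ` E_face x num rF n F \<subseteq> div_free"
  unfolding E_face_curl[OF assms]
proof (rule span_minimal[OF _ subspace_div_free], rule image_subsetI)
  fix \<alpha>
  show "curl (Phi x (num F) n \<alpha>) \<in> div_free"
    unfolding curl_Phi_fun[OF assms] face_curl_fun
    by (intro subspace_scale[OF subspace_div_free] subspace_add[OF subspace_div_free]
        subspace_diff[OF subspace_div_free] grad_cross_div_free)
qed

lemma V_low_form:
  assumes "v \<in> V_low x" obtains t b where "v = (\<lambda>p. t *\<^sub>R p + b)"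
proof -
  obtain c where c: "v = (\<Sum>l=1..4. c l *\<^sub>R chi x l)"
    using assms unfolding V_low_def by (rule span_familyE) simp
  let ?s = "\<lambda>l. c l * ((-1) ^ l * - vol 2 3 4)"
  have "v = (\<lambda>p. (\<Sum>l=1..4. ?s l) *\<^sub>R p + (- (\<Sum>l=1..4. ?s l *\<^sub>R x l)))"
  proof
    fix p
    have "v p = (\<Sum>l=1..4. ?s l *\<^sub>R p - ?s l *\<^sub>R x l)"
      unfolding c sum_fun_apply scaleR_fun_apply
      by (intro sum.cong refl) (simp only: chi_eq scaleR_scaleR scaleR_diff_right)
    then show "v p = (\<Sum>l=1..4. ?s l) *\<^sub>R p + (- (\<Sum>l=1..4. ?s l *\<^sub>R x l))"
      by (simp only: sum_subtractf scaleR_sum_left add_uminus_conv_diff)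
  qed
  then show ?thesis by (rule that)
qed

text \<open>The coefficients follow \<open>G_combination\<close>, up to the factors from
  \<open>chi_eq\<close>. The radial parts cancel because the gradients sum to 0. This brings the
  curls of \<open>E_low\<close> within reach of \<open>RT_direct\<close>.\<close>

lemma const_in_V_low: "(\<lambda>_. b) \<in> V_low x"
proof -
  have V: "vol 2 3 4 \<noteq> 0" using vol_nonzero[of 3 4 2] by simp
  have "(\<lambda>_. b) = (\<Sum>k=1..4. (G k \<bullet> b / ((-1) ^ k * vol 2 3 4)) *\<^sub>R chi x k)"
  proof
    fix p
    have "(\<Sum>k=1..4. (G k \<bullet> b / ((-1) ^ k * vol 2 3 4)) *\<^sub>R chi x k p) = (\<Sum>k=1..4. (G k \<bullet> b) *\<^sub>R x k - (G k \<bullet> b) *\<^sub>R p)"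
      using V by (intro sum.cong refl) (simp add: chi_eq algebra_simps)
    also have "\<dots> = b - (\<Sum>k=1..4. G k \<bullet> b) *\<^sub>R p"
      by (simp only: sum_subtractf G_combination scaleR_sum_left)
    also have "(\<Sum>k=1..4. G k \<bullet> b) = 0" using sum_G by (simp flip: inner_sum_left)
    finally show "b = (\<Sum>k=1..4. (G k \<bullet> b / ((-1) ^ k * vol 2 3 4)) *\<^sub>R chi x k) p"
      by (simp add: sum_fun_apply)
  qed
  also have "\<dots> \<in> V_low x" unfolding V_low_def by (intro span_sum span_scale span_base imageI)
  finally show ?thesis .
qed

lemma V_low_fields: "V_low x \<subseteq> vec_fields diffable"
  unfolding V_low_def
proof (rule span_minimal[OF image_subsetI subspace_vec_fields[OF subspace_diffable]])
  fix l :: nat assume "l \<in> {1..4}"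
  then have "chi x l = ((-1) ^ l * - vol 2 3 4) *\<^sub>R (\<lambda>p. 1 *\<^sub>R (p - x l))"
    by (intro ext) (simp add: chi_eq)
  also have "\<dots> \<in> vec_fields diffable"
    by (intro subspace_scale subspace_vec_fields subspace_diffable
        scaled_position_fields[where f="\<lambda>_. 1"] diffableI[OF GDERIV_const])
  finally show "chi x l \<in> vec_fields diffable" .
qed

lemma V_cell_fields: "V_cell x rT n \<subseteq> vec_fields diffable"
  unfolding V_cell_def
  by (intro span_minimal subspace_vec_fields subspace_diffable) (auto intro: Upsilon_fields)

lemma E_cell_fields: "E_cell x n \<subseteq> vec_fields diffable"
  unfolding E_cell_def
  by (intro span_minimal subspace_vec_fields subspace_diffable) (auto intro: Psi_fields)

lemma E_face_fields: "F \<in> set faces \<Longrightarrow> E_face x num rF n F \<subseteq> vec_fields diffable"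
  unfolding E_face_def
  by (intro span_minimal subspace_vec_fields subspace_diffable) (auto intro: Phi_fields num_mem)

text \<open>The divergence kills all curls and leaves the constant \<open>3 * t\<close> plus the
  divergence of \<open>w\<close>; both vanish by \<open>divergence_Upsilon_indep\<close>. The
  low-order part is then a constant field, as \<open>boundary_indep\<close> requires. The degree
  \<open>m\<close> of \<open>w\<close> varies independently of \<open>n\<close>, so both kinds of
  decomposition are covered.\<close>

lemma RT_direct:
  assumes v: "v \<in> V_low x" and u: "\<And>F. F \<in> set faces \<Longrightarrow> u F \<in> curl ` E_face x num rF n F"
    and c: "c \<in> curl ` E_cell x (n + 1)" and w: "w \<in> V_cell x rT m"
    and eq: "v + (\<Sum>F\<in>set faces. u F) + c + w = 0"
  shows "v = 0" and "F \<in> set faces \<Longrightarrow> u F = 0" and "c = 0" and "w = 0"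
proof -
  obtain t b where vtb: "v = (\<lambda>p. t *\<^sub>R p + b)" using v by (rule V_low_form)
  obtain d where d: "w = (\<Sum>\<alpha>\<in>indices m - {rT m}. d \<alpha> *\<^sub>R Upsilon x m \<alpha>)"
    using w unfolding V_cell_def by (rule span_familyE) simp
  have dw: "divergence w = (\<Sum>\<alpha>\<in>indices m - {rT m}. d \<alpha> *\<^sub>R divergence (Upsilon x m \<alpha>))"
    unfolding d by (rule linear_op_on_sum[OF divergence_linear Upsilon_fields])
  have uF: "(\<Sum>F\<in>set faces. u F) \<in> div_free"
    using u curl_E_face_div_free by (intro subspace_sum[OF subspace_div_free]) blast
  have c': "c \<in> div_free" using c curl_E_cell_div_free by blast
  have F: "v \<in> vec_fields diffable" "w \<in> vec_fields diffable" "(\<Sum>F\<in>set faces. u F) \<in> vec_fields diffable"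
    "c \<in> vec_fields diffable"
    using v w V_low_fields V_cell_fields uF c' by (auto simp: div_free_def)
  note sub = subspace_add[OF linear_op_on_subspace[OF divergence_linear]]
  have "divergence (v + (\<Sum>F\<in>set faces. u F) + c + w) = divergence v + divergence (\<Sum>F\<in>set faces. u F) + divergence c + divergence w"
    using F by (simp only: linear_op_on_add[OF divergence_linear] sub)
  also have "\<dots> = divergence w + (\<lambda>_. 3 * t)"
    using uF c' unfolding vtb divergence_radial by (simp add: div_free_def add.commute)
  also have "divergence (v + (\<Sum>F\<in>set faces. u F) + c + w) = 0"
    unfolding eq by (rule linear_op_on_0[OF divergence_linear])
  finally have "(\<Sum>\<alpha>\<in>indices m - {rT m}. d \<alpha> *\<^sub>R divergence (Upsilon x m \<alpha>)) + (\<lambda>_. 3 * t) = 0"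
    unfolding dw by (rule sym)
  note div = divergence_Upsilon_indep[OF this]
  have t: "t = 0" using div(1) by simp
  show w0: "w = 0" unfolding d using div(2) by simp
  have "\<forall>F\<in>set faces. \<exists>e. u F = (\<Sum>\<alpha>\<in>Phi_indices n F. e \<alpha> *\<^sub>R curl (Phi x (num F) n \<alpha>))"
  proof
    fix F assume F: "F \<in> set faces"
    have "finite (Phi_indices n F)" by simp
    from span_familyE[OF u[OF F, unfolded E_face_curl[OF F]] this]
    show "\<exists>e. u F = (\<Sum>\<alpha>\<in>Phi_indices n F. e \<alpha> *\<^sub>R curl (Phi x (num F) n \<alpha>))" by blast
  qed
  from bchoice[OF this] obtain e
    where e: "\<And>F. F \<in> set faces \<Longrightarrow> u F = (\<Sum>\<alpha>\<in>Phi_indices n F. e F \<alpha> *\<^sub>R curl (Phi x (num F) n \<alpha>))"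
    by blast
  have "(\<Sum>F\<in>set faces. u F) = (\<Sum>F\<in>set faces. \<Sum>\<alpha>\<in>Phi_indices n F. e F \<alpha> *\<^sub>R curl (Phi x (num F) n \<alpha>))"
    by (intro sum.cong refl e)
  moreover have v': "v = (\<lambda>_. b)" unfolding vtb t by simp
  ultimately have "(\<lambda>_. b) + (\<Sum>F\<in>set faces. \<Sum>\<alpha>\<in>Phi_indices n F. e F \<alpha> *\<^sub>R curl (Phi x (num F) n \<alpha>)) + c = 0"
    using eq unfolding w0 by simp
  note bd = boundary_indep[OF this c]
  show v0: "v = 0" unfolding v' bd(1) by (simp add: zero_fun_def)
  show u0: "u F = 0" if "F \<in> set faces" for F using e[OF that] bd(2)[OF that] by simp
  show "c = 0" using eq u0 unfolding v0 w0 by simp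
qed

section \<open>Directness of the sums of gradients and fields with curl\<close>

lemma omega_fields: "omega x i j \<in> vec_fields diffable"
  unfolding omega_eq[abs_def]
  by (intro diff_vec_fields scaleR_const_vec_fields subspace_diffable bary_diffable)

lemma curl_omega: "curl (omega x i j) p = 2 *\<^sub>R cross3 (G i) (G j)"
proof -
  have "curl (omega x i j) p = cross3 (G i) (G j) - cross3 (G j) (G i)"
    unfolding omega_eq[abs_def]
    by (simp add: curl_diff curl_scaleR scaleR_const_vec_fields subspace_diffable bary_diffable)
  also have "cross3 (G j) (G i) = - cross3 (G i) (G j)" by (rule cross_skew)
  finally show ?thesis by (simp add: scaleR_2)
qed

text \<open>The double cross product expands into the linear part of \<open>omega\<close>, whose
  coordinates are affine by \<open>bary_add\<close>.\<close>

lemma omega_affine: "omega x i j p = omega x i j 0 + cross3 (cross3 (G i) (G j)) p"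
proof -
  have "cross3 (cross3 (G i) (G j)) p = (G i \<bullet> p) *\<^sub>R G j - (G j \<bullet> p) *\<^sub>R G i"
    by (simp add: cross3_simps forall_3)
  then show ?thesis
    using bary_add[of i 0 p] bary_add[of j 0 p] by (simp add: omega_eq scaleR_add_left)
qed

lemma E_low_form:
  assumes "e \<in> E_low x"
  obtains a b where "e = (\<lambda>p. a + cross3 b p)" "curl e = (\<lambda>_. 2 *\<^sub>R b)" "e \<in> vec_fields diffable"
proof -
  have fin: "finite low_edges" using omega_indep by (rule indep_family_finite)
  obtain c where c: "e = (\<Sum>q\<in>low_edges. c q *\<^sub>R (case q of (i, j) \<Rightarrow> omega x i j))"
    using assms fin unfolding E_low_def by (rule span_familyE)
  then have c: "e = (\<Sum>q\<in>low_edges. c q *\<^sub>R omega x (fst q) (snd q))" by (simp add: split_def)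
  let ?a = "\<Sum>q\<in>low_edges. c q *\<^sub>R omega x (fst q) (snd q) 0"
  let ?b = "\<Sum>q\<in>low_edges. c q *\<^sub>R cross3 (G (fst q)) (G (snd q))"
  show ?thesis
  proof (rule that[of ?a ?b])
    show "e = (\<lambda>p. ?a + cross3 ?b p)"
    proof
      fix p
      have "e p = (\<Sum>q\<in>low_edges. c q *\<^sub>R omega x (fst q) (snd q) 0 + c q *\<^sub>R cross3 (cross3 (G (fst q)) (G (snd q))) p)"
        unfolding c sum_fun_apply scaleR_fun_apply
        by (intro sum.cong refl) (subst omega_affine, rule scaleR_add_right)
      then show "e p = ?a + cross3 ?b p"
        by (simp only: sum.distrib cross3_sum_left cross_mult_left)
    qed
    have "curl e = (\<Sum>q\<in>low_edges. c q *\<^sub>R curl (omega x (fst q) (snd q)))"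
      unfolding c by (rule linear_op_on_sum[OF curl_linear omega_fields])
    also have "\<dots> = (\<lambda>_. 2 *\<^sub>R ?b)"
      by (intro ext) (simp add: sum_fun_apply curl_omega scaleR_sum_right mult.commute)
    finally show "curl e = (\<lambda>_. 2 *\<^sub>R ?b)" .
    show "e \<in> vec_fields diffable"
      unfolding c by (intro subspace_sum subspace_scale subspace_vec_fields subspace_diffable omega_fields)
  qed
qed

lemma grad_S_space_closed:
  assumes "s \<in> grad ` S_space x n A" shows "s \<in> vec_fields diffable" "curl s = 0"
proof -
  obtain c where s: "s = (\<Sum>\<alpha>\<in>interior_indices n A. c \<alpha> *\<^sub>R grad (bern x n \<alpha>))"
    using assms unfolding grad_S_space by (rule span_familyE) simp
  have g: "grad (bern x n \<alpha>) = fact n *\<^sub>R grad (dpow \<alpha>)" for \<alpha> by (intro ext) (simp add: grad_bern)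
  have f: "grad (bern x n \<alpha>) \<in> vec_fields diffable" for \<alpha>
    unfolding g by (intro subspace_scale subspace_vec_fields subspace_diffable grad_dpow_fields)
  have "curl (grad (bern x n \<alpha>)) = 0" for \<alpha>
  proof
    fix p show "curl (grad (bern x n \<alpha>)) p = 0 p"
      unfolding g using curl_scale[OF grad_dpow_fields, of "fact n" \<alpha> p]
      by (simp add: scaleR_fun_def curl_grad_dpow)
  qed
  then show "curl s = 0" unfolding s linear_op_on_sum[OF curl_linear f] by simp
  show "s \<in> vec_fields diffable"
    unfolding s by (intro subspace_sum subspace_scale subspace_vec_fields subspace_diffable f)
qed

lemma S_space_diffable: "S_space x n A \<subseteq> diffable"
  unfolding S_space_def by (intro span_minimal subspace_diffable) (auto intro: bern_diffable)

lemma curl_inj_E_face: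
  assumes "\<phi> \<in> E_face x num rF n F" "F \<in> set faces" "curl \<phi> = 0" shows "\<phi> = 0"
proof -
  obtain c where c: "\<phi> = (\<Sum>\<alpha>\<in>Phi_indices n F. c \<alpha> *\<^sub>R Phi x (num F) n \<alpha>)"
    using assms(1) unfolding E_face_def by (rule span_familyE) simp
  have eq: "(\<Sum>\<alpha>\<in>Phi_indices n F. c \<alpha> *\<^sub>R curl (Phi x (num F) n \<alpha>)) = curl \<phi>"
    unfolding c by (rule linear_op_on_sum[OF curl_linear Phi_fields[where f="num F", OF num_mem[OF assms(2)]], symmetric])
  have "c \<alpha> = 0" if "\<alpha> \<in> Phi_indices n F" for \<alpha>
    by (rule indep_familyD[OF curl_Phi_indep[OF assms(2)] eq[unfolded assms(3)] that])
  then show ?thesis unfolding c by simp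
qed

lemma curl_inj_E_cell:
  assumes "\<psi> \<in> E_cell x n" "curl \<psi> = 0" shows "\<psi> = 0"
proof -
  obtain c where c: "\<psi> = (\<Sum>q\<in>Psi_indices n. c q *\<^sub>R (case q of (l, \<alpha>) \<Rightarrow> Psi x n l \<alpha>))"
    using assms(1) unfolding E_cell_def by (rule span_familyE) simp
  have "curl \<psi> = (\<Sum>q\<in>Psi_indices n. c q *\<^sub>R curl (case q of (l, \<alpha>) \<Rightarrow> Psi x n l \<alpha>))"
    unfolding c by (rule linear_op_on_sum[OF curl_linear]) (auto simp: Psi_fields split: prod.split)
  also have "\<dots> = (\<Sum>q\<in>Psi_indices n. c q *\<^sub>R (case q of (l, \<alpha>) \<Rightarrow> curl (Psi x n l \<alpha>)))"
    by (intro sum.cong refl) (simp split: prod.split)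
  finally have "c q = 0" if "q \<in> Psi_indices n" for q
    using indep_familyD[OF curl_Psi_indep _ that, of c] assms(2) by simp
  then show ?thesis unfolding c by simp
qed

text \<open>An affine function is reproduced by interpolation at the four vertices.\<close>

lemma affine_in_S_low: "(\<lambda>p. p \<bullet> a + k) \<in> S_low x"
proof -
  have "(\<lambda>p. p \<bullet> a + k) = (\<Sum>i=1..4. (x i \<bullet> a + k) *\<^sub>R bary x i)"
  proof
    fix p
    have "(\<Sum>i=1..4. (x i \<bullet> a + k) * bary x i p) = (\<Sum>i=1..4. bary x i p *\<^sub>R x i) \<bullet> a + k * (\<Sum>i=1..4. bary x i p)"
      by (simp add: inner_sum_left sum_distrib_left sum.distrib[symmetric] algebra_simps)
    then show "p \<bullet> a + k = (\<Sum>i=1..4. (x i \<bullet> a + k) *\<^sub>R bary x i) p"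
      unfolding bary_combination bary_sum by (simp add: sum_fun_apply)
  qed
  also have "\<dots> \<in> S_low x" unfolding S_low_def by (intro span_sum span_scale span_base imageI)
  finally show ?thesis .
qed

text \<open>The curl turns the relation into one for \<open>RT_direct\<close>, with
  \<open>curl e\<close> as low-order part and \<open>w = 0\<close>. Injectivity of the curl removes
  the face and cell fields, and \<open>e\<close> becomes constant. What is left is a sum of
  gradients, which is integrated and settled by \<open>S_direct\<close>.\<close>

lemma Nedelec_direct:
  assumes e: "e \<in> E_low x" and s: "\<And>A. A \<in> cells \<Longrightarrow> s A \<in> grad ` S_space x M A"
    and \<phi>: "\<And>F. F \<in> set faces \<Longrightarrow> \<phi> F \<in> E_face x num rF m F" and \<psi>: "\<psi> \<in> E_cell x (m + 1)"
    and eq: "e + (\<Sum>A\<in>cells. s A) + (\<Sum>F\<in>set faces. \<phi> F) + \<psi> = 0"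
  shows "e = 0" and "A \<in> cells \<Longrightarrow> s A = 0" and "F \<in> set faces \<Longrightarrow> \<phi> F = 0" and "\<psi> = 0"
proof -
  obtain a b where ab: "e = (\<lambda>p. a + cross3 b p)" "curl e = (\<lambda>_. 2 *\<^sub>R b)" "e \<in> vec_fields diffable"
    using e by (rule E_low_form)
  note sub = linear_op_on_subspace[OF curl_linear]
  have F: "(\<Sum>A\<in>cells. s A) \<in> vec_fields diffable" "(\<Sum>F\<in>set faces. \<phi> F) \<in> vec_fields diffable"
    "\<psi> \<in> vec_fields diffable"
    using subsetD[OF E_cell_fields \<psi>] subsetD[OF E_face_fields \<phi>]
    by (auto intro!: subspace_sum[OF sub] grad_S_space_closed(1)[OF s])
  have "curl (\<Sum>A\<in>cells. s A) = (\<Sum>A\<in>cells. curl (s A))"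
    by (intro linear_op_on_plain_sum[OF curl_linear] grad_S_space_closed(1)[OF s])
  also have "\<dots> = 0" by (intro sum.neutral ballI grad_S_space_closed(2)[OF s])
  finally have cs: "curl (\<Sum>A\<in>cells. s A) = 0" .
  have "curl (e + (\<Sum>A\<in>cells. s A) + (\<Sum>F\<in>set faces. \<phi> F) + \<psi>) =
      curl e + curl (\<Sum>A\<in>cells. s A) + curl (\<Sum>F\<in>set faces. \<phi> F) + curl \<psi>"
    using F ab(3) by (simp only: linear_op_on_add[OF curl_linear] subspace_add[OF sub])
  also have "curl (\<Sum>F\<in>set faces. \<phi> F) = (\<Sum>F\<in>set faces. curl (\<phi> F))"
    using \<phi> E_face_fields by (intro linear_op_on_plain_sum[OF curl_linear]) blast
  finally have "0 = curl e + 0 + (\<Sum>F\<in>set faces. curl (\<phi> F)) + curl \<psi>"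
    unfolding eq cs linear_op_on_0[OF curl_linear] .
  then have c0: "curl e + (\<Sum>F\<in>set faces. curl (\<phi> F)) + curl \<psi> + 0 = 0"
    unfolding add_0_right by (rule sym)
  have "curl e \<in> V_low x" unfolding ab(2) by (rule const_in_V_low)
  moreover have "(0 :: real^3 \<Rightarrow> real^3) \<in> V_cell x rT 0" unfolding V_cell_def by (rule span_zero)
  ultimately have rt: "curl e = 0" "\<And>F. F \<in> set faces \<Longrightarrow> curl (\<phi> F) = 0" "curl \<psi> = 0"
    using RT_direct[where v="curl e" and u="\<lambda>F. curl (\<phi> F)" and c="curl \<psi>" and w=0 and n=m and m=0]
      \<phi> \<psi> c0 by blast+
  show \<phi>0: "\<phi> F = 0" if "F \<in> set faces" for F using curl_inj_E_face[OF \<phi> that rt(2)] that by blast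
  show \<psi>0: "\<psi> = 0" using curl_inj_E_cell[OF \<psi> rt(3)] .
  have "b = 0" using fun_cong[OF rt(1), of 0] unfolding ab(2) by simp
  then have ea: "e = (\<lambda>_. a)" unfolding ab(1) by simp
  have "\<forall>A\<in>cells. \<exists>u. u \<in> S_space x M A \<and> s A = grad u" using s by blast
  then obtain u where u: "\<And>A. A \<in> cells \<Longrightarrow> u A \<in> S_space x M A" "\<And>A. A \<in> cells \<Longrightarrow> s A = grad (u A)" by metis
  \<comment> \<open>A potential of the constant field \<open>e\<close>.\<close>
  let ?l = "\<lambda>p. p \<bullet> a"
  have ud: "u A \<in> diffable" if "A \<in> cells" for A using u(1)[OF that] S_space_diffable by blast
  have sd: "(\<Sum>A\<in>cells. u A) \<in> diffable" by (intro subspace_sum subspace_diffable ud)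
  have ld: "?l \<in> diffable" by (rule diffableI[OF GDERIV_inner])
  have gl: "grad ?l = (\<lambda>_. a)" by (intro ext grad_eqI GDERIV_inner)
  have "grad ((\<Sum>A\<in>cells. u A) + ?l) = (\<Sum>A\<in>cells. grad (u A)) + (\<lambda>_. a)"
  proof -
    have "grad (\<Sum>A\<in>cells. u A) = (\<Sum>A\<in>cells. grad (u A))"
      by (intro linear_op_on_plain_sum[OF grad_linear] ud)
    then show ?thesis unfolding linear_op_on_add[OF grad_linear sd ld] gl by (simp only:)
  qed
  also have "\<dots> = 0" using eq \<phi>0 \<psi>0 u(2) ea by (simp add: add.commute)
  finally obtain k where k: "(\<Sum>A\<in>cells. u A) + ?l = (\<lambda>_. k)"
    using constant_if_grad_eq_0[OF subspace_add[OF subspace_diffable sd ld]] by blast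
  \<comment> \<open>The constant of integration joins the potential, so that the affine function can
    play the low-order part in \<open>S_direct\<close>.\<close>
  have "(\<lambda>p. p \<bullet> a + (- k)) + (\<Sum>A\<in>cells. u A) = 0"
  proof
    fix p show "((\<lambda>p. p \<bullet> a + (- k)) + (\<Sum>A\<in>cells. u A)) p = 0 p"
      using fun_cong[OF k, of p] by simp
  qed
  from S_direct[OF affine_in_S_low u(1) this]
  have S: "(\<lambda>p. p \<bullet> a + (- k)) = 0" "\<And>A. A \<in> cells \<Longrightarrow> u A = 0" by blast+
  show "s A = 0" if "A \<in> cells" for A
    using S(2)[OF that] u(2)[OF that] linear_op_on_0[OF grad_linear] by simp
  have "k = 0" using fun_cong[OF S(1), of 0] by simp
  then have "a \<bullet> a = 0" using fun_cong[OF S(1), of a] by simp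
  then show "e = 0" unfolding ea by (simp add: zero_fun_def)
qed

end

section \<open>Dimensions\<close>

text \<open>A relation that carries a finite basis along, since \<open>direct_sum_dims\<close> joins
  bases of the summands.\<close>

definition fin_dim :: "'v::real_vector set \<Rightarrow> nat \<Rightarrow> bool" where
  "fin_dim V d \<longleftrightarrow> (\<exists>B. finite B \<and> independent B \<and> span B = V \<and> card B = d)"

lemma fin_dim_family: "indep_family f I \<Longrightarrow> fin_dim (span (f ` I)) (card I)"
  unfolding fin_dim_def
  by (intro exI[of _ "f ` I"])
    (simp add: indep_family_finite indep_family_independent card_image indep_family_inj)

text \<open>Directness makes the joined bases of the summands independent, after which the count is
  that of \<open>direct_sum_basis\<close>.\<close>

lemma direct_sum_dims:
  fixes V :: "'j \<Rightarrow> 'v::real_vector set"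
  assumes L: "distinct L"
    and dim: "\<And>j. j \<in> set L \<Longrightarrow> fin_dim (V j) (d j)"
    and dir: "\<And>v j. \<lbrakk>\<And>j. j \<in> set L \<Longrightarrow> v j \<in> V j; (\<Sum>j\<in>set L. v j) = 0; j \<in> set L\<rbrakk> \<Longrightarrow> v j = 0"
    and sub: "subspace W"
    and in_W: "\<And>j. j \<in> set L \<Longrightarrow> V j \<subseteq> W"
    and C: "finite C" "W \<subseteq> span C" "card C \<le> sum_list (map d L)"
  shows "direct_sum (map V L) W"
proof -
  from dim have "\<forall>j\<in>set L. \<exists>B. finite B \<and> independent B \<and> span B = V j \<and> card B = d j"
    unfolding fin_dim_def by blast
  from bchoice[OF this] obtain B where B: "\<And>j. j \<in> set L \<Longrightarrow> finite (B j)"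
    "\<And>j. j \<in> set L \<Longrightarrow> independent (B j)" "\<And>j. j \<in> set L \<Longrightarrow> span (B j) = V j"
    "\<And>j. j \<in> set L \<Longrightarrow> card (B j) = d j" by blast
  have ind: "indep_family (\<lambda>(j, b). b) (SIGMA j:set L. B j)"
    unfolding indep_family_def
  proof (intro conjI allI impI ballI)
    show "finite (SIGMA j:set L. B j)" using B(1) by (intro finite_SigmaI) auto
    fix c q assume 0: "(\<Sum>q\<in>(SIGMA j:set L. B j). c q *\<^sub>R (case q of (j, b) \<Rightarrow> b)) = 0"
      and q: "q \<in> (SIGMA j:set L. B j)"
    obtain j b where jb: "q = (j, b)" "j \<in> set L" "b \<in> B j" using q by blast
    define v where "v = (\<lambda>j. \<Sum>b\<in>B j. c (j, b) *\<^sub>R b)"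
    have "(\<Sum>j\<in>set L. v j) = (\<Sum>q\<in>(SIGMA j:set L. B j). c q *\<^sub>R (case q of (j, b) \<Rightarrow> b))"
      unfolding v_def using B(1) by (subst sum.Sigma) (auto intro!: sum.cong)
    then have s0: "(\<Sum>j\<in>set L. v j) = 0" unfolding 0 .
    have mem: "v j \<in> V j" if "j \<in> set L" for j
      unfolding v_def B(3)[OF that, symmetric] by (intro span_sum span_scale span_base)
    have "v j = 0" by (rule dir[of v j, OF _ s0 jb(2)]) (rule mem)
    then have "(\<Sum>b\<in>B j. c (j, b) *\<^sub>R b) = 0" unfolding v_def .
    from independentD[OF B(2)[OF jb(2)] B(1)[OF jb(2)] subset_refl this jb(3)]
    show "c q = 0" unfolding jb(1) .
  qed
  have "direct_sum (map (\<lambda>j. span ((\<lambda>b. b) ` B j)) L) W"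
  proof (rule direct_sum_basis[OF L ind sub _ C(1,2) _ B(1)])
    show "i \<in> W" if "j \<in> set L" "i \<in> B j" for j i
      using in_W[OF that(1)] span_base[OF that(2)] B(3)[OF that(1)] by blast
    show "card C \<le> (\<Sum>j\<in>set L. card (B j))"
      using C(3) L B(4) by (simp add: sum_list_distinct_conv_sum_set)
  qed simp_all
  moreover have "map (\<lambda>j. span ((\<lambda>b. b) ` B j)) L = map V L"
    by (intro map_cong refl) (simp add: B(3))
  ultimately show ?thesis by (simp only:)
qed

lemma direct_sum_single: "subspace U \<Longrightarrow> direct_sum [U] U"
  unfolding direct_sum_def by (auto simp: bij_betw_def inj_on_def image_image)

lemma direct_sum_pair:
  assumes U: "subspace U" and V: "subspace V"
    and 0: "\<And>u v. u \<in> U \<Longrightarrow> v \<in> V \<Longrightarrow> u + v = 0 \<Longrightarrow> v = 0"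
  shows "direct_sum [U, V] {u + v | u v. u \<in> U \<and> v \<in> V}"
proof -
  let ?V = "\<lambda>b. if b then U else V"
  have "direct_sum (map ?V [True, False]) {u + v | u v. u \<in> U \<and> v \<in> V}"
  proof (rule direct_sum_map)
    show "subspace (?V j)" for j using U V by simp
    show "v j = 0" if "\<And>j. j \<in> set [True, False] \<Longrightarrow> v j \<in> ?V j" "(\<Sum>j\<in>set [True, False]. v j) = 0"
      for v :: "bool \<Rightarrow> 'a" and j
    proof -
      have uv: "v True \<in> U" "v False \<in> V" "v True + v False = 0" using that(1)[of True] that(1)[of False] that(2) by simp_all
      then have "v False = 0" using 0 by blast
      then show ?thesis using uv by (cases j) simp_all
    qed
    show "{u + v | u v. u \<in> U \<and> v \<in> V} = {\<Sum>j\<in>set [True, False]. v j | v. \<forall>j\<in>set [True, False]. v j \<in> ?V j}"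
    proof (intro set_eqI iffI)
      fix w assume "w \<in> {u + v | u v. u \<in> U \<and> v \<in> V}"
      then obtain u v where "w = u + v" "u \<in> U" "v \<in> V" by blast
      then show "w \<in> {\<Sum>j\<in>set [True, False]. v j | v. \<forall>j\<in>set [True, False]. v j \<in> ?V j}"
        by (intro CollectI exI[of _ "\<lambda>b. if b then u else v"]) simp
    qed auto
  qed simp
  then show ?thesis by simp
qed

section \<open>Counting multi-indices\<close>

definition compositions :: "nat set \<Rightarrow> nat \<Rightarrow> (nat \<Rightarrow> nat) set" where
  "compositions A n = {\<alpha>. (\<forall>i. i \<notin> A \<longrightarrow> \<alpha> i = 0) \<and> (\<Sum>i\<in>A. \<alpha> i) = n}"

lemma compositions_0: "finite A \<Longrightarrow> compositions A 0 = {\<lambda>_. 0}"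
  by (auto simp: compositions_def fun_eq_iff)

lemma compositions_singleton: "compositions {a} n = {\<lambda>i. if i = a then n else 0}"
  by (auto simp: compositions_def fun_eq_iff)

text \<open>The entry at \<open>a\<close> is 0 or can be lowered by one; on cardinalities this is
  Pascal's recursion.\<close>

lemma compositions_insert:
  assumes "finite A" "a \<notin> A"
  shows "compositions (insert a A) (Suc n) =
    compositions A (Suc n) \<union> (\<lambda>\<alpha>. \<alpha>(a := Suc (\<alpha> a))) ` compositions (insert a A) n"
proof (intro set_eqI iffI)
  fix \<alpha> assume \<alpha>: "\<alpha> \<in> compositions (insert a A) (Suc n)"
  show "\<alpha> \<in> compositions A (Suc n) \<union> (\<lambda>\<alpha>. \<alpha>(a := Suc (\<alpha> a))) ` compositions (insert a A) n"
  proof (cases "\<alpha> a")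
    case 0
    have "\<alpha> i = 0" if "i \<notin> A" for i
      using \<alpha> 0 that by (cases "i = a") (auto simp: compositions_def)
    then show ?thesis using \<alpha> 0 assms by (auto simp: compositions_def)
  next
    case (Suc k)
    have "(\<Sum>i\<in>A. if i = a then k else \<alpha> i) = (\<Sum>i\<in>A. \<alpha> i)" using assms by (intro sum.cong) auto
    then have "\<alpha>(a := k) \<in> compositions (insert a A) n"
      using \<alpha> Suc assms by (auto simp: compositions_def)
    moreover have "\<alpha> = (\<alpha>(a := k))(a := Suc ((\<alpha>(a := k)) a))" using Suc by auto
    ultimately show ?thesis by blast
  qed
next
  fix \<alpha> assume "\<alpha> \<in> compositions A (Suc n) \<union> (\<lambda>\<alpha>. \<alpha>(a := Suc (\<alpha> a))) ` compositions (insert a A) n"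
  then show "\<alpha> \<in> compositions (insert a A) (Suc n)"
  proof
    assume "\<alpha> \<in> compositions A (Suc n)"
    then show ?thesis using assms by (auto simp: compositions_def)
  next
    assume "\<alpha> \<in> (\<lambda>\<alpha>. \<alpha>(a := Suc (\<alpha> a))) ` compositions (insert a A) n"
    then obtain \<beta> where b: "\<beta> \<in> compositions (insert a A) n" "\<alpha> = \<beta>(a := Suc (\<beta> a))" by blast
    have "(\<Sum>i\<in>A. if i = a then Suc (\<beta> a) else \<beta> i) = (\<Sum>i\<in>A. \<beta> i)" using assms by (intro sum.cong) auto
    then show ?thesis using b assms by (auto simp: compositions_def)
  qed
qed

lemma card_compositions:
  assumes "finite A" "A \<noteq> {}"
  shows "finite (compositions A n) \<and> card (compositions A n) = (n + card A - 1) choose (card A - 1)"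
  using assms
proof (induction A arbitrary: n rule: finite_ne_induct)
  case (singleton a)
  then show ?case by (simp add: compositions_singleton)
next
  case (insert a A)
  show ?case
  proof (induction n)
    case 0
    show ?case using insert.hyps by (simp add: compositions_0)
  next
    case (Suc n)
    have inj: "inj_on (\<lambda>\<alpha> :: nat \<Rightarrow> nat. \<alpha>(a := Suc (\<alpha> a))) S" for S
    proof (rule inj_onI, rule ext)
      fix \<alpha> \<beta> :: "nat \<Rightarrow> nat" and i
      assume "\<alpha>(a := Suc (\<alpha> a)) = \<beta>(a := Suc (\<beta> a))"
      from fun_cong[OF this, of i] show "\<alpha> i = \<beta> i" by (auto split: if_splits)
    qed
    have disj: "compositions A (Suc n) \<inter> (\<lambda>\<alpha>. \<alpha>(a := Suc (\<alpha> a))) ` compositions (insert a A) n = {}"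
      using insert.hyps by (auto simp: compositions_def)
    obtain k where k: "card A = Suc k" using insert.hyps by (metis card_0_eq not0_implies_Suc)
    have "card (compositions (insert a A) (Suc n)) = card (compositions A (Suc n)) + card (compositions (insert a A) n)"
      unfolding compositions_insert[OF insert.hyps(1,3)]
      using disj insert.IH[of "Suc n"] Suc by (subst card_Un_disjoint) (auto simp: card_image[OF inj])
    also have "\<dots> = (Suc n + card (insert a A) - 1) choose (card (insert a A) - 1)"
      using insert.IH[of "Suc n"] Suc insert.hyps by (simp add: k)
    finally show ?case
      using compositions_insert[OF insert.hyps(1,3), of n] insert.IH[of "Suc n"] Suc by simp
  qed
qed

lemma face_indices_compositions: "F \<subseteq> {1..4} \<Longrightarrow> face_indices n F = compositions F n"
proof -
  assume F: "F \<subseteq> {1..4}"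
  have "(\<Sum>i=1..4. \<alpha> i) = (\<Sum>i\<in>F. \<alpha> i)" if "\<forall>i. i \<notin> F \<longrightarrow> \<alpha> i = 0" for \<alpha> :: "nat \<Rightarrow> nat"
    using F that by (intro sum.mono_neutral_right) auto
  moreover have "\<alpha> \<in> face_indices n F \<longleftrightarrow> (\<forall>i. i \<notin> F \<longrightarrow> \<alpha> i = 0) \<and> (\<Sum>i=1..4. \<alpha> i) = n" for \<alpha>
    using F by (auto simp: face_indices_def indices_def subset_iff)
  ultimately show ?thesis by (auto simp: compositions_def)
qed

lemma card_face_indices:
  assumes "F \<subseteq> {1..4}" "F \<noteq> {}"
  shows "card (face_indices n F) = (n + card F - 1) choose (card F - 1)"
  using card_compositions[of F n] assms finite_subset[OF assms(1)]
  by (simp add: face_indices_compositions)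

text \<open>Subtracting 1 from every entry leaves an arbitrary index of degree
  \<open>Suc n - card A\<close>. If \<open>card A\<close> exceeds \<open>Suc n\<close>, both sides
  are 0.\<close>

lemma card_interior_indices:
  assumes "A \<subseteq> {1..4}" "A \<noteq> {}"
  shows "card (interior_indices (Suc n) A) = n choose (card A - 1)"
proof -
  have fin: "finite A" using assms(1) finite_subset by blast
  have int: "\<alpha> \<in> interior_indices (Suc n) A \<longleftrightarrow> \<alpha> \<in> compositions A (Suc n) \<and> (\<forall>i\<in>A. \<alpha> i > 0)" for \<alpha>
    unfolding face_indices_compositions[OF assms(1), symmetric] using assms(1)
    by (auto simp: interior_indices_def face_indices_def split: if_splits)
  show ?thesis
  proof (cases "card A \<le> Suc n")
    case True
    let ?f = "\<lambda>(\<alpha> :: nat \<Rightarrow> nat) i. if i \<in> A then \<alpha> i + 1 else 0"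
    have pred: "0 < m \<Longrightarrow> m - 1 + 1 = m" for m :: nat by simp
    have s: "(\<Sum>i\<in>A. \<alpha> i + 1) = (\<Sum>i\<in>A. \<alpha> i) + card A" for \<alpha> :: "nat \<Rightarrow> nat" by (simp add: sum.distrib)
    have s': "(\<Sum>i\<in>A. \<alpha> i - 1) + card A = (\<Sum>i\<in>A. \<alpha> i)" if "\<forall>i\<in>A. \<alpha> i > 0" for \<alpha> :: "nat \<Rightarrow> nat"
      unfolding s[symmetric] using that by (intro sum.cong) auto
    have "bij_betw ?f (compositions A (Suc n - card A)) (interior_indices (Suc n) A)"
    proof (rule bij_betw_byWitness[where f' = "\<lambda>\<alpha> i. \<alpha> i - 1"])
      show "?f ` compositions A (Suc n - card A) \<subseteq> interior_indices (Suc n) A"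
        using True s by (auto simp: int compositions_def)
      show "(\<lambda>\<alpha> i. \<alpha> i - 1) ` interior_indices (Suc n) A \<subseteq> compositions A (Suc n - card A)"
      proof (rule image_subsetI)
        fix \<alpha> assume "\<alpha> \<in> interior_indices (Suc n) A"
        then show "(\<lambda>i. \<alpha> i - 1) \<in> compositions A (Suc n - card A)"
          using s'[of \<alpha>] by (auto simp: int compositions_def)
      qed
    qed (auto simp: int compositions_def fun_eq_iff pred)
    then have "card (interior_indices (Suc n) A) = card (compositions A (Suc n - card A))"
      by (simp add: bij_betw_same_card)
    also have "\<dots> = (Suc n - card A + card A - 1) choose (card A - 1)"
      using card_compositions[OF fin assms(2)] by blast
    also have "Suc n - card A + card A - 1 = n" using True by simp
    finally show ?thesis .
  next
    case False
    have "interior_indices (Suc n) A = {}"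
    proof (rule ccontr)
      assume "interior_indices (Suc n) A \<noteq> {}"
      then obtain \<alpha> where "(\<Sum>i\<in>A. \<alpha> i) = Suc n" "\<forall>i\<in>A. \<alpha> i > 0" by (auto simp: int compositions_def)
      moreover from this(2) have "(\<Sum>i\<in>A. 1) \<le> (\<Sum>i\<in>A. \<alpha> i)" by (intro sum_mono) (auto simp: Suc_le_eq)
      ultimately show False using False by simp
    qed
    then show ?thesis using False by simp
  qed
qed

lemma card_indices: "card (indices n) = (n + 3) choose 3"
  using card_face_indices[of "{1..4}" n] by (simp add: face_indices_full add.commute)

lemma cells_nonempty: "A \<in> cells \<Longrightarrow> A \<noteq> {}"
  by (auto simp: edges_def faces_def)

lemma card_edge: "E \<in> set edges \<Longrightarrow> card E = 2"
  by (auto simp: edges_def)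

lemma card_face: "F \<in> set faces \<Longrightarrow> card F = 3"
  by (auto simp: faces_def)

lemma card_interior_edge: "E \<in> set edges \<Longrightarrow> card (interior_indices (Suc n) E) = n"
  using card_interior_indices[of E n] cells_bounds(1)[of E] cells_nonempty[of E] card_edge[of E] by auto

lemma card_interior_face: "F \<in> set faces \<Longrightarrow> card (interior_indices (Suc n) F) = n choose 2"
  using card_interior_indices[of F n] cells_bounds(1)[of F] cells_nonempty[of F] card_face[of F] by auto

lemma card_interior_cell: "card (interior_indices (Suc n) {1..4}) = n choose 3"
  using card_interior_indices[of "{1..4}" n] by simp

lemma card_face_indices_face: "F \<in> set faces \<Longrightarrow> card (face_indices n F) = (n + 2) choose 2"
  using card_face_indices[of F n] cells_bounds(1)[of F] cells_nonempty[of F] card_face[of F] by auto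

text \<open>Setting the entry 1 at vertex 3 to 0 matches the indices for \<open>l = 3\<close> with
  the interior indices of the face \<open>{1, 2, 4}\<close> one degree lower.\<close>

lemma card_Psi_indices: "card (Psi_indices (Suc n)) = 2 * (Suc n choose 3) + (n choose 2)"
proof -
  let ?I = "interior_indices (Suc (Suc n)) {1..4}"
  have i: "{1..4} = {1, 2, 3, 4::nat}" by auto
  have P: "Psi_indices (Suc n) = {1, 2} \<times> ?I \<union> Pair 3 ` {\<alpha>\<in>?I. \<alpha> 3 = 1}"
    by (auto simp: Psi_indices_def simp flip: Suc_eq_plus1)
  have "bij_betw (\<lambda>\<alpha>. \<alpha>(3 := 0)) {\<alpha>\<in>?I. \<alpha> 3 = 1} (interior_indices (Suc n) {1, 2, 4})"
    by (rule bij_betw_byWitness[where f' = "\<lambda>\<alpha>. \<alpha>(3 := 1)"])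
      (auto simp: interior_indices_def indices_def i fun_eq_iff)
  then have "card {\<alpha>\<in>?I. \<alpha> 3 = 1} = card (interior_indices (Suc n) {1, 2, 4})"
    by (rule bij_betw_same_card)
  also have "\<dots> = n choose 2" by (rule card_interior_face) (simp add: faces_def)
  finally have 1: "card {\<alpha>\<in>?I. \<alpha> 3 = 1} = n choose 2" .
  have "card (Psi_indices (Suc n)) = card ({1, 2::nat} \<times> ?I) + card (Pair (3::nat) ` {\<alpha>\<in>?I. \<alpha> 3 = 1})"
    unfolding P by (rule card_Un_disjoint) auto
  also have "card (Pair (3::nat) ` {\<alpha>\<in>?I. \<alpha> 3 = 1}) = n choose 2"
    unfolding 1[symmetric] by (rule card_image) (simp add: inj_on_def)
  also have "card ({1, 2::nat} \<times> ?I) = 2 * (Suc n choose 3)"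
    by (simp add: card_cartesian_product card_interior_cell)
  finally show ?thesis .
qed

section \<open>Binomial identities for the dimension counts\<close>

lemma real_choose_2: "real (n choose 2) = real n * (real n - 1) / 2"
proof (induction n)
  case (Suc n)
  have "Suc n choose 2 = n + (n choose 2)" by (simp add: numeral_2_eq_2)
  then show ?case using Suc by (simp add: field_simps)
qed simp

lemma real_choose_3: "real (n choose 3) = real n * (real n - 1) * (real n - 2) / 6"
proof (induction n)
  case (Suc n)
  have "Suc n choose 3 = (n choose 2) + (n choose 3)" by (simp add: numeral_2_eq_2 numeral_3_eq_3)
  then show ?case using Suc by (simp add: real_choose_2 field_simps)
qed simp

text \<open>A positive binomial keeps the natural subtraction exact, so the counts become polynomial
  identities over the reals.\<close>

lemma real_choose_2_minus: "m \<ge> 2 \<Longrightarrow> real ((m choose 2) - 1) = real m * (real m - 1) / 2 - 1"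
  using zero_less_binomial[of 2 m] by (subst of_nat_diff) (simp_all add: real_choose_2 Suc_le_eq One_nat_def)

lemma real_choose_3_minus:
  "m \<ge> 3 \<Longrightarrow> real ((m choose 3) - 1) = real m * (real m - 1) * (real m - 2) / 6 - 1"
  using zero_less_binomial[of 3 m] by (subst of_nat_diff) (simp_all add: real_choose_3 Suc_le_eq One_nat_def)

lemmas real_choose = real_choose_2 real_choose_3 real_choose_2_minus real_choose_3_minus

text \<open>In the \<open>dim_count\<close> lemmas the left side adds the sizes of the bases,
  starting with the low-order space, and the right side is a bound for a generating set of the
  polynomial space. The polynomial degree is \<open>Suc n\<close> where the decomposition needs
  degree at least 1.\<close>

lemma dim_count_S: "4 + 6 * n + 4 * (n choose 2) + (n choose 3) = (Suc n + 3) choose 3"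
proof -
  have "real (4 + 6 * n + 4 * (n choose 2) + (n choose 3)) = real ((Suc n + 3) choose 3)"
    by (simp add: real_choose field_simps)
  then show ?thesis by (simp only: of_nat_eq_iff)
qed

lemma dim_count_N1:
  "6 + 6 * n + 4 * ((n choose 2) + ((n + 2 choose 2) - 1)) + (n choose 3) + (2 * (Suc n choose 3) + (n choose 2))
   = 3 * ((n + 3) choose 3) + (2 * ((n + 2) choose 2) + (n + 1))" (is "?l = ?r")
proof -
  have "real ?l = real ?r" by (simp add: real_choose field_simps)
  then show ?thesis by (simp only: of_nat_eq_iff)
qed

lemma dim_count_N2:
  "6 + 6 * Suc n + 4 * ((Suc n choose 2) + ((n + 2 choose 2) - 1)) + (Suc n choose 3) + (2 * (Suc n choose 3) + (n choose 2))
   = 3 * ((Suc n + 3) choose 3)" (is "?l = ?r")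
proof -
  have "real ?l = real ?r" by (simp add: real_choose field_simps)
  then show ?thesis by (simp only: of_nat_eq_iff)
qed

lemma dim_count_RT1:
  "4 + 4 * ((n + 2 choose 2) - 1) + (2 * (Suc n choose 3) + (n choose 2)) + ((n + 3 choose 3) - 1)
   = 3 * ((n + 3) choose 3) + ((n + 2) choose 2)" (is "?l = ?r")
proof -
  have "real ?l = real ?r" by (simp add: real_choose field_simps)
  then show ?thesis by (simp only: of_nat_eq_iff)
qed

lemma dim_count_RT2:
  "4 + 4 * ((Suc n + 2 choose 2) - 1) + (2 * (Suc (Suc n) choose 3) + (Suc n choose 2)) + ((n + 3 choose 3) - 1)
   = 3 * ((Suc n + 3) choose 3)" (is "?l = ?r")
proof -
  have "real ?l = real ?r" by (simp add: real_choose field_simps)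
  then show ?thesis by (simp only: of_nat_eq_iff)
qed

section \<open>The polynomial spaces of vector fields\<close>

definition hom_exponents :: "nat \<Rightarrow> (nat \<times> nat \<times> nat) set" where
  "hom_exponents n = {(a, b, c). a + b + c = n}"

lemma finite_hom_exponents [simp]: "finite (hom_exponents n)"
  by (rule finite_subset[of _ "{..n} \<times> {..n} \<times> {..n}"]) (auto simp: hom_exponents_def)

lemma card_hom_exponents: "card (hom_exponents n) = (n + 2) choose 2"
proof -
  have "bij_betw (\<lambda>\<alpha>. (\<alpha> 1, \<alpha> 2, \<alpha> 3)) (compositions {1, 2, 3} n) (hom_exponents n)"
    by (rule bij_betw_byWitness[where f' = "\<lambda>(a, b, c) i. if i = 1 then a else if i = 2 then b else if i = 3 then c else 0"])
      (auto simp: compositions_def hom_exponents_def fun_eq_iff)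
  then have "card (hom_exponents n) = card (compositions {1, 2, 3} n)"
    by (simp add: bij_betw_same_card)
  also have "\<dots> = (n + 2) choose 2"
    using card_compositions[of "{1, 2, 3}" n] by simp
  finally show ?thesis .
qed

lemma hom_polys_eq: "hom_polys n = span (monomial3 ` hom_exponents n)"
  by (simp add: hom_polys_def hom_exponents_def)

lemma subspace_hom_polys: "subspace (hom_polys n)"
  by (simp add: hom_polys_def)

lemma hom_polys_subset: "hom_polys n \<subseteq> polys n"
  unfolding hom_polys_def polys_def by (intro span_mono image_mono) auto

lemma hom_polys_homogeneous:
  assumes "g \<in> hom_polys n" shows "g (t *\<^sub>R p) = t ^ n * g p"
  using assms unfolding hom_polys_def
proof (rule span_induct)
  show "subspace {g. g (t *\<^sub>R p) = t ^ n * g p}"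
    by (auto simp: subspace_def algebra_simps)
  show "g (t *\<^sub>R p) = t ^ n * g p" if "g \<in> monomial3 ` {(a, b, c). a + b + c = n}" for g
    using that by (auto simp: monomial3_def power_mult_distrib power_add mult_ac)
qed

lemma polys_along_line:
  assumes "f \<in> polys n"
  shows "\<exists>P. degree P \<le> n \<and> (\<forall>t. f (t *\<^sub>R p) = poly P t)"
  using assms unfolding polys_def
proof (rule span_induct)
  show "subspace {f. \<exists>P. degree P \<le> n \<and> (\<forall>t. f (t *\<^sub>R p) = poly P t)}"
    unfolding subspace_def
  proof (intro conjI ballI allI)
    show "0 \<in> {f. \<exists>P. degree P \<le> n \<and> (\<forall>t. f (t *\<^sub>R p) = poly P t)}"
      by (auto intro!: exI[of _ 0])
    fix f assume "f \<in> {f. \<exists>P. degree P \<le> n \<and> (\<forall>t. f (t *\<^sub>R p) = poly P t)}"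
    then obtain P where P: "degree P \<le> n" "\<And>t. f (t *\<^sub>R p) = poly P t" by blast
    { fix g assume "g \<in> {f. \<exists>P. degree P \<le> n \<and> (\<forall>t. f (t *\<^sub>R p) = poly P t)}"
      then obtain Q where "degree Q \<le> n" "\<And>t. g (t *\<^sub>R p) = poly Q t" by blast
      then show "f + g \<in> {f. \<exists>P. degree P \<le> n \<and> (\<forall>t. f (t *\<^sub>R p) = poly P t)}"
        using P by (intro CollectI exI[of _ "P + Q"]) (simp add: degree_add_le) }
    fix c :: real
    show "c *\<^sub>R f \<in> {f. \<exists>P. degree P \<le> n \<and> (\<forall>t. f (t *\<^sub>R p) = poly P t)}"
      using P by (intro CollectI exI[of _ "smult c P"]) (simp add: order_trans[OF degree_smult_le])
  qed
  show "\<exists>P. degree P \<le> n \<and> (\<forall>t. f (t *\<^sub>R p) = poly P t)"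
    if f: "f \<in> monomial3 ` {(a, b, c). a + b + c \<le> n}" for f
  proof -
    obtain a b c where "a + b + c \<le> n" "f = monomial3 (a, b, c)" using f by blast
    then show ?thesis
      by (intro exI[of _ "monom (f p) (a + b + c)"])
        (simp add: degree_monom_eq order_trans[OF degree_monom_le] poly_monom monomial3_def
          power_mult_distrib power_add mult_ac)
  qed
qed

text \<open>Along the line through the origin and \<open>p\<close>, the coefficient of
  \<open>t ^ Suc n\<close> comes from \<open>g\<close> alone, because \<open>f\<close> has degree at
  most \<open>n\<close> there.\<close>

lemma polys_plus_homogeneous:
  assumes f: "f \<in> polys n" and g: "\<And>t p. g (t *\<^sub>R p) = t ^ Suc n * g p"
    and 0: "\<And>p. f p + g p = 0"
  shows "g p = 0"
proof -
  obtain P where P: "degree P \<le> n" "\<And>t. f (t *\<^sub>R p) = poly P t" using polys_along_line[OF f] by blast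
  have "poly (P + monom (g p) (Suc n)) t = 0" for t
    using 0[of "t *\<^sub>R p"] unfolding g P(2) by (simp add: poly_monom mult_ac)
  then have "P + monom (g p) (Suc n) = 0" by (simp add: poly_all_0_iff_0[symmetric])
  then have "coeff (P + monom (g p) (Suc n)) (Suc n) = 0" by simp
  moreover have "coeff P (Suc n) = 0" using P(1) by (intro coeff_eq_0) simp
  ultimately show ?thesis by simp
qed

lemma cross_field_linear: "linear (\<lambda>(q :: real^3 \<Rightarrow> real^3) p. cross3 p (q p))"
  by (rule linearI) (auto simp: cross_add_right cross_mult_right fun_eq_iff)

lemma radial_field_linear: "linear (\<lambda>(q :: real^3 \<Rightarrow> real) p. q p *\<^sub>R p)"
  by (rule linearI) (auto simp: scaleR_add_left fun_eq_iff)

lemma scaleR_field_linear: "linear (\<lambda>(q :: real^3 \<Rightarrow> real) p. q p *\<^sub>R (w :: real^3))"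
  by (rule linearI) (auto simp: scaleR_add_left fun_eq_iff)

lemma subspace_x_cross_hom: "subspace (x_cross_hom n)"
  unfolding x_cross_hom_def
  by (intro linear_subspace_image cross_field_linear subspace_vec_fields subspace_hom_polys)

lemma subspace_x_times_hom: "subspace (x_times_hom n)"
  unfolding x_times_hom_def
  by (intro linear_subspace_image radial_field_linear subspace_hom_polys)

lemma polys_hom_direct:
  assumes "u \<in> vec_fields (polys n)" "\<And>t p. v (t *\<^sub>R p) = t ^ Suc n *\<^sub>R v p" "u + v = 0"
  shows "v = 0"
proof -
  have "v p $ i = 0" for p i
  proof (rule polys_plus_homogeneous[where g="\<lambda>p. v p $ i" and f="\<lambda>p. u p $ i" and n=n])
    show "(\<lambda>p. u p $ i) \<in> polys n" using assms(1) by (simp add: vec_fields_def)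
    show "v (t *\<^sub>R p) $ i = t ^ Suc n * v p $ i" for t p by (simp add: assms(2))
    show "u p $ i + v p $ i = 0" for p using fun_cong[OF assms(3), of p] by (simp add: vec_eq_iff)
  qed
  then show ?thesis by (simp add: fun_eq_iff vec_eq_iff)
qed

definition plus_space :: "'v::real_vector set \<Rightarrow> 'v set \<Rightarrow> 'v set" where
  "plus_space U V = {u + v | u v. u \<in> U \<and> v \<in> V}"

lemma subspace_plus_space: "subspace U \<Longrightarrow> subspace V \<Longrightarrow> subspace (plus_space U V)"
  unfolding plus_space_def by (rule subspace_sums)

lemma plus_space_left: "subspace V \<Longrightarrow> u \<in> U \<Longrightarrow> u \<in> plus_space U V"
  unfolding plus_space_def by (intro CollectI exI[of _ u] exI[of _ 0]) (simp add: subspace_0)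

lemma plus_space_right: "subspace U \<Longrightarrow> v \<in> V \<Longrightarrow> v \<in> plus_space U V"
  unfolding plus_space_def by (intro CollectI exI[of _ 0] exI[of _ v]) (simp add: subspace_0)

lemma x_cross_direct: "direct_sum [vec_fields (polys n), x_cross_hom n] (plus_space (vec_fields (polys n)) (x_cross_hom n))"
  unfolding plus_space_def
proof (rule direct_sum_pair)
  fix u v assume u: "u \<in> vec_fields (polys n)" and v: "v \<in> x_cross_hom n" and uv: "u + v = 0"
  obtain q where q: "q \<in> vec_fields (hom_polys n)" "v = (\<lambda>p. cross3 p (q p))"
    using v by (auto simp: x_cross_hom_def)
  have hom: "q (t *\<^sub>R p) = t ^ n *\<^sub>R q p" for t p
  proof -
    have "q (t *\<^sub>R p) $ i = t ^ n * q p $ i" for i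
      using q(1) by (intro hom_polys_homogeneous[of "\<lambda>p. q p $ i"]) (simp add: vec_fields_def)
    then show ?thesis by (simp add: vec_eq_iff)
  qed
  have "v (t *\<^sub>R p) = t ^ Suc n *\<^sub>R v p" for t p
    unfolding q(2) hom by (simp add: cross_mult_left cross_mult_right)
  then show "v = 0" by (rule polys_hom_direct[OF u _ uv])
qed (simp_all add: subspace_x_cross_hom subspace_vec_fields polys_def)

lemma x_times_direct: "direct_sum [vec_fields (polys n), x_times_hom n] (plus_space (vec_fields (polys n)) (x_times_hom n))"
  unfolding plus_space_def
proof (rule direct_sum_pair)
  fix u v assume u: "u \<in> vec_fields (polys n)" and v: "v \<in> x_times_hom n" and uv: "u + v = 0"
  obtain q where q: "q \<in> hom_polys n" "v = (\<lambda>p. q p *\<^sub>R p)"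
    using v by (auto simp: x_times_hom_def)
  have "v (t *\<^sub>R p) = t ^ Suc n *\<^sub>R v p" for t p
    unfolding q(2) by (simp add: hom_polys_homogeneous[OF q(1)])
  then show "v = 0" by (rule polys_hom_direct[OF u _ uv])
qed (simp_all add: subspace_x_times_hom subspace_vec_fields polys_def)

lemma axis_sum_field: "(v :: real^3 \<Rightarrow> real^3) = (\<Sum>i\<in>UNIV. (\<lambda>p. v p $ i *\<^sub>R axis i 1))"
  using basis_expansion[of "v _"] by (intro ext) (simp add: sum_fun_apply scalar_mult_eq_scaleR)

lemma x_times_hom_span:
  obtains C where "finite C" "x_times_hom n = span C" "card C \<le> (n + 2) choose 2"
proof (rule that)
  let ?C = "(\<lambda>t p. monomial3 t p *\<^sub>R p) ` hom_exponents n"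
  show "finite ?C" by simp
  show "x_times_hom n = span ?C"
    unfolding x_times_hom_def hom_polys_eq linear_span_image[OF radial_field_linear, symmetric]
    by (simp add: image_image)
  show "card ?C \<le> (n + 2) choose 2"
    using card_image_le[of "hom_exponents n"] by (simp add: card_hom_exponents)
qed

text \<open>As \<open>x \<times> m x = 0\<close>, the fields \<open>x \<times> x\<^sub>3 m e\<^sub>3\<close> are combinations of \<open>x \<times> x\<^sub>1 m e\<^sub>1\<close> and
  \<open>x \<times> x\<^sub>2 m e\<^sub>2\<close>.\<close>

lemma x_cross_hom_span:
  obtains C where "finite C" "x_cross_hom n \<subseteq> span C" "card C \<le> 2 * ((n + 2) choose 2) + (n + 1)"
proof (rule that)
  define f where "f = (\<lambda>(i :: 3, t) p. cross3 p (monomial3 t p *\<^sub>R axis i 1))"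
  \<comment> \<open>In the third direction only the \<open>n + 1\<close> monomials without the third
    variable are kept.\<close>
  let ?I = "{1, 2 :: 3} \<times> hom_exponents n" and ?J = "(\<lambda>a. (3 :: 3, (a, n - a, 0 :: nat))) ` {..n}"
  let ?C = "f ` (?I \<union> ?J)"
  show "finite ?C" by simp
  have "card ?C \<le> card (?I \<union> ?J)" by (rule card_image_le) simp
  also have "\<dots> \<le> card ?I + card ?J" by (rule card_Un_le)
  also have "card ?I = 2 * ((n + 2) choose 2)"
    by (simp add: card_cartesian_product card_hom_exponents)
  also have "card ?J \<le> n + 1" by (rule order_trans[OF card_image_le]) simp_all
  finally show "card ?C \<le> 2 * ((n + 2) choose 2) + (n + 1)" by simp
  have 12: "f (i, t) \<in> span ?C" if "i = 1 \<or> i = 2" "t \<in> hom_exponents n" for i t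
    using that by (intro span_base imageI) auto
  have 3: "f (3, t) \<in> span ?C" if t: "t \<in> hom_exponents n" for t
  proof -
    obtain a b c where abc: "t = (a, b, c)" "a + b + c = n" using t by (auto simp: hom_exponents_def)
    show ?thesis
    proof (cases c)
      case 0
      then have "(3, t) = (3, (a, n - a, 0))" "a \<le> n" using abc by auto
      then show ?thesis by (intro span_base imageI) auto
    next
      case (Suc c')
      have "f (3, t) = - f (1, (Suc a, b, c')) - f (2, (a, Suc b, c'))"
        by (intro ext) (simp add: f_def abc Suc monomial3_def cross3_def axis_def vec_eq_iff forall_3 algebra_simps)
      also have "\<dots> \<in> span ?C"
        using abc Suc by (intro span_diff span_neg 12) (auto simp: hom_exponents_def)
      finally show ?thesis .
    qed
  qed
  have f: "f (i, t) \<in> span ?C" if "t \<in> hom_exponents n" for i t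
    using 12[OF _ that] 3[OF that] exhaust_3[of i] by auto
  show "x_cross_hom n \<subseteq> span ?C"
  proof
    fix v assume "v \<in> x_cross_hom n"
    then obtain q where q: "q \<in> vec_fields (hom_polys n)" "v = (\<lambda>p. cross3 p (q p))"
      by (auto simp: x_cross_hom_def)
    have lin: "linear (\<lambda>(g :: real^3 \<Rightarrow> real) p. cross3 p (g p *\<^sub>R axis i 1))" for i
      by (rule linearI) (auto simp: scaleR_add_left cross_add_right cross_mult_right fun_eq_iff)
    have comp: "(\<lambda>p. cross3 p (q p $ i *\<^sub>R axis i 1)) \<in> span ?C" for i
    proof -
      have "(\<lambda>p. q p $ i) \<in> span (monomial3 ` hom_exponents n)"
        using q(1) unfolding hom_polys_eq vec_fields_def by blast
      then have "(\<lambda>p. cross3 p (q p $ i *\<^sub>R axis i 1)) \<in>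
          (\<lambda>g p. cross3 p (g p *\<^sub>R axis i 1)) ` span (monomial3 ` hom_exponents n)"
        by (rule image_eqI[rotated]) simp
      also have "\<dots> = span ((\<lambda>g p. cross3 p (g p *\<^sub>R axis i 1)) ` monomial3 ` hom_exponents n)"
        by (rule linear_span_image[OF lin, symmetric])
      also have "\<dots> \<subseteq> span ?C"
      proof (rule span_minimal, clarify)
        fix a b c assume "(a, b, c) \<in> hom_exponents n"
        from f[OF this, of i] show "(\<lambda>p. cross3 p (monomial3 (a, b, c) p *\<^sub>R axis i 1)) \<in> span ?C"
          by (simp add: f_def)
      qed simp
      finally show ?thesis .
    qed
    have "v = (\<Sum>i\<in>UNIV. (\<lambda>p. cross3 p (q p $ i *\<^sub>R axis i 1)))"
      unfolding q(2) by (subst axis_sum_field[of q]) (simp add: linear_sum[OF cross_field_linear])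
    also have "\<dots> \<in> span ?C" by (intro span_sum comp)
    finally show "v \<in> span ?C" .
  qed
qed

abbreviation "W_cross n \<equiv> plus_space (vec_fields (polys n)) (x_cross_hom n)"
abbreviation "W_times n \<equiv> plus_space (vec_fields (polys n)) (x_times_hom n)"

lemma subspace_vec_polys: "subspace (vec_fields (polys n))"
  by (intro subspace_vec_fields subspace_polys)

lemma subspace_W_cross: "subspace (W_cross n)"
  by (intro subspace_plus_space subspace_vec_polys subspace_x_cross_hom)

lemma subspace_W_times: "subspace (W_times n)"
  by (intro subspace_plus_space subspace_vec_polys subspace_x_times_hom)

lemma polys_scaleR: "g \<in> polys n \<Longrightarrow> (\<lambda>p. g p *\<^sub>R w) \<in> vec_fields (polys n)"
  by (rule scaleR_const_vec_fields[OF subspace_polys])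

lemma polys_mult_fields:
  assumes g: "g \<in> polys m" and v: "v \<in> vec_fields (polys k)"
  shows "(\<lambda>p. g p *\<^sub>R v p) \<in> vec_fields (polys (m + k))"
  using v polys_mult[OF g] by (auto simp: vec_fields_def)

lemma polys_mult_linear_fields:
  "g \<in> polys m \<Longrightarrow> v \<in> vec_fields (polys 1) \<Longrightarrow> (\<lambda>p. g p *\<^sub>R v p) \<in> vec_fields (polys (Suc m))"
  using polys_mult_fields[of g m v 1] unfolding Suc_eq_plus1 .

lemma const_vec_polys: "(\<lambda>_. w) \<in> vec_fields (polys n)"
  using polys_scaleR[OF one_polys, where w=w] by simp

lemma position_polys: "(\<lambda>p. p) \<in> vec_fields (polys 1)"
  by (simp add: vec_fields_def coord_polys)

lemma cross_position_polys: "(\<lambda>p. cross3 b p) \<in> vec_fields (polys 1)"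
proof -
  have "(\<lambda>p. cross3 b p) = (\<Sum>i\<in>UNIV. (\<lambda>p. p $ i *\<^sub>R cross3 b (axis i 1)))"
  proof
    fix p :: "real^3"
    have "cross3 b p = cross3 b (\<Sum>i\<in>UNIV. p $ i *\<^sub>R axis i 1)"
      using basis_expansion[of p] by (simp add: scalar_mult_eq_scaleR)
    then show "cross3 b p = (\<Sum>i\<in>UNIV. (\<lambda>p. p $ i *\<^sub>R cross3 b (axis i 1))) p"
      by (simp add: sum_fun_apply sum_3 cross_add_right cross_mult_right)
  qed
  also have "\<dots> \<in> vec_fields (polys 1)"
    by (intro subspace_sum subspace_vec_polys polys_scaleR coord_polys)
  finally show ?thesis .
qed

text \<open>A monomial below the top degree can absorb a linear factor within degree
  \<open>n\<close>; one of top degree is homogeneous. The two cases match the two summands of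
  \<open>W_cross\<close> and of \<open>W_times\<close>.\<close>

lemma monomial_cases:
  assumes "t \<in> {(a, b, c). a + b + c \<le> n}"
  obtains m where "n = Suc m" "monomial3 t \<in> polys m" | "monomial3 t \<in> hom_polys n"
proof -
  obtain a b c where t: "t = (a, b, c)" "a + b + c \<le> n" using assms by blast
  show ?thesis
  proof (cases "a + b + c = n")
    case True
    then have "monomial3 t \<in> hom_polys n" unfolding t hom_polys_def by (auto intro: span_base)
    then show ?thesis by (rule that(2))
  next
    case False
    then obtain m where "n = Suc m" "a + b + c \<le> m" using t(2) by (cases n) auto
    then show ?thesis using monomial3_polys[of a b c m] t(1) by (intro that(1)) auto
  qed
qed

text \<open>For a monomial of top degree the cross product is reversed and the sign goes to
  \<open>b\<close>, which gives a member of \<open>x_cross_hom\<close>.\<close>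

lemma mult_cross_mem:
  assumes "g \<in> polys n" shows "(\<lambda>p. g p *\<^sub>R cross3 b p) \<in> W_cross n"
proof -
  have lin: "linear (\<lambda>(g :: real^3 \<Rightarrow> real) p. g p *\<^sub>R cross3 b p)"
    by (rule linearI) (auto simp: scaleR_add_left fun_eq_iff)
  have "(\<lambda>p. g p *\<^sub>R cross3 b p) \<in> (\<lambda>g p. g p *\<^sub>R cross3 b p) ` span (monomial3 ` {(a, b, c). a + b + c \<le> n})"
    using assms unfolding polys_def by blast
  also have "\<dots> = span ((\<lambda>g p. g p *\<^sub>R cross3 b p) ` monomial3 ` {(a, b, c). a + b + c \<le> n})"
    by (rule linear_span_image[OF lin, symmetric])
  also have "\<dots> \<subseteq> W_cross n"
  proof (rule span_minimal[OF _ subspace_W_cross], unfold image_image, rule image_subsetI)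
    fix t assume "t \<in> {(a, b, c). a + b + c \<le> n}"
    then show "(\<lambda>p. monomial3 t p *\<^sub>R cross3 b p) \<in> W_cross n"
    proof (cases rule: monomial_cases)
      case (1 m)
      then show ?thesis
        using polys_mult_linear_fields[OF 1(2) cross_position_polys[of b]]
        by (intro plus_space_left subspace_x_cross_hom) simp
    next
      case 2
      have "(\<lambda>p. monomial3 t p *\<^sub>R (- b)) \<in> vec_fields (hom_polys n)"
        using scaleR_const_vec_fields[OF subspace_hom_polys 2] .
      then have "(\<lambda>p. cross3 p (monomial3 t p *\<^sub>R (- b))) \<in> x_cross_hom n"
        unfolding x_cross_hom_def
        by (intro image_eqI[of _ _ "\<lambda>p. monomial3 t p *\<^sub>R (- b)"]) simp_all
      moreover have "(\<lambda>p. cross3 p (monomial3 t p *\<^sub>R (- b))) = (\<lambda>p. monomial3 t p *\<^sub>R cross3 b p)"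
      proof
        fix p
        have "cross3 p (- b) = cross3 b p" using cross_skew[of p b] by simp
        then show "cross3 p (monomial3 t p *\<^sub>R (- b)) = monomial3 t p *\<^sub>R cross3 b p"
          by (simp only: cross_mult_right)
      qed
      ultimately show ?thesis by (intro plus_space_right subspace_vec_polys) simp
    qed
  qed
  finally show ?thesis .
qed

lemma mult_position_mem:
  assumes "g \<in> polys n" shows "(\<lambda>p. g p *\<^sub>R p) \<in> W_times n"
proof -
  have "(\<lambda>p. g p *\<^sub>R p) \<in> (\<lambda>g p. g p *\<^sub>R p) ` span (monomial3 ` {(a, b, c). a + b + c \<le> n})"
    using assms unfolding polys_def by blast
  also have "\<dots> = span ((\<lambda>g p. g p *\<^sub>R p) ` monomial3 ` {(a, b, c). a + b + c \<le> n})"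
    by (rule linear_span_image[OF radial_field_linear, symmetric])
  also have "\<dots> \<subseteq> W_times n"
  proof (rule span_minimal[OF _ subspace_W_times], unfold image_image, rule image_subsetI)
    fix t assume "t \<in> {(a, b, c). a + b + c \<le> n}"
    then show "(\<lambda>p. monomial3 t p *\<^sub>R p) \<in> W_times n"
    proof (cases rule: monomial_cases)
      case (1 m)
      then show ?thesis
        using polys_mult_linear_fields[OF 1(2) position_polys]
        by (intro plus_space_left subspace_x_times_hom) simp
    next
      case 2
      then show ?thesis unfolding x_times_hom_def
        by (intro plus_space_right subspace_vec_polys) blast
    qed
  qed
  finally show ?thesis .
qed

lemma position_diff_mem:
  assumes "g \<in> polys n" shows "(\<lambda>p. g p *\<^sub>R (p - a)) \<in> W_times n"
proof -
  have "(\<lambda>p. g p *\<^sub>R (p - a)) = (\<lambda>p. g p *\<^sub>R p) - (\<lambda>p. g p *\<^sub>R a)"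
    by (intro ext) (simp add: scaleR_diff_right)
  also have "\<dots> \<in> W_times n"
    by (intro subspace_diff subspace_W_times mult_position_mem[OF assms] plus_space_left
        subspace_x_times_hom polys_scaleR[OF assms])
  finally show ?thesis .
qed

lemma position_diff_polys:
  assumes "g \<in> polys n" shows "(\<lambda>p. g p *\<^sub>R (p - a)) \<in> vec_fields (polys (Suc n))"
proof -
  have "(\<lambda>p. p - a) = (\<lambda>p. p) - (\<lambda>_. a)" by (intro ext) simp
  also have "\<dots> \<in> vec_fields (polys 1)"
    by (intro subspace_diff subspace_vec_polys position_polys const_vec_polys)
  finally show ?thesis by (rule polys_mult_linear_fields[OF assms])
qed

lemma Psi_indices_mem:
  assumes "(l, \<alpha>) \<in> Psi_indices n"
  shows "l \<in> {1..4}" "\<alpha> \<in> interior_indices (Suc n) {1..4}" "\<alpha> \<in> indices (Suc n)" "\<alpha> l \<noteq> 0"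
  using assms interior_indices_subset[of "Suc n" "{1..4}"]
  by (auto simp: Psi_indices_def interior_indices_def simp flip: Suc_eq_plus1)

context tetrahedron_choice
begin

lemma vec_H_span:
  obtains C where "finite C" "vec_fields (H n) \<subseteq> span C" "card C \<le> 3 * ((n + 3) choose 3)"
proof (rule that)
  let ?f = "\<lambda>(i :: 3, \<alpha>) p. dpow \<alpha> p *\<^sub>R (axis i 1 :: real^3)"
  let ?C = "?f ` (UNIV \<times> indices n)"
  show "finite ?C" by simp
  have "card ?C \<le> card ((UNIV :: 3 set) \<times> indices n)" by (rule card_image_le) simp
  then show "card ?C \<le> 3 * ((n + 3) choose 3)" by (simp add: card_cartesian_product card_indices)
  show "vec_fields (H n) \<subseteq> span ?C"
  proof
    fix v assume v: "v \<in> vec_fields (H n)"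
    have "(\<lambda>p. v p $ i *\<^sub>R axis i 1) \<in> span ?C" for i
    proof -
      have lin: "linear (\<lambda>(g :: real^3 \<Rightarrow> real) p. g p *\<^sub>R (axis i 1 :: real^3))"
        by (rule scaleR_field_linear)
      have "(\<lambda>p. v p $ i *\<^sub>R axis i 1) \<in> (\<lambda>g p. g p *\<^sub>R (axis i 1 :: real^3)) ` span (dpow ` indices n)"
        using v by (intro image_eqI[of _ _ "\<lambda>p. v p $ i"]) (simp_all add: vec_fields_def H_def)
      also have "\<dots> = span ((\<lambda>g p. g p *\<^sub>R axis i 1) ` dpow ` indices n)"
        by (rule linear_span_image[OF lin, symmetric])
      also have "\<dots> \<subseteq> span ?C"
        by (intro span_mono) force
      finally show ?thesis .
    qed
    then have "(\<Sum>i\<in>UNIV. (\<lambda>p. v p $ i *\<^sub>R axis i 1)) \<in> span ?C" by (intro span_sum)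
    then show "v \<in> span ?C" using axis_sum_field[of v] by simp
  qed
qed

lemma plus_space_span:
  assumes "vec_fields (H n) \<subseteq> span C" "X \<subseteq> span D"
  shows "plus_space (vec_fields (polys n)) X \<subseteq> span (C \<union> D)"
proof -
  have "span C \<subseteq> span (C \<union> D)" "span D \<subseteq> span (C \<union> D)" by (auto intro!: span_mono)
  then show ?thesis
    using assms unfolding plus_space_def H_eq_polys by (blast intro: span_add)
qed

section \<open>Membership of the families\<close>

lemma omega_mem:
  assumes "g \<in> polys n" shows "(\<lambda>p. g p *\<^sub>R omega x i j p) \<in> W_cross n"
proof -
  have "(\<lambda>p. g p *\<^sub>R omega x i j p) = (\<lambda>p. g p *\<^sub>R omega x i j 0) + (\<lambda>p. g p *\<^sub>R cross3 (cross3 (G i) (G j)) p)"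
    by (intro ext) (subst omega_affine, simp add: scaleR_add_right)
  also have "\<dots> \<in> W_cross n"
    by (intro subspace_add subspace_W_cross mult_cross_mem[OF assms] plus_space_left
        subspace_x_cross_hom polys_scaleR[OF assms])
  finally show ?thesis .
qed

lemma omega_polys: "omega x i j \<in> vec_fields (polys 1)"
proof -
  have "omega x i j = (\<lambda>p. bary x i p *\<^sub>R G j) - (\<lambda>p. bary x j p *\<^sub>R G i)"
    by (intro ext) (simp add: omega_eq)
  also have "\<dots> \<in> vec_fields (polys 1)"
    by (intro subspace_diff subspace_vec_polys polys_scaleR bary_polys)
  finally show ?thesis .
qed

lemma dpow_polys: "\<alpha> \<in> indices n \<Longrightarrow> dpow \<alpha> \<in> polys n"
  using dpow_H H_eq_polys by blast

lemma dp_polys: "\<alpha> \<in> indices (Suc n) \<Longrightarrow> dp \<alpha> i \<in> polys n"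
  using dp_H H_eq_polys by blast

lemma grad_dpow_polys: "\<alpha> \<in> indices (Suc n) \<Longrightarrow> grad (dpow \<alpha>) \<in> vec_fields (polys n)"
  unfolding grad_dpow_fun by (intro sum_vec_fields subspace_polys polys_scaleR dp_polys)

lemma grad_cross_polys:
  "\<alpha> \<in> indices (Suc n) \<Longrightarrow> (\<lambda>p. cross3 (grad (dpow \<alpha>) p) w) \<in> vec_fields (polys n)"
  unfolding grad_cross_eq by (intro sum_vec_fields subspace_polys polys_scaleR dp_polys)

lemma grad_bern_fun: "grad (bern x n \<alpha>) = fact n *\<^sub>R grad (dpow \<alpha>)"
  by (intro ext) (simp add: grad_bern)

lemma grad_S_polys: "grad ` S_space x (Suc n) A \<subseteq> vec_fields (polys n)"
  unfolding grad_S_space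
proof (intro span_minimal subspace_vec_polys image_subsetI)
  fix \<alpha> assume "\<alpha> \<in> interior_indices (Suc n) A"
  then have "\<alpha> \<in> indices (Suc n)" using interior_indices_subset by blast
  then show "grad (bern x (Suc n) \<alpha>) \<in> vec_fields (polys n)"
    unfolding grad_bern_fun by (intro subspace_scale subspace_vec_polys grad_dpow_polys)
qed

lemma Phi_fun:
  "Phi x f n \<alpha> = fact (n + 1) *\<^sub>R (real (\<alpha> (f 1)) *\<^sub>R (\<lambda>p. dpow \<alpha> p *\<^sub>R omega x (f 2) (f 3) p)
    + real (\<alpha> (f 2)) *\<^sub>R (\<lambda>p. dpow \<alpha> p *\<^sub>R omega x (f 3) (f 1) p)
    + real (\<alpha> (f 3)) *\<^sub>R (\<lambda>p. dpow \<alpha> p *\<^sub>R omega x (f 1) (f 2) p))"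
  by (intro ext) (simp only: Phi_eq plus_fun_apply scaleR_fun_apply)

lemma E_face_W_cross: "E_face x num rF n F \<subseteq> W_cross n"
  unfolding E_face_def
proof (intro span_minimal subspace_W_cross image_subsetI)
  fix \<alpha> assume "\<alpha> \<in> Phi_indices n F"
  then have "dpow \<alpha> \<in> polys n" using face_indices_subset dpow_polys by blast
  then show "Phi x (num F) n \<alpha> \<in> W_cross n"
    unfolding Phi_fun by (intro subspace_scale subspace_add subspace_W_cross omega_mem)
qed

lemma E_face_polys: "E_face x num rF n F \<subseteq> vec_fields (polys (Suc n))"
  unfolding E_face_def
proof (intro span_minimal subspace_vec_polys image_subsetI)
  fix \<alpha> assume "\<alpha> \<in> Phi_indices n F"
  then have "dpow \<alpha> \<in> polys n" using face_indices_subset dpow_polys by blast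
  then have "(\<lambda>p. dpow \<alpha> p *\<^sub>R omega x i j p) \<in> vec_fields (polys (Suc n))" for i j
    using polys_mult_linear_fields[OF _ omega_polys] by blast
  then show "Phi x (num F) n \<alpha> \<in> vec_fields (polys (Suc n))"
    unfolding Phi_fun by (intro subspace_scale subspace_add subspace_vec_polys)
qed

text \<open>The defining formula only shows polynomial degree \<open>n + 1\<close>. Coefficients of
  degree \<open>n\<close> times \<open>omega\<close> lie in \<open>W_cross n\<close> by
  \<open>omega_mem\<close>, which is what the first kind decomposition needs. The sum over
  \<open>k\<close> uses that the entries of \<alpha> add up to \<open>n + 2\<close>.\<close>

lemma Psi_omega:
  assumes a: "\<alpha> \<in> interior_indices (Suc (Suc n)) {1..4}" and l: "l \<in> {1..4}"
  shows "Psi x (Suc n) l \<alpha> = (fact (Suc n + 1) / real (Suc n + 1)) *\<^sub>R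
    (\<Sum>k=1..4. (\<lambda>p. (if k = l then 0 else dpow (dn (dn \<alpha> l) k) p) *\<^sub>R omega x k l p))"
proof
  fix p
  have pos: "\<alpha> i \<noteq> 0" if "i \<in> {1..4}" for i using a that by (auto simp: interior_indices_def)
  have sum: "(\<Sum>k=1..4. real (\<alpha> k)) = real (Suc n + 1)"
    using a unfolding of_nat_sum[symmetric] by (auto simp: interior_indices_def indices_def)
  have summand: "(if k = l then 0 else dpow (dn (dn \<alpha> l) k) p) *\<^sub>R omega x k l p =
      real (\<alpha> k) *\<^sub>R (dpow (dn \<alpha> l) p *\<^sub>R G l) - real (\<alpha> l) *\<^sub>R (dp \<alpha> k p *\<^sub>R G k)"
    if k: "k \<in> {1..4}" for k
  proof (cases "k = l")
    case True
    then show ?thesis using pos[OF l] by (simp add: dp_def)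
  next
    case False
    have 1: "bary x k p * dpow (dn (dn \<alpha> l) k) p = real (\<alpha> k) * dpow (dn \<alpha> l) p"
      using bary_dp[OF k, of p "dn \<alpha> l"] pos[OF k] False by (simp add: dp_def) (simp add: dn_def)
    have c: "dn (dn \<alpha> l) k = dn (dn \<alpha> k) l" using False by (auto simp: dn_def fun_upd_twist)
    have 2: "bary x l p * dpow (dn (dn \<alpha> l) k) p = real (\<alpha> l) * dp \<alpha> k p"
      using bary_dp[OF l, of p "dn \<alpha> k"] pos[OF k] pos[OF l] False unfolding c
      by (simp add: dp_def) (simp add: dn_def)
    have "dpow (dn (dn \<alpha> l) k) p *\<^sub>R omega x k l p =
        (bary x k p * dpow (dn (dn \<alpha> l) k) p) *\<^sub>R G l - (bary x l p * dpow (dn (dn \<alpha> l) k) p) *\<^sub>R G k"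
      by (simp add: omega_eq scaleR_diff_right mult.commute)
    then show ?thesis using False unfolding 1 2 by simp
  qed
  have "(\<Sum>k=1..4. (if k = l then 0 else dpow (dn (dn \<alpha> l) k) p) *\<^sub>R omega x k l p) =
      (\<Sum>k=1..4. real (\<alpha> k) *\<^sub>R (dpow (dn \<alpha> l) p *\<^sub>R G l) - real (\<alpha> l) *\<^sub>R (dp \<alpha> k p *\<^sub>R G k))"
    by (intro sum.cong refl summand)
  also have "\<dots> = real (Suc n + 1) *\<^sub>R (dpow (dn \<alpha> l) p *\<^sub>R G l) - real (\<alpha> l) *\<^sub>R grad (dpow \<alpha>) p"
    unfolding sum_subtractf scaleR_sum_left[symmetric] scaleR_sum_right[symmetric] sum grad_dpow ..
  finally have s: "(\<Sum>k=1..4. (if k = l then 0 else dpow (dn (dn \<alpha> l) k) p) *\<^sub>R omega x k l p) =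
    real (Suc n + 1) *\<^sub>R (dpow (dn \<alpha> l) p *\<^sub>R G l) - real (\<alpha> l) *\<^sub>R grad (dpow \<alpha>) p" .
  show "Psi x (Suc n) l \<alpha> p = ((fact (Suc n + 1) / real (Suc n + 1)) *\<^sub>R
    (\<Sum>k=1..4. (\<lambda>p. (if k = l then 0 else dpow (dn (dn \<alpha> l) k) p) *\<^sub>R omega x k l p))) p"
    unfolding Psi_eq scaleR_fun_apply sum_fun_apply s by (simp add: scaleR_diff_right del: fact_Suc)
qed

lemma E_cell_W_cross: "E_cell x (Suc n) \<subseteq> W_cross n"
  unfolding E_cell_def
proof (intro span_minimal subspace_W_cross image_subsetI)
  fix q assume "q \<in> Psi_indices (Suc n)"
  then obtain l \<alpha> where q: "q = (l, \<alpha>)" and "(l, \<alpha>) \<in> Psi_indices (Suc n)" by (cases q) auto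
  note m = Psi_indices_mem[OF this(2)]
  have "(\<lambda>p. if k = l then 0 else dpow (dn (dn \<alpha> l) k) p) \<in> polys n" if k: "k \<in> {1..4}" for k
  proof (cases "k = l")
    case True
    then show ?thesis using subspace_0[OF subspace_polys] by (simp add: zero_fun_def)
  next
    case False
    have "\<alpha> k \<noteq> 0" using m(2) k by (auto simp: interior_indices_def)
    then have "dn \<alpha> l k \<noteq> 0" using False by (simp add: dn_def)
    then have "dn (dn \<alpha> l) k \<in> indices n" using m(3,4) by (intro dn_indices)
    then show ?thesis using False dpow_polys by simp
  qed
  then show "(case q of (l, \<alpha>) \<Rightarrow> Psi x (Suc n) l \<alpha>) \<in> W_cross n"
    unfolding q prod.case Psi_omega[OF m(2,1)]
    by (intro subspace_scale subspace_sum subspace_W_cross omega_mem)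
qed

lemma E_cell_polys: "E_cell x n \<subseteq> vec_fields (polys n)"
  unfolding E_cell_def
proof (intro span_minimal subspace_vec_polys image_subsetI)
  fix q assume "q \<in> Psi_indices n"
  then obtain l \<alpha> where q: "q = (l, \<alpha>)" and "(l, \<alpha>) \<in> Psi_indices n" by (cases q) auto
  note m = Psi_indices_mem[OF this(2)]
  have "Psi x n l \<alpha> = fact (n + 1) *\<^sub>R ((\<lambda>p. dpow (dn \<alpha> l) p *\<^sub>R G l) - (real (\<alpha> l) / real (n + 1)) *\<^sub>R grad (dpow \<alpha>))"
    by (intro ext) (simp add: Psi_eq)
  also have "\<dots> \<in> vec_fields (polys n)"
    using m by (intro subspace_scale subspace_diff subspace_vec_polys polys_scaleR dpow_polys
        dn_indices grad_dpow_polys)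
  finally show "(case q of (l, \<alpha>) \<Rightarrow> Psi x n l \<alpha>) \<in> vec_fields (polys n)" unfolding q by simp
qed

lemma curl_E_cell_polys: "curl ` E_cell x (Suc n) \<subseteq> vec_fields (polys n)"
  unfolding E_cell_curl
proof (intro span_minimal subspace_vec_polys image_subsetI)
  fix q assume "q \<in> Psi_indices (Suc n)"
  then obtain l \<alpha> where q: "q = (l, \<alpha>)" and "(l, \<alpha>) \<in> Psi_indices (Suc n)" by (cases q) auto
  note m = Psi_indices_mem[OF this(2)]
  show "(case q of (l, \<alpha>) \<Rightarrow> curl (Psi x (Suc n) l \<alpha>)) \<in> vec_fields (polys n)"
    unfolding q prod.case curl_Psi_fun using m
    by (intro subspace_scale subspace_vec_polys grad_cross_polys dn_indices)
qed

lemma curl_E_face_polys: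
  assumes F: "F \<in> set faces" shows "curl ` E_face x num rF n F \<subseteq> vec_fields (polys n)"
  unfolding E_face_curl[OF F]
proof (intro span_minimal subspace_vec_polys image_subsetI)
  fix \<alpha> assume "\<alpha> \<in> Phi_indices n F"
  then have "\<alpha> \<in> indices n" using face_indices_subset by blast
  then show "curl (Phi x (num F) n \<alpha>) \<in> vec_fields (polys n)"
    unfolding curl_Phi_fun[OF F] face_curl_fun using num_mem[OF F]
    by (intro subspace_scale subspace_add subspace_diff subspace_vec_polys grad_cross_polys up_indices)
qed

lemma Upsilon_fun:
  "Upsilon x n \<alpha> = (fact (n + 1) * - vol 2 3 4) *\<^sub>R (\<Sum>l=1..4. real (\<alpha> l) *\<^sub>R (\<lambda>p. dpow \<alpha> p *\<^sub>R (p - x l)))"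
  by (intro ext) (simp only: Upsilon_eq scaleR_fun_apply sum_fun_apply)

lemma V_cell_W_times: "V_cell x rT n \<subseteq> W_times n"
  unfolding V_cell_def
proof (intro span_minimal subspace_W_times image_subsetI)
  fix \<alpha> assume "\<alpha> \<in> indices n - {rT n}"
  then show "Upsilon x n \<alpha> \<in> W_times n"
    unfolding Upsilon_fun
    by (intro subspace_scale subspace_sum subspace_W_times position_diff_mem dpow_polys) blast
qed

lemma V_cell_polys: "V_cell x rT n \<subseteq> vec_fields (polys (Suc n))"
  unfolding V_cell_def
proof (intro span_minimal subspace_vec_polys image_subsetI)
  fix \<alpha> assume "\<alpha> \<in> indices n - {rT n}"
  then show "Upsilon x n \<alpha> \<in> vec_fields (polys (Suc n))"
    unfolding Upsilon_fun
    by (intro subspace_scale subspace_sum subspace_vec_polys position_diff_polys dpow_polys) blast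
qed

lemma chi_fun: "l \<in> {1..4} \<Longrightarrow> chi x l = ((-1) ^ l * - vol 2 3 4) *\<^sub>R (\<lambda>p. 1 *\<^sub>R (p - x l))"
  by (intro ext) (simp add: chi_eq)

lemma V_low_W_times: "V_low x \<subseteq> W_times n"
  unfolding V_low_def
  by (intro span_minimal subspace_W_times image_subsetI)
    (simp only: chi_fun subspace_scale[OF subspace_W_times] position_diff_mem[OF one_polys])

lemma V_low_polys: "V_low x \<subseteq> vec_fields (polys (Suc n))"
  unfolding V_low_def
  by (intro span_minimal subspace_vec_polys image_subsetI)
    (simp only: chi_fun subspace_scale[OF subspace_vec_polys] position_diff_polys[OF one_polys])

lemma E_low_W_cross: "E_low x \<subseteq> W_cross n"
  unfolding E_low_def
proof (intro span_minimal subspace_W_cross image_subsetI, clarify)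
  fix i j
  show "omega x i j \<in> W_cross n" using omega_mem[OF one_polys, of i j n] by simp
qed

lemma E_low_polys: "E_low x \<subseteq> vec_fields (polys (Suc n))"
  unfolding E_low_def
proof (intro span_minimal subspace_vec_polys image_subsetI, clarify)
  fix i j
  show "omega x i j \<in> vec_fields (polys (Suc n))"
    using omega_polys[of i j] vec_fields_mono[OF polys_mono[of 1 "Suc n"]] by auto
qed

lemma lap_polys:
  assumes a: "\<alpha> \<in> indices n" shows "lap {1..4} \<alpha> \<in> polys n"
  unfolding lap_def
proof (intro subspace_sum subspace_polys)
  fix i j :: nat assume ij: "i \<in> {1..4}" "j \<in> {1..4} - {i}"
  show "(real (\<alpha> i) * real (\<alpha> j + 1)) *\<^sub>R (dpow \<alpha> - dpow (dn (up \<alpha> j) i)) \<in> polys n"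
  proof (cases "\<alpha> i = 0")
    case True
    then show ?thesis using subspace_0[OF subspace_polys] by simp
  next
    case False
    then have "dn (up \<alpha> j) i \<in> indices n"
      using ij by (intro dn_indices up_indices[OF a]) (auto simp: up_def)
    then show ?thesis by (intro subspace_scale subspace_diff subspace_polys dpow_polys a)
  qed
qed

lemma divergence_V_cell_polys: "divergence ` V_cell x rT n \<subseteq> polys n"
  unfolding V_cell_divergence
proof (intro span_minimal subspace_polys image_subsetI)
  fix \<alpha> assume "\<alpha> \<in> indices n - {rT n}"
  then show "divergence (Upsilon x n \<alpha>) \<in> polys n"
    by (simp only: divergence_Upsilon lap_polys subspace_scale[OF subspace_polys] Diff_iff)
qed

lemma S_space_polys: "S_space x n A \<subseteq> polys n"
  unfolding S_space_def bern_scaleR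
  using interior_indices_subset
  by (intro span_minimal subspace_polys image_subsetI subspace_scale dpow_polys) blast

lemma S_low_polys: "S_low x \<subseteq> polys (Suc n)"
  unfolding S_low_def using bary_polys polys_mono[of 1 "Suc n"]
  by (intro span_minimal subspace_polys image_subsetI) auto

end

section \<open>The decompositions\<close>

text \<open>Labels for the summands. Spaces may coincide as sets, for instance when several of them
  are zero, so the sums run over distinct labels and not over the spaces.\<close>

datatype part = Low | Sub "nat set" | Face "nat set" | Cell | Top

definition S_parts :: "part list" where
  "S_parts = [Low] @ map Sub edges @ map Sub faces @ [Sub {1..4}]"

definition E_parts :: "part list" where
  "E_parts = [Low] @ map Sub edges @ concat (map (\<lambda>F. [Sub F, Face F]) faces) @ [Sub {1..4}, Cell]"

definition V_parts :: "part list" where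
  "V_parts = [Low] @ map Face faces @ [Cell, Top]"

text \<open>Vertex sets are encoded as binary numbers, for which distinctness is a
  computation.\<close>

lemma distinct_cells: "distinct (edges @ faces @ [{1..4}])"
proof -
  have i: "{1..4} = {1, 2, 3, 4::nat}" by auto
  have "distinct (map (\<lambda>A. \<Sum>i\<in>A. 2 ^ i :: nat) (edges @ faces @ [{1, 2, 3, 4}]))"
    by (simp add: edges_def faces_def)
  then show ?thesis unfolding i distinct_map by (rule conjunct1)
qed

lemma distinct_faces: "distinct faces"
  using distinct_cells unfolding distinct_append by blast

lemma inj_part: "inj_on Sub X" "inj_on Face X"
  by (simp_all add: inj_on_def)

lemma set_S_parts: "set S_parts = insert Low (Sub ` cells)"
  by (auto simp: S_parts_def)

lemma set_E_parts: "set E_parts = insert Low (insert Cell (Sub ` cells \<union> Face ` set faces))"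
  by (auto simp: E_parts_def)

lemma set_V_parts: "set V_parts = insert Low (insert Cell (insert Top (Face ` set faces)))"
  by (auto simp: V_parts_def)

lemma distinct_S_parts: "distinct S_parts"
proof -
  have eq: "S_parts = Low # map Sub (edges @ faces @ [{1..4}])" by (simp add: S_parts_def)
  have "Low \<notin> set (map Sub X)" for X by auto
  moreover have "distinct (map Sub (edges @ faces @ [{1..4}]))"
    unfolding distinct_map by (intro conjI distinct_cells inj_part)
  ultimately show ?thesis unfolding eq distinct.simps by blast
qed

lemma distinct_V_parts: "distinct V_parts"
proof -
  have "distinct (map Face faces)"
    unfolding distinct_map by (intro conjI distinct_faces inj_part)
  moreover have "Low \<notin> set (map Face X @ [Cell, Top])" "set (map Face X) \<inter> set [Cell, Top] = {}" for X
    by auto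
  ultimately show ?thesis by (simp add: V_parts_def del: set_map)
qed

text \<open>The 17 labels are counted instead of being compared pairwise.\<close>

lemma distinct_E_parts: "distinct E_parts"
proof (rule card_distinct)
  have "card (set E_parts) = Suc (Suc (card (Sub ` cells \<union> Face ` set faces)))"
    unfolding set_E_parts by (subst card_insert_disjoint; auto)+
  also have "card (Sub ` cells \<union> Face ` set faces) = card (Sub ` cells) + card (Face ` set faces)"
    by (rule card_Un_disjoint) auto
  also have "\<dots> = card cells + card (set faces)"
    unfolding card_image[OF inj_part(1)] card_image[OF inj_part(2)] ..
  also have "cells = set (edges @ faces @ [{1..4}])" by auto
  also have "card \<dots> = 11"
    unfolding distinct_card[OF distinct_cells] by (simp add: edges_def faces_def)
  also have "card (set faces) = 4"
    unfolding distinct_card[OF distinct_faces] by (simp add: faces_def)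
  finally show "card (set E_parts) = length E_parts" by (simp add: E_parts_def edges_def faces_def)
qed

lemma sum_cells_parts:
  "sum v (insert Low (insert Cell (Sub ` cells \<union> Face ` set faces))) =
    v Low + (\<Sum>A\<in>cells. v (Sub A)) + (\<Sum>F\<in>set faces. v (Face F)) + (v Cell :: 'a::comm_monoid_add)"
proof -
  have "sum v (Sub ` cells \<union> Face ` set faces) = sum v (Sub ` cells) + sum v (Face ` set faces)"
    by (rule sum.union_disjoint) auto
  also have "sum v (Sub ` cells) = (\<Sum>A\<in>cells. v (Sub A))"
    by (subst sum.reindex) (simp_all add: inj_on_def)
  also have "sum v (Face ` set faces) = (\<Sum>F\<in>set faces. v (Face F))"
    by (subst sum.reindex) (simp_all add: inj_on_def)
  moreover have "sum v (insert Low (insert Cell (Sub ` cells \<union> Face ` set faces))) =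
      v Low + (v Cell + sum v (Sub ` cells \<union> Face ` set faces))"
    by (subst sum.insert, simp, force)+ simp
  ultimately show ?thesis by (simp add: ac_simps)
qed

lemma x_cross_hom_polys: "x_cross_hom n \<subseteq> vec_fields (polys (Suc n))"
proof
  fix v assume "v \<in> x_cross_hom n"
  then obtain q where q: "q \<in> vec_fields (hom_polys n)" "v = (\<lambda>p. cross3 p (q p))"
    by (auto simp: x_cross_hom_def)
  have m: "(\<lambda>p. p $ i * q p $ j) \<in> polys (Suc n)" for i j
  proof -
    have "(\<lambda>p. q p $ j) \<in> polys n" using q(1) hom_polys_subset by (auto simp: vec_fields_def)
    from polys_mult[OF coord_polys this] show ?thesis unfolding plus_1_eq_Suc .
  qed
  have d: "(\<lambda>p. p $ i * q p $ j - p $ k * q p $ l) \<in> polys (Suc n)" for i j k l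
    using subspace_diff[OF subspace_polys m m] by (simp add: fun_diff_def)
  have "(\<lambda>p. cross3 p (q p) $ i) \<in> polys (Suc n)" for i
    using exhaust_3[of i] d by (auto simp: cross3_def)
  then show "v \<in> vec_fields (polys (Suc n))" by (simp add: q(2) vec_fields_def)
qed

lemma x_times_hom_polys: "x_times_hom n \<subseteq> vec_fields (polys (Suc n))"
  unfolding x_times_hom_def
proof (rule image_subsetI)
  fix q assume "q \<in> hom_polys n"
  then have "q \<in> polys n" using hom_polys_subset by blast
  then show "(\<lambda>p. q p *\<^sub>R p) \<in> vec_fields (polys (Suc n))"
    by (rule polys_mult_linear_fields[OF _ position_polys])
qed

lemma plus_space_polys:
  assumes "X \<subseteq> vec_fields (polys (Suc n))"
  shows "plus_space (vec_fields (polys n)) X \<subseteq> vec_fields (polys (Suc n))"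
  using assms vec_fields_mono[OF polys_mono[of n "Suc n"]]
  by (auto simp: plus_space_def intro!: subspace_add[OF subspace_vec_polys])

lemma card_low_edges: "card low_edges = 6"
proof -
  have e: "low_edges = {(1, 2), (1, 3), (1, 4), (2, 3), (2, 4), (3, 4)}"
    by (auto simp: low_edges_def)
  show ?thesis unfolding e by simp
qed

context tetrahedron_choice
begin

section \<open>Bases and direct sums on the tetrahedron\<close>

abbreviation "Tet \<equiv> convex hull (x ` {1..4})"

lemma basis_scalar:
  assumes "indep_family f I" "V = span (f ` I)" "V \<subseteq> polys N" shows "basis_on Tet f I V"
proof (rule basis_onI[OF assms(1,2) subspace_polys])
  show "f ` I \<subseteq> polys N" using assms(2,3) span_superset by blast
  show "w = 0" if "w \<in> polys N" "restr Tet w = 0" for w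
    using that H_restr_eq_0[of w N] by (simp add: H_eq_polys)
qed

lemma vec_polys_restr_eq_0: "w \<in> vec_fields (polys N) \<Longrightarrow> restr Tet w = 0 \<Longrightarrow> w = 0"
  using vec_H_restr_eq_0[of w N] by (simp add: H_eq_polys)

lemma basis_vector:
  assumes "indep_family f I" "V = span (f ` I)" "V \<subseteq> vec_fields (polys N)" shows "basis_on Tet f I V"
proof (rule basis_onI[OF assms(1,2) subspace_vec_polys])
  show "f ` I \<subseteq> vec_fields (polys N)" using assms(2,3) span_superset by blast
qed (rule vec_polys_restr_eq_0)

text \<open>The crude bound \<open>n\<close> also holds in degree 0, where the derivative is zero.
  This covers the bases of gradients and curls for every \<open>n\<close>.\<close>

lemma dp_polys_same: "\<alpha> \<in> indices n \<Longrightarrow> dp \<alpha> i \<in> polys n"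
proof (cases "\<alpha> i = 0")
  case True
  then show ?thesis using subspace_0[OF subspace_polys] by (simp add: dp_def)
next
  case False
  assume a: "\<alpha> \<in> indices n"
  with False obtain m where "n = Suc m" using indices_le[OF a, of i] by (cases n) auto
  then show ?thesis using dp_polys[of \<alpha> m i] a polys_mono[of m n] by auto
qed

lemma grad_S_polys_same: "grad ` S_space x n A \<subseteq> vec_fields (polys n)"
  unfolding grad_S_space grad_bern_fun grad_dpow_fun
  using interior_indices_subset
  by (intro span_minimal subspace_vec_polys image_subsetI subspace_scale sum_vec_fields
      subspace_polys polys_scaleR dp_polys_same) blast

lemma curl_E_cell_polys_same: "curl ` E_cell x n \<subseteq> vec_fields (polys n)"
  unfolding E_cell_curl
proof (intro span_minimal subspace_vec_polys image_subsetI)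
  fix q assume "q \<in> Psi_indices n"
  then obtain l \<alpha> where q: "q = (l, \<alpha>)" and "(l, \<alpha>) \<in> Psi_indices n" by (cases q) auto
  note m = Psi_indices_mem[OF this(2)]
  show "(case q of (l, \<alpha>) \<Rightarrow> curl (Psi x n l \<alpha>)) \<in> vec_fields (polys n)"
    unfolding q prod.case curl_Psi_fun grad_cross_eq using m
    by (intro subspace_scale subspace_vec_polys sum_vec_fields subspace_polys polys_scaleR
        dp_polys_same dn_indices)
qed

lemma basis_W_low: "basis_on Tet (\<lambda>(_::unit) _. 1) UNIV W_low"
proof (rule basis_scalar)
  show "indep_family (\<lambda>(_::unit) (_::real^3). 1 :: real) UNIV"
    by (simp add: indep_family_def UNIV_unit fun_eq_iff)
  show "W_low = span ((\<lambda>(_::unit) _. 1) ` UNIV)" by (simp add: W_low_def UNIV_unit)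
  show "W_low \<subseteq> polys 0"
    unfolding W_low_def using one_polys by (intro span_minimal subspace_polys) simp
qed

text \<open>Restriction is injective on polynomial fields, so one common sum \<open>W\<close> on the
  whole space yields both direct sums on the tetrahedron.\<close>

lemma vec_direct_sums_eq:
  assumes "direct_sum Us W" "direct_sum Vs W" "subspace W" "W \<subseteq> vec_fields (polys N)"
  shows "direct_sums_eq_on Tet Us Vs"
  unfolding direct_sums_eq_on_def
  using assms vec_polys_restr_eq_0[of _ N]
  by (intro exI[of _ "restr Tet ` W"] conjI direct_sum_image[OF restr_linear]) blast+

lemma scalar_direct_sums_eq:
  assumes "direct_sum Us (polys N)" "direct_sum Vs (polys N)"
  shows "direct_sums_eq_on Tet Us Vs"
  unfolding direct_sums_eq_on_def
proof (intro exI[of _ "restr Tet ` polys N"] conjI)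
  have inj: "w = 0" if "w \<in> polys N" "restr Tet w = 0" for w
    using that H_restr_eq_0[of w N] by (simp add: H_eq_polys)
  show "direct_sum (map (image (restr Tet)) Us) (restr Tet ` polys N)"
    by (rule direct_sum_image[OF restr_linear inj subspace_polys assms(1)])
  show "direct_sum (map (image (restr Tet)) Vs) (restr Tet ` polys N)"
    by (rule direct_sum_image[OF restr_linear inj subspace_polys assms(2)])
qed

lemma S_decomposition:
  "direct_sum ([S_low x] @ map (S_space x (Suc n)) edges @ map (S_space x (Suc n)) faces @ [S_space x (Suc n) {1..4}])
    (polys (Suc n))"
proof -
  define V where "V = (\<lambda>t. case t of Low \<Rightarrow> S_low x | Sub A \<Rightarrow> S_space x (Suc n) A | _ \<Rightarrow> {})"
  define d where "d = (\<lambda>t. case t of Low \<Rightarrow> 4 | Sub A \<Rightarrow> card (interior_indices (Suc n) A) | _ \<Rightarrow> 0)"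
  have "direct_sum (map V S_parts) (polys (Suc n))"
  proof (rule direct_sum_dims[OF distinct_S_parts, where d = d and C = "dpow ` indices (Suc n)"])
    show "fin_dim (V j) (d j)" if "j \<in> set S_parts" for j
      using that fin_dim_family[OF bary_indep] fin_dim_family[OF bern_indep]
      by (auto simp: set_S_parts V_def d_def S_low_def S_space_def)
    show "V j \<subseteq> polys (Suc n)" if "j \<in> set S_parts" for j
      using that unfolding set_S_parts
      by (elim insertE imageE) (simp_all add: V_def S_low_polys S_space_polys)
    show "polys (Suc n) \<subseteq> span (dpow ` indices (Suc n))"
      using H_eq_polys[of "Suc n"] by (simp add: H_def)
    show "v j = 0" if v: "\<And>j. j \<in> set S_parts \<Longrightarrow> v j \<in> V j" and s: "(\<Sum>j\<in>set S_parts. v j) = 0"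
      and j: "j \<in> set S_parts" for v j
    proof -
      have "(\<Sum>j\<in>set S_parts. v j) = v Low + sum v (Sub ` cells)"
        unfolding set_S_parts by (rule sum.insert) auto
      also have "sum v (Sub ` cells) = (\<Sum>A\<in>cells. v (Sub A))"
        unfolding sum.reindex[OF inj_part(1)] comp_def ..
      finally have "(\<Sum>j\<in>set S_parts. v j) = v Low + (\<Sum>A\<in>cells. v (Sub A))" .
      then have eq: "v Low + (\<Sum>A\<in>cells. v (Sub A)) = 0" using s by simp
      have "v Low \<in> S_low x" using v[of Low] by (simp add: set_S_parts V_def)
      moreover have "\<And>A. A \<in> cells \<Longrightarrow> v (Sub A) \<in> S_space x (Suc n) A"
        using v[of "Sub _"] by (auto simp: set_S_parts V_def)
      ultimately have "v Low = 0" "\<And>A. A \<in> cells \<Longrightarrow> v (Sub A) = 0"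
        using S_direct[where u="\<lambda>A. v (Sub A)", OF _ _ eq] by blast+
      then show ?thesis using j by (auto simp: set_S_parts)
    qed
    have "card (dpow ` indices (Suc n)) \<le> (Suc n + 3) choose 3"
      using card_image_le[OF finite_indices, of dpow "Suc n"] by (simp add: card_indices)
    moreover have "\<forall>E\<in>set edges. card (interior_indices (Suc n) E) = n"
      "\<forall>F\<in>set faces. card (interior_indices (Suc n) F) = n choose 2"
      using card_interior_edge card_interior_face by blast+
    then have "sum_list (map d S_parts) = 4 + 6 * n + 4 * (n choose 2) + (n choose 3)"
      by (simp add: S_parts_def d_def edges_def faces_def card_interior_cell)
    ultimately show "card (dpow ` indices (Suc n)) \<le> sum_list (map d S_parts)"
      by (simp only: dim_count_S)
  qed (simp_all add: subspace_polys)
  then show ?thesis by (simp add: S_parts_def V_def edges_def faces_def)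
qed

lemma card_Phi_indices:
  "F \<in> set faces \<Longrightarrow> card (Phi_indices n F) = ((n + 2) choose 2) - 1"
  using card_Diff_singleton[OF rF, of F n] card_face_indices_face[of F n] by simp

text \<open>The degrees of the gradients and of the face and cell fields vary separately: the first
  kind takes \<open>m = n\<close>, the second kind \<open>Suc n\<close> and \<open>n\<close>. The
  set \<open>C\<close> bounds the dimension of \<open>W\<close> from above, and
  \<open>Nedelec_direct\<close> bounds it from below.\<close>

lemma E_decomposition:
  assumes sub: "subspace W" and low: "E_low x \<subseteq> W" and grad: "\<And>A. grad ` S_space x (Suc n) A \<subseteq> W"
    and face: "\<And>F. E_face x num rF m F \<subseteq> W" and cell: "E_cell x (Suc m) \<subseteq> W"
    and C: "finite C" "W \<subseteq> span C"
    and card: "card C \<le> 6 + 6 * n + 4 * ((n choose 2) + ((m + 2 choose 2) - 1)) + (n choose 3)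
      + (2 * (Suc m choose 3) + (m choose 2))"
  shows "direct_sum ([E_low x] @ map (\<lambda>E. grad ` S_space x (Suc n) E) edges
          @ concat (map (\<lambda>F. [grad ` S_space x (Suc n) F, E_face x num rF m F]) faces)
          @ [grad ` S_space x (Suc n) {1..4}, E_cell x (Suc m)]) W"
proof -
  define V where "V = (\<lambda>t. case t of Low \<Rightarrow> E_low x | Sub A \<Rightarrow> grad ` S_space x (Suc n) A
    | Face F \<Rightarrow> E_face x num rF m F | Cell \<Rightarrow> E_cell x (Suc m) | Top \<Rightarrow> {})"
  define d where "d = (\<lambda>t. case t of Low \<Rightarrow> 6 | Sub A \<Rightarrow> card (interior_indices (Suc n) A)
    | Face F \<Rightarrow> card (Phi_indices m F) | Cell \<Rightarrow> card (Psi_indices (Suc m)) | Top \<Rightarrow> 0)"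
  have "direct_sum (map V E_parts) W"
  proof (rule direct_sum_dims[OF distinct_E_parts, where d = d and C = C])
    have "fin_dim (E_low x) 6"
      using fin_dim_family[OF omega_indep] by (simp add: E_low_def card_low_edges)
    moreover have "A \<in> cells \<Longrightarrow> fin_dim (grad ` S_space x (Suc n) A) (card (interior_indices (Suc n) A))" for A
      unfolding grad_S_space by (rule fin_dim_family[OF grad_bern_indep])
    moreover have "F \<in> set faces \<Longrightarrow> fin_dim (E_face x num rF m F) (card (Phi_indices m F))" for F
      unfolding E_face_def by (rule fin_dim_family[OF Phi_indep])
    moreover have "fin_dim (E_cell x (Suc m)) (card (Psi_indices (Suc m)))"
      unfolding E_cell_def by (rule fin_dim_family[OF Psi_indep])
    ultimately show "fin_dim (V j) (d j)" if "j \<in> set E_parts" for j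
      using that unfolding set_E_parts by (auto simp: V_def d_def)
    show "V j \<subseteq> W" if "j \<in> set E_parts" for j
      using that low grad face cell by (auto simp: V_def split: part.split)
    show "v j = 0" if v: "\<And>j. j \<in> set E_parts \<Longrightarrow> v j \<in> V j" and s: "(\<Sum>j\<in>set E_parts. v j) = 0"
      and j: "j \<in> set E_parts" for v j
    proof -
      have eq: "v Low + (\<Sum>A\<in>cells. v (Sub A)) + (\<Sum>F\<in>set faces. v (Face F)) + v Cell = 0"
        using s unfolding set_E_parts sum_cells_parts .
      have low: "v Low \<in> E_low x" and cell: "v Cell \<in> E_cell x (m + 1)"
        using v[of Low] v[of Cell] by (simp_all add: set_E_parts V_def flip: Suc_eq_plus1)
      have sub: "\<And>A. A \<in> cells \<Longrightarrow> v (Sub A) \<in> grad ` S_space x (Suc n) A"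
        using v[of "Sub _"] by (auto simp: set_E_parts V_def)
      have face: "\<And>F. F \<in> set faces \<Longrightarrow> v (Face F) \<in> E_face x num rF m F"
        using v[of "Face _"] by (auto simp: set_E_parts V_def)
      note D = Nedelec_direct[OF low _ _ cell eq]
      have "v Low = 0" by (rule D(1)) (fact sub face)+
      moreover have "v Cell = 0" by (rule D(4)) (fact sub face)+
      moreover have "v (Sub A) = 0" if "A \<in> cells" for A by (rule D(2)[OF _ _ that]) (fact sub face)+
      moreover have "v (Face F) = 0" if "F \<in> set faces" for F by (rule D(3)[OF _ _ that]) (fact sub face)+
      ultimately have zero: "v Low = 0" "v Cell = 0" "\<And>A. A \<in> cells \<Longrightarrow> v (Sub A) = 0"
        "\<And>F. F \<in> set faces \<Longrightarrow> v (Face F) = 0" by blast+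
      show ?thesis using j zero unfolding set_E_parts by (elim insertE UnE imageE) simp_all
    qed
    have "\<forall>E\<in>set edges. card (interior_indices (Suc n) E) = n"
      "\<forall>F\<in>set faces. card (interior_indices (Suc n) F) = n choose 2"
      "\<forall>F\<in>set faces. card (Phi_indices m F) = ((m + 2) choose 2) - 1"
      using card_interior_edge card_interior_face card_Phi_indices by blast+
    then have "sum_list (map d E_parts) = 6 + 6 * n + 4 * ((n choose 2) + ((m + 2 choose 2) - 1)) + (n choose 3)
      + (2 * (Suc m choose 3) + (m choose 2))"
      by (simp add: E_parts_def d_def edges_def faces_def card_interior_cell card_Psi_indices del: binomial_Suc_Suc)
    then show "card C \<le> sum_list (map d E_parts)" using card by simp
  qed (fact sub C)+
  then show ?thesis by (simp add: E_parts_def V_def edges_def faces_def)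
qed

text \<open>The degree \<open>m\<close> of the fields with divergence equals \<open>n\<close> for
  the first kind and is one less for the second.\<close>

lemma V_decomposition:
  assumes sub: "subspace W" and low: "V_low x \<subseteq> W"
    and face: "\<And>F. F \<in> set faces \<Longrightarrow> curl ` E_face x num rF n F \<subseteq> W"
    and cell: "curl ` E_cell x (Suc n) \<subseteq> W" and top: "V_cell x rT m \<subseteq> W"
    and C: "finite C" "W \<subseteq> span C"
    and card: "card C \<le> 4 + 4 * ((n + 2 choose 2) - 1) + (2 * (Suc n choose 3) + (n choose 2))
      + ((m + 3 choose 3) - 1)"
  shows "direct_sum ([V_low x] @ map (\<lambda>F. curl ` E_face x num rF n F) faces
    @ [curl ` E_cell x (Suc n), V_cell x rT m]) W"
proof -
  define V where "V = (\<lambda>t. case t of Low \<Rightarrow> V_low x | Sub A \<Rightarrow> {}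
    | Face F \<Rightarrow> curl ` E_face x num rF n F | Cell \<Rightarrow> curl ` E_cell x (Suc n) | Top \<Rightarrow> V_cell x rT m)"
  define d where "d = (\<lambda>t. case t of Low \<Rightarrow> 4 | Sub A \<Rightarrow> 0
    | Face F \<Rightarrow> card (Phi_indices n F) | Cell \<Rightarrow> card (Psi_indices (Suc n)) | Top \<Rightarrow> card (indices m - {rT m}))"
  have "direct_sum (map V V_parts) W"
  proof (rule direct_sum_dims[OF distinct_V_parts, where d = d and C = C])
    have "fin_dim (V_low x) 4"
      using fin_dim_family[OF chi_indep] by (simp add: V_low_def)
    moreover have "F \<in> set faces \<Longrightarrow> fin_dim (curl ` E_face x num rF n F) (card (Phi_indices n F))" for F
      using fin_dim_family[OF curl_Phi_indep] by (simp add: E_face_curl)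
    moreover have "fin_dim (curl ` E_cell x (Suc n)) (card (Psi_indices (Suc n)))"
      unfolding E_cell_curl by (rule fin_dim_family[OF curl_Psi_indep])
    moreover have "fin_dim (V_cell x rT m) (card (indices m - {rT m}))"
      unfolding V_cell_def by (rule fin_dim_family[OF Upsilon_indep])
    ultimately show "fin_dim (V j) (d j)" if "j \<in> set V_parts" for j
      using that unfolding set_V_parts by (auto simp: V_def d_def)
    show "V j \<subseteq> W" if "j \<in> set V_parts" for j
      using that unfolding set_V_parts
      by (elim insertE imageE) (simp_all add: V_def low face cell top)
    show "v j = 0" if v: "\<And>j. j \<in> set V_parts \<Longrightarrow> v j \<in> V j" and s: "(\<Sum>j\<in>set V_parts. v j) = 0"
      and j: "j \<in> set V_parts" for v j
    proof -
      have "(\<Sum>j\<in>set V_parts. v j) = v Low + (v Cell + (v Top + (\<Sum>F\<in>set faces. v (Face F))))"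
        unfolding set_V_parts by (subst sum.insert, simp, force)+ (simp add: sum.reindex inj_on_def)
      then have eq: "v Low + (\<Sum>F\<in>set faces. v (Face F)) + v Cell + v Top = 0"
        using s by (simp add: ac_simps)
      have low: "v Low \<in> V_low x" and cell: "v Cell \<in> curl ` E_cell x (n + 1)"
        and top: "v Top \<in> V_cell x rT m"
        using v[of Low] v[of Cell] v[of Top] by (simp_all add: set_V_parts V_def flip: Suc_eq_plus1)
      have face: "\<And>F. F \<in> set faces \<Longrightarrow> v (Face F) \<in> curl ` E_face x num rF n F"
        using v[of "Face _"] by (auto simp: set_V_parts V_def)
      note D = RT_direct[OF low _ cell top eq]
      have "v Low = 0" by (rule D(1)) (fact face)
      moreover have "v Cell = 0" by (rule D(3)) (fact face)
      moreover have "v Top = 0" by (rule D(4)) (fact face)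
      moreover have "v (Face F) = 0" if "F \<in> set faces" for F by (rule D(2)[OF _ that]) (fact face)
      ultimately have zero: "v Low = 0" "v Cell = 0" "v Top = 0"
        "\<And>F. F \<in> set faces \<Longrightarrow> v (Face F) = 0" by blast+
      show ?thesis using j zero unfolding set_V_parts by (elim insertE UnE imageE) simp_all
    qed
    have "\<forall>F\<in>set faces. card (Phi_indices n F) = ((n + 2) choose 2) - 1"
      using card_Phi_indices by blast
    moreover have "card (indices m - {rT m}) = ((m + 3) choose 3) - 1"
      using card_Diff_singleton[OF rT, of m] by (simp add: card_indices)
    ultimately have "sum_list (map d V_parts) = 4 + 4 * ((n + 2 choose 2) - 1) + (2 * (Suc n choose 3) + (n choose 2))
      + ((m + 3 choose 3) - 1)"
      by (simp add: V_parts_def d_def faces_def card_Psi_indices del: binomial_Suc_Suc)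
    then show "card C \<le> sum_list (map d V_parts)" using card by simp
  qed (fact sub C)+
  then show ?thesis by (simp add: V_parts_def V_def faces_def)
qed

text \<open>The removed index leaves room for exactly the constants: the two sizes add up to the
  number of Bernstein polynomials of degree \<open>n\<close>.\<close>

lemma W_decomposition: "direct_sum [W_low, divergence ` V_cell x rT n] (polys n)"
proof -
  define V where "V = (\<lambda>t. case t of Low \<Rightarrow> W_low | _ \<Rightarrow> divergence ` V_cell x rT n)"
  define d where "d = (\<lambda>t. case t of Low \<Rightarrow> 1 | _ \<Rightarrow> card (indices n - {rT n}))"
  have "direct_sum (map V [Low, Top]) (polys n)"
  proof (rule direct_sum_dims[where d = d and C = "dpow ` indices n"])
    have "indep_family (\<lambda>(_::unit) (_::real^3). 1 :: real) UNIV"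
      by (simp add: indep_family_def UNIV_unit fun_eq_iff)
    from fin_dim_family[OF this] have "fin_dim W_low 1" by (simp add: W_low_def UNIV_unit One_nat_def)
    moreover have "fin_dim (divergence ` V_cell x rT n) (card (indices n - {rT n}))"
      unfolding V_cell_divergence by (rule fin_dim_family[OF divergence_Upsilon_indep_family])
    ultimately show "fin_dim (V j) (d j)" if "j \<in> set [Low, Top]" for j
      using that by (auto simp: V_def d_def)
    have "W_low \<subseteq> polys n" unfolding W_low_def using one_polys by (intro span_minimal subspace_polys) simp
    then show "V j \<subseteq> polys n" if "j \<in> set [Low, Top]" for j
      using that divergence_V_cell_polys[of n] by (auto simp: V_def)
    show "polys n \<subseteq> span (dpow ` indices n)"
      using H_eq_polys[of n] by (simp add: H_def)
    show "v j = 0" if v: "\<And>j. j \<in> set [Low, Top] \<Longrightarrow> v j \<in> V j" and s: "(\<Sum>j\<in>set [Low, Top]. v j) = 0"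
      and j: "j \<in> set [Low, Top]" for v j
    proof -
      have "v Low \<in> span ((\<lambda>(_::unit) _. 1) ` UNIV)" using v[of Low] by (simp add: V_def W_low_def UNIV_unit)
      then obtain k where k: "v Low = (\<lambda>_. k)"
        by (rule span_familyE) (auto simp: UNIV_unit scaleR_fun_def)
      have "v Top \<in> divergence ` V_cell x rT n" using v[of Top] by (simp add: V_def)
      then obtain c where c: "v Top = (\<Sum>\<alpha>\<in>indices n - {rT n}. c \<alpha> *\<^sub>R divergence (Upsilon x n \<alpha>))"
        unfolding V_cell_divergence by (rule span_familyE) simp
      have "v Low + v Top = 0" using s by simp
      then have eq: "(\<Sum>\<alpha>\<in>indices n - {rT n}. c \<alpha> *\<^sub>R divergence (Upsilon x n \<alpha>)) + (\<lambda>_. k) = 0"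
        unfolding k c by (simp only: add.commute)
      have "v Low = 0" unfolding k divergence_Upsilon_indep(1)[OF eq] by (simp add: zero_fun_def)
      moreover have "v Top = 0" unfolding c using divergence_Upsilon_indep(2)[OF eq] by simp
      ultimately show ?thesis using j by auto
    qed
    have "card (dpow ` indices n) \<le> card (indices n)" by (rule card_image_le) simp
    also have "\<dots> = 1 + card (indices n - {rT n})"
      using card_Suc_Diff1[OF finite_indices rT, of n] by simp
    finally show "card (dpow ` indices n) \<le> sum_list (map d [Low, Top])" by (simp add: d_def)
  qed (simp_all add: subspace_polys)
  then show ?thesis by (simp add: V_def)
qed

section \<open>The four decompositions of vector polynomial spaces\<close>

lemma E_first_kind:
  "direct_sums_eq_on Tet [vec_fields (polys n), x_cross_hom n]
    ([E_low x] @ map (\<lambda>E. grad ` S_space x (n + 1) E) edges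
      @ concat (map (\<lambda>F. [grad ` S_space x (n + 1) F, E_face x num rF n F]) faces)
      @ [grad ` S_space x (n + 1) {1..4}, E_cell x (n + 1)])"
proof -
  obtain C where C: "finite C" "vec_fields (H n) \<subseteq> span C" "card C \<le> 3 * ((n + 3) choose 3)"
    by (rule vec_H_span)
  obtain D where D: "finite D" "x_cross_hom n \<subseteq> span D" "card D \<le> 2 * ((n + 2) choose 2) + (n + 1)"
    by (rule x_cross_hom_span)
  have CD: "card (C \<union> D) \<le> 3 * ((n + 3) choose 3) + (2 * ((n + 2) choose 2) + (n + 1))"
    using card_Un_le[of C D] C(3) D(3) by linarith
  have left: "v \<in> W_cross n" if "v \<in> vec_fields (polys n)" for v
    using that by (rule plus_space_left[OF subspace_x_cross_hom])
  show ?thesis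
    unfolding Suc_eq_plus1[symmetric]
  proof (rule vec_direct_sums_eq[OF x_cross_direct E_decomposition subspace_W_cross plus_space_polys[OF x_cross_hom_polys]])
    show "grad ` S_space x (Suc n) A \<subseteq> W_cross n" for A using grad_S_polys left by blast
    show "W_cross n \<subseteq> span (C \<union> D)" by (rule plus_space_span[OF C(2) D(2)])
    show "card (C \<union> D) \<le> 6 + 6 * n + 4 * ((n choose 2) + ((n + 2 choose 2) - 1)) + (n choose 3)
      + (2 * (Suc n choose 3) + (n choose 2))"
      unfolding dim_count_N1 by (rule CD)
  qed (use C(1) D(1) in \<open>simp_all add: subspace_W_cross E_low_W_cross E_face_W_cross E_cell_W_cross\<close>)
qed

lemma E_second_kind:
  "direct_sums_eq_on Tet [vec_fields (polys (Suc n))]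
    ([E_low x] @ map (\<lambda>E. grad ` S_space x (Suc (Suc n)) E) edges
      @ concat (map (\<lambda>F. [grad ` S_space x (Suc (Suc n)) F, E_face x num rF n F]) faces)
      @ [grad ` S_space x (Suc (Suc n)) {1..4}, E_cell x (Suc n)])"
proof -
  obtain C where C: "finite C" "vec_fields (H (Suc n)) \<subseteq> span C" "card C \<le> 3 * ((Suc n + 3) choose 3)"
    by (rule vec_H_span)
  show ?thesis
  proof (rule vec_direct_sums_eq[OF direct_sum_single[OF subspace_vec_polys] E_decomposition subspace_vec_polys subset_refl])
    show "vec_fields (polys (Suc n)) \<subseteq> span C" using C(2) by (simp add: H_eq_polys)
    show "card C \<le> 6 + 6 * Suc n + 4 * ((Suc n choose 2) + ((n + 2 choose 2) - 1)) + (Suc n choose 3)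
      + (2 * (Suc n choose 3) + (n choose 2))"
      unfolding dim_count_N2 by (rule C(3))
  qed (use C(1) in \<open>simp_all add: subspace_vec_polys E_low_polys grad_S_polys E_face_polys E_cell_polys\<close>)
qed

lemma V_first_kind:
  "direct_sums_eq_on Tet [vec_fields (polys n), x_times_hom n]
    ([V_low x] @ map (\<lambda>F. curl ` E_face x num rF n F) faces @ [curl ` E_cell x (n + 1), V_cell x rT n])"
proof -
  obtain C where C: "finite C" "vec_fields (H n) \<subseteq> span C" "card C \<le> 3 * ((n + 3) choose 3)"
    by (rule vec_H_span)
  obtain D where D: "finite D" "x_times_hom n = span D" "card D \<le> (n + 2) choose 2"
    by (rule x_times_hom_span)
  have CD: "card (C \<union> D) \<le> 3 * ((n + 3) choose 3) + ((n + 2) choose 2)"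
    using card_Un_le[of C D] C(3) D(3) by linarith
  have left: "v \<in> W_times n" if "v \<in> vec_fields (polys n)" for v
    using that by (rule plus_space_left[OF subspace_x_times_hom])
  show ?thesis
    unfolding Suc_eq_plus1[symmetric]
  proof (rule vec_direct_sums_eq[OF x_times_direct V_decomposition subspace_W_times plus_space_polys[OF x_times_hom_polys]])
    show "curl ` E_face x num rF n F \<subseteq> W_times n" if "F \<in> set faces" for F
      using curl_E_face_polys[OF that] left by blast
    show "curl ` E_cell x (Suc n) \<subseteq> W_times n" using curl_E_cell_polys left by blast
    show "W_times n \<subseteq> span (C \<union> D)" using D(2) by (intro plus_space_span[OF C(2)]) simp
    show "card (C \<union> D) \<le> 4 + 4 * ((n + 2 choose 2) - 1) + (2 * (Suc n choose 3) + (n choose 2))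
      + ((n + 3 choose 3) - 1)"
      unfolding dim_count_RT1 by (rule CD)
  qed (use C(1) D(1) in \<open>simp_all add: subspace_W_times V_low_W_times V_cell_W_times\<close>)
qed

lemma V_second_kind:
  "direct_sums_eq_on Tet [vec_fields (polys (Suc n))]
    ([V_low x] @ map (\<lambda>F. curl ` E_face x num rF (Suc n) F) faces
      @ [curl ` E_cell x (Suc (Suc n)), V_cell x rT n])"
proof -
  obtain C where C: "finite C" "vec_fields (H (Suc n)) \<subseteq> span C" "card C \<le> 3 * ((Suc n + 3) choose 3)"
    by (rule vec_H_span)
  show ?thesis
  proof (rule vec_direct_sums_eq[OF direct_sum_single[OF subspace_vec_polys] V_decomposition subspace_vec_polys subset_refl])
    show "vec_fields (polys (Suc n)) \<subseteq> span C" using C(2) by (simp add: H_eq_polys)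
    show "card C \<le> 4 + 4 * ((Suc n + 2 choose 2) - 1) + (2 * (Suc (Suc n) choose 3) + (Suc n choose 2))
      + ((n + 3 choose 3) - 1)"
      unfolding dim_count_RT2 by (rule C(3))
  qed (use C(1) in \<open>simp_all add: subspace_vec_polys V_low_polys curl_E_face_polys curl_E_cell_polys V_cell_polys\<close>)
qed

end

theorem theorem1:
  fixes x :: "nat \<Rightarrow> real^3"
    and T :: "(real^3) set"
    and num :: "nat set \<Rightarrow> nat \<Rightarrow> nat"
    and rF :: "nat \<Rightarrow> nat set \<Rightarrow> nat \<Rightarrow> nat"
    and rT :: "nat \<Rightarrow> nat \<Rightarrow> nat"
  assumes nondegenerate: "inj_on x {1..4}" "\<not> affine_dependent (x ` {1..4})"
    and T: "T = convex hull (x ` {1..4})"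
    and num: "\<And>F. F \<in> set faces \<Longrightarrow> F = {num F 1, num F 2, num F 3}"
    and rF: "\<And>n F. F \<in> set faces \<Longrightarrow> rF n F \<in> face_indices n F"
    and rT: "\<And>n. rT n \<in> indices n"
  shows
    "basis_on T (bary x) {1..4} (S_low x) \<and>
     basis_on T (\<lambda>(i, j). omega x i j) low_edges (E_low x) \<and>
     basis_on T (chi x) {1..4} (V_low x) \<and>
     basis_on T (\<lambda>(_::unit) _. 1) UNIV W_low \<and>
     (\<forall>n. \<forall>A \<in> set edges \<union> set faces \<union> {{1..4}}.
        basis_on T (bern x n) (interior_indices n A) (S_space x n A) \<and>
        basis_on T (\<lambda>\<alpha>. grad (bern x n \<alpha>)) (interior_indices n A) (grad ` S_space x n A)) \<and>
     (\<forall>n. \<forall>F \<in> set faces.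
        basis_on T (Phi x (num F) n) (face_indices n F - {rF n F}) (E_face x num rF n F) \<and>
        basis_on T (\<lambda>\<alpha>. curl (Phi x (num F) n \<alpha>)) (face_indices n F - {rF n F}) (curl ` E_face x num rF n F)) \<and>
     (\<forall>n. basis_on T (\<lambda>(l, \<alpha>). Psi x n l \<alpha>) (Psi_indices n) (E_cell x n) \<and>
          basis_on T (\<lambda>(l, \<alpha>). curl (Psi x n l \<alpha>)) (Psi_indices n) (curl ` E_cell x n)) \<and>
     (\<forall>n. basis_on T (Upsilon x n) (indices n - {rT n}) (V_cell x rT n) \<and>
          basis_on T (\<lambda>\<alpha>. divergence (Upsilon x n \<alpha>)) (indices n - {rT n}) (divergence ` V_cell x rT n)) \<and>
     (\<forall>n\<ge>1. direct_sums_eq_on T [polys n]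
        ([S_low x] @ map (S_space x n) edges @ map (S_space x n) faces @ [S_space x n {1..4}])) \<and>
     (\<forall>n. direct_sums_eq_on T [vec_fields (polys n), x_cross_hom n]
        ([E_low x] @ map (\<lambda>E. grad ` S_space x (n + 1) E) edges
          @ concat (map (\<lambda>F. [grad ` S_space x (n + 1) F, E_face x num rF n F]) faces)
          @ [grad ` S_space x (n + 1) {1..4}, E_cell x (n + 1)])) \<and>
     (\<forall>n\<ge>1. direct_sums_eq_on T [vec_fields (polys n)]
        ([E_low x] @ map (\<lambda>E. grad ` S_space x (n + 1) E) edges
          @ concat (map (\<lambda>F. [grad ` S_space x (n + 1) F, E_face x num rF (n - 1) F]) faces)
          @ [grad ` S_space x (n + 1) {1..4}, E_cell x n])) \<and>
     (\<forall>n. direct_sums_eq_on T [vec_fields (polys n), x_times_hom n]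
        ([V_low x] @ map (\<lambda>F. curl ` E_face x num rF n F) faces @ [curl ` E_cell x (n + 1), V_cell x rT n])) \<and>
     (\<forall>n\<ge>1. direct_sums_eq_on T [vec_fields (polys n)]
        ([V_low x] @ map (\<lambda>F. curl ` E_face x num rF n F) faces @ [curl ` E_cell x (n + 1), V_cell x rT (n - 1)])) \<and>
     (\<forall>n. direct_sums_eq_on T [polys n] [W_low, divergence ` V_cell x rT n])"
proof -
  interpret tetrahedron_choice x num rF rT
    using assms by unfold_locales blast+
  show ?thesis
    unfolding T
  proof (intro conjI allI ballI)
    show "basis_on Tet (bary x) {1..4} (S_low x)"
      by (rule basis_scalar[OF bary_indep S_low_def S_low_polys])
    show "basis_on Tet (\<lambda>(i, j). omega x i j) low_edges (E_low x)"
      by (rule basis_vector[OF omega_indep E_low_def E_low_polys])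
    show "basis_on Tet (chi x) {1..4} (V_low x)"
      by (rule basis_vector[OF chi_indep V_low_def V_low_polys])
    show "basis_on Tet (\<lambda>(_::unit) _. 1) UNIV W_low" by (rule basis_W_low)
    show "basis_on Tet (bern x n) (interior_indices n A) (S_space x n A)" for n A
      by (rule basis_scalar[OF bern_indep S_space_def S_space_polys])
    show "basis_on Tet (\<lambda>\<alpha>. grad (bern x n \<alpha>)) (interior_indices n A) (grad ` S_space x n A)"
      if "A \<in> cells" for n A
      by (rule basis_vector[OF grad_bern_indep[OF that] grad_S_space grad_S_polys_same])
    show "basis_on Tet (Phi x (num F) n) (face_indices n F - {rF n F}) (E_face x num rF n F)"
      if "F \<in> set faces" for n F
      by (rule basis_vector[OF Phi_indep[OF that] E_face_def E_face_polys])
    show "basis_on Tet (\<lambda>\<alpha>. curl (Phi x (num F) n \<alpha>)) (face_indices n F - {rF n F}) (curl ` E_face x num rF n F)"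
      if "F \<in> set faces" for n F
      by (rule basis_vector[OF curl_Phi_indep[OF that] E_face_curl[OF that] curl_E_face_polys[OF that]])
    show "basis_on Tet (\<lambda>(l, \<alpha>). Psi x n l \<alpha>) (Psi_indices n) (E_cell x n)" for n
      by (rule basis_vector[OF Psi_indep E_cell_def E_cell_polys])
    show "basis_on Tet (\<lambda>(l, \<alpha>). curl (Psi x n l \<alpha>)) (Psi_indices n) (curl ` E_cell x n)" for n
      by (rule basis_vector[OF curl_Psi_indep E_cell_curl curl_E_cell_polys_same])
    show "basis_on Tet (Upsilon x n) (indices n - {rT n}) (V_cell x rT n)" for n
      by (rule basis_vector[OF Upsilon_indep V_cell_def V_cell_polys])
    show "basis_on Tet (\<lambda>\<alpha>. divergence (Upsilon x n \<alpha>)) (indices n - {rT n}) (divergence ` V_cell x rT n)" for n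
      by (rule basis_scalar[OF divergence_Upsilon_indep_family V_cell_divergence divergence_V_cell_polys])
    show "direct_sums_eq_on Tet [polys n] [W_low, divergence ` V_cell x rT n]" for n
      by (rule scalar_direct_sums_eq[OF direct_sum_single[OF subspace_polys] W_decomposition])
    fix n :: nat
    show "direct_sums_eq_on Tet [vec_fields (polys n), x_cross_hom n]
        ([E_low x] @ map (\<lambda>E. grad ` S_space x (n + 1) E) edges
          @ concat (map (\<lambda>F. [grad ` S_space x (n + 1) F, E_face x num rF n F]) faces)
          @ [grad ` S_space x (n + 1) {1..4}, E_cell x (n + 1)])"
      by (rule E_first_kind)
    show "direct_sums_eq_on Tet [vec_fields (polys n), x_times_hom n]
        ([V_low x] @ map (\<lambda>F. curl ` E_face x num rF n F) faces @ [curl ` E_cell x (n + 1), V_cell x rT n])"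
      by (rule V_first_kind)
    show "1 \<le> n \<longrightarrow> direct_sums_eq_on Tet [polys n]
        ([S_low x] @ map (S_space x n) edges @ map (S_space x n) faces @ [S_space x n {1..4}])"
    proof
      assume "1 \<le> n"
      then obtain m where n: "n = Suc m" by (cases n) auto
      show "direct_sums_eq_on Tet [polys n]
        ([S_low x] @ map (S_space x n) edges @ map (S_space x n) faces @ [S_space x n {1..4}])"
        unfolding n by (rule scalar_direct_sums_eq[OF direct_sum_single[OF subspace_polys] S_decomposition])
    qed
    show "1 \<le> n \<longrightarrow> direct_sums_eq_on Tet [vec_fields (polys n)]
        ([E_low x] @ map (\<lambda>E. grad ` S_space x (n + 1) E) edges
          @ concat (map (\<lambda>F. [grad ` S_space x (n + 1) F, E_face x num rF (n - 1) F]) faces)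
          @ [grad ` S_space x (n + 1) {1..4}, E_cell x n])"
    proof
      assume "1 \<le> n"
      then obtain m where n: "n = m + 1" by (cases n) auto
      show "direct_sums_eq_on Tet [vec_fields (polys n)]
        ([E_low x] @ map (\<lambda>E. grad ` S_space x (n + 1) E) edges
          @ concat (map (\<lambda>F. [grad ` S_space x (n + 1) F, E_face x num rF (n - 1) F]) faces)
          @ [grad ` S_space x (n + 1) {1..4}, E_cell x n])"
        unfolding n add_diff_cancel_right' using E_second_kind[of m] unfolding Suc_eq_plus1 .
    qed
    show "1 \<le> n \<longrightarrow> direct_sums_eq_on Tet [vec_fields (polys n)]
        ([V_low x] @ map (\<lambda>F. curl ` E_face x num rF n F) faces @ [curl ` E_cell x (n + 1), V_cell x rT (n - 1)])"
    proof
      assume "1 \<le> n"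
      then obtain m where n: "n = m + 1" by (cases n) auto
      show "direct_sums_eq_on Tet [vec_fields (polys n)]
        ([V_low x] @ map (\<lambda>F. curl ` E_face x num rF n F) faces @ [curl ` E_cell x (n + 1), V_cell x rT (n - 1)])"
        unfolding n add_diff_cancel_right' using V_second_kind[of m] unfolding Suc_eq_plus1 .
    qed
  qed
qed

end
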